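(* The piecewise constant interpolation $\sigma_\tau$ produced by the splitting scheme satisfies $\|\partial_x\chi'(\sigma_\tau)\|_{L^2((0,T)\times\Omega)}\le C$ for a constant $C$ depending only on $T$ (and the data), and independent of $\tau$.
   Context: Setting. $\Omega\subset\mathbb R$ is a bounded open interval and $T>0$. $BV(\Omega)$ is the space of functions $f:\bar\Omega\to\mathbb R$ with finite total variation $|f|_{BV}:=\sup_P\sum_{i=1}^{|P|-1}|f(x_{i+1})-f(x_i)|$, the supremum over finite partitions $P=\{x_1<\dots<x_{|P|}\}\subset\Omega$. A function $\chi:[0,\infty)\to\mathbb R$ is an internal energy density: $\chi\in C^0([0,\infty))\cap C^2((0,\infty))$, $\chi''>0$ on $(0,\infty)$, $\lim_{h\downarrow0}\chi'(h)=0$, and the integrals $\kappa(x):=\int_1^x\frac{\chi''(s)}{s}\,ds$ and $K(\sigma):=\int_0^\sigma\kappa(x)\,dx$ exist. Put $\mathcal K(\sigma):=\int_\Omega K(\sigma)\,dx$ and $\mathcal E(\rho,\eta):=\int_\Omega\chi(\rho+\eta)\,dx$. The functions $F_1,F_2,G_1,G_2:[0,\infty)^2\to\mathbb R$ are bounded and Lipschitz, with $G_1(0,\eta)\ge0$ for all $\eta\ge0$ and $G_2(\rho,0)\ge0$ for all $\rho\ge0$. For $\sigma\ge0$, $r\in[0,1]$ set $\tilde F_i(\sigma,r)=F_i(r\sigma,(1-r)\sigma)$, $\tilde G_i(\sigma,r)=G_i(r\sigma,(1-r)\sigma)$, $A_1=\tilde F_1+\tilde G_2$, $A_2=\tilde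 G_1+\tilde F_2$, $A_3=\tilde F_1-\tilde F_2$, $\Sigma(\sigma,r)=\sigma(rA_1+(1-r)A_2)$, $R(\sigma,r)=r(1-r)A_3+(1-r)^2\tilde G_1-r^2\tilde G_2$. Initial data: $\rho_0,\eta_0\in BV(\Omega)\cap L^\infty(\Omega)$ nonnegative, $\sigma_0=\rho_0+\eta_0$, and $r_0\in BV(\Omega)$ with $0\le r_0\le1$ and $r_0=\rho_0/\sigma_0$ on $\{\sigma_0>0\}$. For $m>0$, $\mathcal P^m(\Omega)$ is the set of nonnegative Borel measures on $\Omega$ of total mass $m$; $W_p$ ($p=1,2$) is the $p$-Wasserstein distance between measures of equal mass, $W_p^p(\mu,\nu)=\inf_\gamma\int|x-y|^p\,d\gamma$ over couplings $\gamma$ of $\mu,\nu$. Splitting scheme. Fix $\tau\in(0,1)$ and $N\in\mathbb N$ with $N\tau=T$; set $r^0=r_0$, $\sigma^0=\sigma_0$. For $n=0,\dots,N-1$: (Reaction step) for each $x\in\Omega$ solve $\dot\sigma=\Sigma(\sigma,r)$, $\dot r=R(\sigma,r)$ on $[0,\tau]$ with $\sigma(0)=\sigma^n(x)$, $r(0)=r^n(x)$, and set $\sigma^{n+1/2}(x)=\sigma(\tau)$, $r^{n+1/2}(x)=r(\tau)$, $\rho^{n+1/2}=r^{n+1/2}\sigma^{n+1/2}$, $\eta^{n+1/2}=(1-r^{n+1/2})\sigma^{n+1/2}$, $U^{n+1/2}=(\rho^{n+1/2},\eta^{n+1/2})$. (Diffusion step) with $m_1=\int_\Omega\rho^{n+1/2}$,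 $m_2=\int_\Omega\eta^{n+1/2}$, let $U^{n+1}=(\rho^{n+1},\eta^{n+1})$ be a minimiser over $(\rho,\eta)\in\mathcal P^{m_1}(\Omega)\times\mathcal P^{m_2}(\Omega)$ of $\frac1{2\tau}\big[W_2^2(\rho,\rho^{n+1/2})+W_2^2(\eta,\eta^{n+1/2})\big]+\mathcal E(\rho,\eta)$; set $\sigma^{n+1}=\rho^{n+1}+\eta^{n+1}$ and $r^{n+1}=r^{n+1/2}\circ\mathcal T$, where $\mathcal T$ is the nondecreasing optimal transport map pushing $\sigma^{n+1}$ forward to $\sigma^{n+1/2}$. Also $\rho^n=r^n\sigma^n$, $\eta^n=(1-r^n)\sigma^n$, $U^n=(\rho^n,\eta^n)$. Piecewise constant interpolation: for $t\in[n\tau,(n+1)\tau)$, $r_\tau(t)=r^n$, $\sigma_\tau(t)=\sigma^n$, $\rho_\tau(t)=r^n\sigma^n$, $\eta_\tau(t)=(1-r^n)\sigma^n$, $U_\tau=(\rho_\tau,\eta_\tau)$.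
   Formalization: The first interval [0,τ), where σ_τ=σ_0, is left out (the bound covers σ^1,…,σ^N), because σ_0 is only BV and χ'(σ_0) may jump, so ∂_xχ'(σ_0) need not lie in L². *)

theory Defs
  imports "HOL-Analysis.Analysis"
begin

text \<open>Omega is the open interval {a<..<b}; functions on the closure are functions on {a..b}.\<close>

definition total_var :: "(real \<Rightarrow> real) \<Rightarrow> real \<Rightarrow> real \<Rightarrow> ereal" where
  "total_var f a b =
     (SUP xs \<in> {xs. sorted_wrt (<) xs \<and> set xs \<subseteq> {a<..<b}}.
        ereal (\<Sum>i<length xs - 1. \<bar>f (xs ! Suc i) - f (xs ! i)\<bar>))"

definition is_BV :: "(real \<Rightarrow> real) \<Rightarrow> real \<Rightarrow> real \<Rightarrow> bool" where
  "is_BV f a b \<longleftrightarrow> total_var f a b < \<infinity>"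

text \<open>chi' extended by its limit 0 at 0 (chi is only C^0 at 0).\<close>
definition chi1 :: "(real \<Rightarrow> real) \<Rightarrow> real \<Rightarrow> real" where
  "chi1 chi x = (if 0 < x then deriv chi x else 0)"

definition chi2 :: "(real \<Rightarrow> real) \<Rightarrow> real \<Rightarrow> real" where
  "chi2 chi x = deriv (deriv chi) x"

definition kappa :: "(real \<Rightarrow> real) \<Rightarrow> real \<Rightarrow> real" where
  "kappa chi x = (if 1 \<le> x then integral {1..x} (\<lambda>s. chi2 chi s / s)
                  else - integral {x..1} (\<lambda>s. chi2 chi s / s))"

definition internal_energy_density :: "(real \<Rightarrow> real) \<Rightarrow> bool" where
  "internal_energy_density chi \<longleftrightarrow>
     continuous_on {0..} chi \<and>
     (\<forall>x>0. chi differentiable (at x)) \<and>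
     (\<forall>x>0. (deriv chi) differentiable (at x)) \<and>
     continuous_on {0<..} (chi2 chi) \<and>
     (\<forall>x>0. chi2 chi x > 0) \<and>
     ((deriv chi) \<longlongrightarrow> 0) (at_right 0) \<and>
     (\<forall>x>0. (\<lambda>s. chi2 chi s / s) integrable_on {min 1 x..max 1 x}) \<and>
     (\<forall>\<sigma>\<ge>0. kappa chi integrable_on {0..\<sigma>})"

definition bdd_lip :: "(real \<Rightarrow> real \<Rightarrow> real) \<Rightarrow> bool" where
  "bdd_lip F \<longleftrightarrow> bounded ((\<lambda>(u,v). F u v) ` ({0..} \<times> {0..})) \<and>
      (\<exists>L. lipschitz_on L ({0..} \<times> {0..}) (\<lambda>(u,v). F u v))"

definition tilde :: "(real \<Rightarrow> real \<Rightarrow> real) \<Rightarrow> real \<Rightarrow> real \<Rightarrow> real" where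
  "tilde F \<sigma> r = F (r * \<sigma>) ((1 - r) * \<sigma>)"

definition SigmaF :: "(real \<Rightarrow> real \<Rightarrow> real) \<Rightarrow> (real \<Rightarrow> real \<Rightarrow> real) \<Rightarrow>
    (real \<Rightarrow> real \<Rightarrow> real) \<Rightarrow> (real \<Rightarrow> real \<Rightarrow> real) \<Rightarrow> real \<Rightarrow> real \<Rightarrow> real" where
  "SigmaF F1 F2 G1 G2 \<sigma> r =
     \<sigma> * (r * (tilde F1 \<sigma> r + tilde G2 \<sigma> r) + (1 - r) * (tilde G1 \<sigma> r + tilde F2 \<sigma> r))"

definition RF :: "(real \<Rightarrow> real \<Rightarrow> real) \<Rightarrow> (real \<Rightarrow> real \<Rightarrow> real) \<Rightarrow>
    (real \<Rightarrow> real \<Rightarrow> real) \<Rightarrow> (real \<Rightarrow> real \<Rightarrow> real) \<Rightarrow> real \<Rightarrow> real \<Rightarrow> real" where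
  "RF F1 F2 G1 G2 \<sigma> r =
     r * (1 - r) * (tilde F1 \<sigma> r - tilde F2 \<sigma> r) + (1 - r)^2 * tilde G1 \<sigma> r
       - r^2 * tilde G2 \<sigma> r"

text \<open>(s,q) solves sigma' = Sig(sigma,r), r' = R(sigma,r) on [0,tau] with the given
  initial values (staying in the domain sigma >= 0, 0 <= r <= 1 where Sig, R are defined).\<close>
definition reaction_sol ::
  "(real \<Rightarrow> real \<Rightarrow> real) \<Rightarrow> (real \<Rightarrow> real \<Rightarrow> real) \<Rightarrow> real \<Rightarrow> real \<Rightarrow> real \<Rightarrow>
   (real \<Rightarrow> real) \<Rightarrow> (real \<Rightarrow> real) \<Rightarrow> bool" where
  "reaction_sol Sig R \<tau> s0 q0 s q \<longleftrightarrow>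
     s 0 = s0 \<and> q 0 = q0 \<and>
     (\<forall>t\<in>{0..\<tau>}.
        (s has_real_derivative Sig (s t) (q t)) (at t within {0..\<tau>}) \<and>
        (q has_real_derivative R (s t) (q t)) (at t within {0..\<tau>}) \<and>
        0 \<le> s t \<and> 0 \<le> q t \<and> q t \<le> 1)"

definition dens :: "real \<Rightarrow> real \<Rightarrow> (real \<Rightarrow> real) \<Rightarrow> real measure" where
  "dens a b f = density lborel (\<lambda>x. ennreal (f x) * indicator {a<..<b} x)"

definition couplings :: "real measure \<Rightarrow> real measure \<Rightarrow> (real \<times> real) measure set" where
  "couplings \<mu> \<nu> = {\<gamma>. sets \<gamma> = sets (lborel \<Otimes>\<^sub>M lborel) \<and>
       distr \<gamma> lborel fst = \<mu> \<and> distr \<gamma> lborel snd = \<nu>}"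

definition W2sq :: "real measure \<Rightarrow> real measure \<Rightarrow> ennreal" where
  "W2sq \<mu> \<nu> = (INF \<gamma> \<in> couplings \<mu> \<nu>. \<integral>\<^sup>+ z. ennreal ((fst z - snd z)^2) \<partial>\<gamma>)"

text \<open>E(rho,eta) = int_Omega chi(rho+eta) dx, written as
  int (chi(rho+eta) - chi 0) + chi 0 |Omega| so that it is well defined in (-inf,inf].\<close>
definition Energy :: "(real \<Rightarrow> real) \<Rightarrow> real \<Rightarrow> real \<Rightarrow> (real \<Rightarrow> real) \<Rightarrow> (real \<Rightarrow> real) \<Rightarrow> ereal" where
  "Energy chi a b \<rho> \<eta> =
     enn2ereal (\<integral>\<^sup>+ x \<in> {a<..<b}. ennreal (chi (\<rho> x + \<eta> x) - chi 0) \<partial>lborel)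
       + ereal (chi 0 * (b - a))"

definition JKO :: "(real \<Rightarrow> real) \<Rightarrow> real \<Rightarrow> real \<Rightarrow> real \<Rightarrow> (real \<Rightarrow> real) \<Rightarrow> (real \<Rightarrow> real) \<Rightarrow>
    (real \<Rightarrow> real) \<Rightarrow> (real \<Rightarrow> real) \<Rightarrow> ereal" where
  "JKO chi a b \<tau> \<rho>h \<eta>h \<rho> \<eta> =
     enn2ereal ((W2sq (dens a b \<rho>) (dens a b \<rho>h) + W2sq (dens a b \<eta>) (dens a b \<eta>h))
                 / ennreal (2 * \<tau>))
     + Energy chi a b \<rho> \<eta>"

definition admissible :: "real \<Rightarrow> real \<Rightarrow> ennreal \<Rightarrow> (real \<Rightarrow> real) \<Rightarrow> bool" where
  "admissible a b m f \<longleftrightarrow> f \<in> borel_measurable lborel \<and> (\<forall>x\<in>{a..b}. 0 \<le> f x) \<and>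
      emeasure (dens a b f) UNIV = m"

text \<open>The sequences sig n = sigma^n, r n = r^n, sigh n = sigma^(n+1/2), rh n = r^(n+1/2),
  rhoN (n+1), etaN (n+1) = the diffusion minimiser, Tm n = transport map of step n,
  are generated by the splitting scheme with step tau and N steps.\<close>
definition splitting_scheme where
  "splitting_scheme a b chi F1 F2 G1 G2 rho0 eta0 r0 \<tau> N sig r sigh rh rhoN etaN Tm \<longleftrightarrow>
     (\<forall>x\<in>{a..b}. sig 0 x = rho0 x + eta0 x \<and> r 0 x = r0 x) \<and>
     (\<forall>n<N. \<forall>x\<in>{a..b}. \<exists>s q.
         reaction_sol (SigmaF F1 F2 G1 G2) (RF F1 F2 G1 G2) \<tau> (sig n x) (r n x) s q \<and>
         sigh n x = s \<tau> \<and> rh n x = q \<tau>) \<and>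
     (\<forall>n<N.
        let \<rho>h = (\<lambda>x. rh n x * sigh n x); \<eta>h = (\<lambda>x. (1 - rh n x) * sigh n x);
            m1 = emeasure (dens a b \<rho>h) UNIV; m2 = emeasure (dens a b \<eta>h) UNIV in
        admissible a b m1 (rhoN (Suc n)) \<and> admissible a b m2 (etaN (Suc n)) \<and>
        (\<forall>\<rho> \<eta>. admissible a b m1 \<rho> \<longrightarrow> admissible a b m2 \<eta> \<longrightarrow>
            JKO chi a b \<tau> \<rho>h \<eta>h (rhoN (Suc n)) (etaN (Suc n)) \<le> JKO chi a b \<tau> \<rho>h \<eta>h \<rho> \<eta>) \<and>
        (\<forall>x\<in>{a..b}. sig (Suc n) x = rhoN (Suc n) x + etaN (Suc n) x) \<and>
        Tm n \<in> borel_measurable lborel \<and> mono_on {a..b} (Tm n) \<and> Tm n ` {a..b} \<subseteq> {a..b} \<and>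
        distr (dens a b (sig (Suc n))) lborel (Tm n) = dens a b (sigh n) \<and>
        (\<forall>x\<in>{a..b}. r (Suc n) x = rh n (Tm n x)))"

definition test_fun :: "real \<Rightarrow> real \<Rightarrow> (real \<Rightarrow> real) \<Rightarrow> bool" where
  "test_fun a b \<phi> \<longleftrightarrow> (\<forall>k x. ((deriv ^^ k) \<phi>) differentiable (at x)) \<and>
     (\<exists>c d. a < c \<and> d < b \<and> (\<forall>x. x \<notin> {c..d} \<longrightarrow> \<phi> x = 0))"

definition weak_deriv_L2 :: "real \<Rightarrow> real \<Rightarrow> (real \<Rightarrow> real) \<Rightarrow> (real \<Rightarrow> real) \<Rightarrow> bool" where
  "weak_deriv_L2 a b f g \<longleftrightarrow>
     (\<forall>c d. a < c \<longrightarrow> d < b \<longrightarrow> set_integrable lborel {c..d} f) \<and>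
     g \<in> borel_measurable lborel \<and>
     set_integrable lborel {a<..<b} (\<lambda>x. (g x)^2) \<and>
     (\<forall>\<phi>. test_fun a b \<phi> \<longrightarrow>
        (LINT x:{a<..<b}|lborel. f x * deriv \<phi> x) = - (LINT x:{a<..<b}|lborel. g x * \<phi> x))"

end

theory Submission
  imports Defs
begin

text \<open>
  Write s and h for the total density after and before a diffusion step, and T for the monotone map
  with T # s = h. The pair functional is minimised exactly when s minimises the one-species
  functional (int (x - T)^2 s) / (2 tau) + int chi(s). Moving a little mass from x to y in this
  functional gives, for almost all y and almost all x with s(x) > 0,
    chi'(s(x)) + (x - T x)^2 / (2 tau) <= chi'(s(y)) + (y - T x)^2 / (2 tau).
  Hence v = chi'(s) is an upper envelope of parabolas, so it is continuous with derivative
  g = (T - id) / tau on the set s > 0 and g = 0 elsewhere. With S the inverse of T, v(S y) <= v(y),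
  which yields the maximum principle sup s <= sup h. If K is the convex function with K' = kappa,
  then x K'(x) - K(x) = chi'(x), and integrating tangents of K along S gives
    int K(h) - int K(s) >= int (v(y) - v(S y)) dy = int int_{S y}^y g dx dy = tau int g^2.
  Since the reaction step changes s by a factor between exp(-B tau) and exp(B tau), it increases
  int K by O(tau) only, and summing over the steps bounds the sum of tau int g^2.
\<close>

subsection \<open>Internal energy and entropy densities\<close>

locale energy_density =
  fixes chi :: "real \<Rightarrow> real"
  assumes density: "internal_energy_density chi"
begin

abbreviation "dchi \<equiv> chi1 chi"

lemma chi_has_derivative: "0 < x \<Longrightarrow> (chi has_real_derivative dchi x) (at x)"
  using density by (auto simp: internal_energy_density_def chi1_def DERIV_deriv_iff_real_differentiable)

lemma dchi_has_derivative:
  assumes "0 < x" shows "(dchi has_real_derivative chi2 chi x) (at x)"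
proof -
  have "(deriv chi has_real_derivative chi2 chi x) (at x)"
    using density assms
    by (auto simp: internal_energy_density_def chi2_def DERIV_deriv_iff_real_differentiable)
  then show ?thesis
    by (rule has_field_derivative_transform_within_open[where S="{0<..}"])
      (use assms in \<open>auto simp: chi1_def\<close>)
qed

lemma chi2_pos: "0 < x \<Longrightarrow> 0 < chi2 chi x"
  using density by (auto simp: internal_energy_density_def)

lemma dchi_0 [simp]: "dchi 0 = 0"
  by (simp add: chi1_def)

lemma continuous_on_dchi: "continuous_on {0..} dchi"
proof -
  have "continuous (at x within {0..}) dchi" if "x \<in> {0..}" for x
  proof (cases "x = 0")
    case True
    have "(deriv chi \<longlongrightarrow> 0) (at_right 0)"
      using density by (auto simp: internal_energy_density_def)
    then have "(dchi \<longlongrightarrow> 0) (at_right 0)"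
      by (rule Lim_transform_eventually)
        (auto simp: eventually_at_filter chi1_def)
    then show ?thesis
      using True by (simp add: continuous_within at_within_Ici_at_right)
  next
    case False
    with that have "isCont dchi x"
      by (intro DERIV_isCont[OF dchi_has_derivative]) auto
    then show ?thesis by (rule continuous_at_imp_continuous_at_within)
  qed
  then show ?thesis by (auto simp: continuous_on_eq_continuous_within)
qed

lemma dchi_strict_mono: assumes "0 \<le> x" "x < y" shows "dchi x < dchi y"
proof -
  have "continuous_on {x..y} dchi"
    using assms by (intro continuous_on_subset[OF continuous_on_dchi]) auto
  moreover have "\<exists>l. (dchi has_real_derivative l) (at z) \<and> 0 < l" if "x < z" "z < y" for z
    using that assms dchi_has_derivative[of z] chi2_pos[of z] by auto
  ultimately show ?thesis
    using DERIV_pos_imp_increasing_open[OF assms(2)] by blast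
qed

lemma dchi_mono: "0 \<le> x \<Longrightarrow> x \<le> y \<Longrightarrow> dchi x \<le> dchi y"
  using dchi_strict_mono[of x y] by (cases "x = y") auto

lemma dchi_nonneg: "0 \<le> x \<Longrightarrow> 0 \<le> dchi x"
  using dchi_mono[of 0 x] by auto

lemma continuous_on_chi: "continuous_on {0..} chi"
  using density by (auto simp: internal_energy_density_def)

lemma chi_diff_le:
  assumes "0 \<le> x" "0 \<le> y" shows "chi y - chi x \<le> dchi y * (y - x)"
proof -
  consider "x = y" | "x < y" | "y < x" by linarith
  then show ?thesis
  proof cases
    case 2
    have "continuous_on {x..y} chi"
      using assms by (intro continuous_on_subset[OF continuous_on_chi]) auto
    then obtain z where z: "x < z" "z < y" "chi y - chi x = (y - x) * dchi z"
      using mvt[OF 2, of chi "\<lambda>z. (*) (dchi z)"] chi_has_derivative assms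
      by (force simp: has_field_derivative_def algebra_simps)
    then show ?thesis
      using dchi_mono[of z y] assms mult_left_mono[of "dchi z" "dchi y" "y - x"]
      by (simp add: algebra_simps)
  next
    case 3
    have "continuous_on {y..x} chi"
      using assms by (intro continuous_on_subset[OF continuous_on_chi]) auto
    then obtain z where z: "y < z" "z < x" "chi x - chi y = (x - y) * dchi z"
      using mvt[OF 3, of chi "\<lambda>z. (*) (dchi z)"] chi_has_derivative assms
      by (force simp: has_field_derivative_def algebra_simps)
    then show ?thesis
      using dchi_mono[of y z] assms mult_left_mono[of "dchi y" "dchi z" "x - y"]
      by (simp add: algebra_simps)
  qed auto
qed

lemma chi_0_le: "0 \<le> x \<Longrightarrow> chi 0 \<le> chi x"
  using chi_diff_le[of x 0] by auto

lemma chi_mono: "0 \<le> x \<Longrightarrow> x \<le> y \<Longrightarrow> chi x \<le> chi y"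
  using chi_diff_le[of y x] dchi_nonneg[of x] mult_nonneg_nonpos[of "dchi x" "x - y"] by auto

lemma borel_measurable_chi:
  assumes "f \<in> borel_measurable M" "\<And>x. 0 \<le> f x" shows "(\<lambda>x. chi (f x)) \<in> borel_measurable M"
proof -
  have "continuous_on UNIV (\<lambda>x. chi (max 0 x))"
    by (rule continuous_on_compose2[OF continuous_on_chi]) (auto intro!: continuous_intros)
  from borel_measurable_continuous_onI[OF this] assms(1)
  have "(\<lambda>x. chi (max 0 (f x))) \<in> borel_measurable M" by measurable
  then show ?thesis using assms(2) by (simp add: max_def)
qed

lemma borel_measurable_dchi:
  assumes "f \<in> borel_measurable M" "\<And>x. 0 \<le> f x" shows "(\<lambda>x. dchi (f x)) \<in> borel_measurable M"
proof -
  have "continuous_on UNIV (\<lambda>x. dchi (max 0 x))"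
    by (rule continuous_on_compose2[OF continuous_on_dchi]) (auto intro!: continuous_intros)
  from borel_measurable_continuous_onI[OF this] assms(1)
  have "(\<lambda>x. dchi (max 0 (f x))) \<in> borel_measurable M" by measurable
  then show ?thesis using assms(2) by (simp add: max_def)
qed

lemma kappa_has_derivative:
  assumes "0 < x" shows "(kappa chi has_real_derivative chi2 chi x / x) (at x)"
proof -
  define f where "f = (\<lambda>s. chi2 chi s / s)"
  define l where "l = min 1 x / 2"
  define u where "u = max 1 x + 1"
  have l: "0 < l" "l < 1" "l < x" and u: "1 < u" "x < u"
    using assms by (auto simp: l_def u_def)
  have cont: "continuous_on {0<..} f"
    using density by (auto simp: internal_energy_density_def f_def intro!: continuous_intros)
  then have cf: "continuous_on {p..q} f" if "0 < p" for p q
    by (rule continuous_on_subset) (use that in auto)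
  have eq: "integral {l..y} f - integral {l..1} f = kappa chi y" if "y \<in> {l<..<u}" for y
  proof (cases "1 \<le> y")
    case True
    then show ?thesis
      using Henstock_Kurzweil_Integration.integral_combine[of l 1 y f]
        integrable_continuous_real[OF cf[of l y]] l
      by (simp add: kappa_def f_def)
  next
    case False
    then show ?thesis
      using Henstock_Kurzweil_Integration.integral_combine[of l y 1 f]
        integrable_continuous_real[OF cf[of l 1]] l that
      by (simp add: kappa_def f_def)
  qed
  have "((\<lambda>y. integral {l..y} f) has_real_derivative f x) (at x within {l..u})"
    by (rule integral_has_real_derivative[OF cf]) (use l u in auto)
  then have "((\<lambda>y. integral {l..y} f) has_real_derivative f x) (at x)"
    using l u by (simp add: at_within_Icc_at)
  then have "((\<lambda>y. integral {l..y} f - integral {l..1} f) has_real_derivative f x) (at x)"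
    by (auto intro!: derivative_eq_intros)
  then have "(kappa chi has_real_derivative f x) (at x)"
    by (rule has_field_derivative_transform_within_open[where S="{l<..<u}"])
      (use l u eq in auto)
  then show ?thesis by (simp add: f_def)
qed

lemma kappa_1 [simp]: "kappa chi 1 = 0"
  by (simp add: kappa_def)

lemma kappa_mono: assumes "0 < x" "x \<le> y" shows "kappa chi x \<le> kappa chi y"
proof (rule DERIV_nonneg_imp_nondecreasing[OF assms(2)])
  fix z assume "x \<le> z" "z \<le> y"
  then have "0 < z" using assms by simp
  then show "\<exists>l. (kappa chi has_real_derivative l) (at z) \<and> 0 \<le> l"
    using kappa_has_derivative chi2_pos[of z] by (intro exI[of _ "chi2 chi z / z"]) auto
qed

text \<open>The antiderivative of kappa that vanishes at 0, in a closed form that makes its Legendre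
  transform x kappa(x) - entropy(x) visibly equal to chi'(x).\<close>

definition entropy :: "real \<Rightarrow> real" where
  "entropy x = x * kappa chi x - dchi x"

lemma entropy_0 [simp]: "entropy 0 = 0"
  by (simp add: entropy_def)

lemma entropy_has_derivative:
  assumes "0 < x" shows "(entropy has_real_derivative kappa chi x) (at x)"
  unfolding entropy_def[abs_def]
  by (rule derivative_eq_intros kappa_has_derivative[OF assms] dchi_has_derivative[OF assms] refl)+
    (use assms in simp)

lemma entropy_tangent:
  assumes "0 < x" "0 \<le> y" shows "kappa chi x * y - dchi x \<le> entropy y"
proof (cases "y = 0")
  case True
  then show ?thesis using dchi_nonneg[of x] assms by simp
next
  case False
  with assms have y: "0 < y" by simp
  consider "x = y" | "x < y" | "y < x" by linarith
  then have "kappa chi x * (y - x) \<le> entropy y - entropy x"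
  proof cases
    case 2
    then obtain z where z: "x < z" "z < y" "entropy y - entropy x = (y - x) * kappa chi z"
      using MVT2[of x y entropy "kappa chi"] entropy_has_derivative assms by force
    then show ?thesis
      using kappa_mono[of x z] assms mult_left_mono[of "kappa chi x" "kappa chi z" "y - x"]
      by (simp add: algebra_simps)
  next
    case 3
    then obtain z where z: "y < z" "z < x" "entropy x - entropy y = (x - y) * kappa chi z"
      using MVT2[of y x entropy "kappa chi"] entropy_has_derivative y by force
    then show ?thesis
      using kappa_mono[of z x] y mult_left_mono[of "kappa chi z" "kappa chi x" "x - y"]
      by (simp add: algebra_simps)
  qed auto
  then show ?thesis by (simp add: entropy_def algebra_simps)
qed

lemma kappa_times_bounded:
  assumes "0 \<le> x" "x \<le> M" shows "\<bar>x * kappa chi x\<bar> \<le> dchi 1 + \<bar>M\<bar> * \<bar>kappa chi (max 1 M)\<bar>"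
proof (cases "x = 0")
  case True
  then show ?thesis using dchi_nonneg[of 1] by simp
next
  case False
  with assms have x: "0 < x" by simp
  show ?thesis
  proof (cases "1 \<le> x")
    case True
    have "0 \<le> kappa chi x" using kappa_mono[of 1 x] True by simp
    moreover have "kappa chi x \<le> kappa chi (max 1 M)" using kappa_mono[of x "max 1 M"] x assms by simp
    ultimately have "\<bar>x * kappa chi x\<bar> \<le> \<bar>M\<bar> * \<bar>kappa chi (max 1 M)\<bar>"
      unfolding abs_mult using assms by (intro mult_mono) auto
    then show ?thesis using dchi_nonneg[of 1] by simp
  next
    case False
    have "kappa chi x \<le> 0" using kappa_mono[of x 1] False x by simp
    \<comment> \<open>kappa chi 1 = 0, so the tangent of the entropy at 1 is constant\<close>
    moreover have "- dchi 1 \<le> entropy x" using entropy_tangent[of 1 x] x by simp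
    moreover have "0 \<le> dchi x" using dchi_nonneg x by simp
    ultimately have "\<bar>x * kappa chi x\<bar> \<le> dchi 1"
      using x mult_nonneg_nonpos[of x "kappa chi x"] by (simp add: entropy_def)
    then show ?thesis by (simp add: add_increasing2)
  qed
qed

lemma borel_measurable_kappa:
  assumes [measurable]: "f \<in> borel_measurable M" and "\<And>x. 0 \<le> f x"
  shows "(\<lambda>x. f x * kappa chi (f x)) \<in> borel_measurable M"
proof -
  have "continuous_on {0<..} (kappa chi)"
    by (intro DERIV_continuous_on) (use kappa_has_derivative in \<open>auto intro: DERIV_subset\<close>)
  then have [measurable]: "(\<lambda>x. indicator {0<..} x *\<^sub>R kappa chi x) \<in> borel_measurable borel"
    by (intro borel_measurable_continuous_on_indicator) auto
  have "(\<lambda>x. f x * (indicator {0<..} (f x) *\<^sub>R kappa chi (f x))) \<in> borel_measurable M"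
    by measurable
  also have "(\<lambda>x. f x * (indicator {0<..} (f x) *\<^sub>R kappa chi (f x))) = (\<lambda>x. f x * kappa chi (f x))"
  proof
    fix x show "f x * (indicator {0<..} (f x) *\<^sub>R kappa chi (f x)) = f x * kappa chi (f x)"
      using assms(2)[of x] by (cases "f x = 0") (auto simp: indicator_def)
  qed
  finally show ?thesis .
qed

end

subsection \<open>Optimal transport by a monotone map\<close>

locale monotone_map =
  fixes a b :: real and T :: "real \<Rightarrow> real"
  assumes ab: "a < b" and T_mono: "mono T" and T_range: "\<And>x. a \<le> T x" "\<And>x. T x \<le> b"
begin

definition S :: "real \<Rightarrow> real" where
  "S y = Sup (insert a {x \<in> {a..b}. T x \<le> y})"

lemma S_range: "a \<le> S y" "S y \<le> b"
  unfolding S_def using ab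
  by (auto intro!: cSup_upper bdd_aboveI[of _ b] cSup_least)

lemma S_mono: "mono S"
proof
  fix x y :: real assume "x \<le> y"
  then show "S x \<le> S y"
    unfolding S_def using ab by (intro cSup_subset_mono bdd_aboveI[of _ b]) auto
qed

lemma S_measurable [measurable]: "S \<in> borel_measurable borel"
  by (rule borel_measurable_mono[OF S_mono])

lemma T_measurable [measurable]: "T \<in> borel_measurable borel"
  by (rule borel_measurable_mono[OF T_mono])

lemma T_le_of_less_S: assumes "a \<le> x" "x < S y" shows "T x \<le> y"
proof -
  obtain z where z: "z \<in> insert a {x \<in> {a..b}. T x \<le> y}" "x < z"
    using less_cSupD[of "insert a {x \<in> {a..b}. T x \<le> y}" x] assms by (auto simp: S_def)
  with assms have "T z \<le> y" by auto
  then show ?thesis using monoD[OF T_mono, of x z] z by simp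
qed

lemma less_T_of_S_less: assumes "S y < x" "x \<le> b" shows "y < T x"
proof (rule ccontr)
  assume "\<not> y < T x"
  moreover have "a \<le> x" using S_range[of y] assms by simp
  ultimately have "x \<in> insert a {x \<in> {a..b}. T x \<le> y}" using assms by auto
  then have "x \<le> S y"
    unfolding S_def using ab by (intro cSup_upper bdd_aboveI[of _ b]) auto
  then show False using assms by simp
qed

lemma le_S_T: assumes "x \<in> {a..b}" shows "x \<le> S (T x)"
  using less_T_of_S_less[of "T x" x] assms by force

text \<open>T is the derivative of the convex function phi, and psi is its Legendre transform, attained
  at the generalised inverse S. Equality in Young's inequality on the graph of T makes
  x^2 - 2 phi(x) and y^2 - 2 psi(y) optimal Kantorovich potentials.\<close>

definition phi :: "real \<Rightarrow> real" where
  "phi x = integral {a..x} T"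

lemma T_integrable: "T integrable_on {x..y}"
  by (rule integrable_on_mono_on) (use T_mono in \<open>auto simp: monotone_on_def\<close>)

lemma phi_diff: "a \<le> x \<Longrightarrow> x \<le> y \<Longrightarrow> phi y - phi x = integral {x..y} T"
  using Henstock_Kurzweil_Integration.integral_combine[of a x y T] T_integrable[of a y]
  by (simp add: phi_def)

lemma integral_T_le:
  assumes "x \<le> y" "\<And>z. x < z \<Longrightarrow> z < y \<Longrightarrow> T z \<le> c" shows "integral {x..y} T \<le> c * (y - x)"
proof -
  have "integral {x<..<y} T \<le> integral {x<..<y} (\<lambda>z. c)"
    using T_integrable[of x y] assms(2)
    by (intro integral_le) (auto simp: integrable_on_open_interval_real integrable_const_ivl)
  also have "\<dots> = c * (y - x)"
    using assms(1) by (simp flip: integral_open_interval_real)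
  finally show ?thesis by (simp add: integral_open_interval_real)
qed

lemma integral_T_ge:
  assumes "x \<le> y" "\<And>z. x < z \<Longrightarrow> z < y \<Longrightarrow> c \<le> T z" shows "c * (y - x) \<le> integral {x..y} T"
proof -
  have "integral {x<..<y} (\<lambda>z. c) \<le> integral {x<..<y} T"
    using T_integrable[of x y] assms(2)
    by (intro integral_le) (auto simp: integrable_on_open_interval_real integrable_const_ivl)
  moreover have "integral {x<..<y} (\<lambda>z. c) = c * (y - x)"
    using assms(1) by (simp flip: integral_open_interval_real)
  ultimately show ?thesis by (simp add: integral_open_interval_real)
qed

definition psi :: "real \<Rightarrow> real" where
  "psi y = y * S y - phi (S y)"

lemma young: assumes "x \<in> {a..b}" shows "x * y \<le> phi x + psi y"
proof (cases "x \<le> S y")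
  case True
  have "integral {x..S y} T \<le> y * (S y - x)"
    using True assms by (intro integral_T_le T_le_of_less_S) auto
  then show ?thesis
    using phi_diff[of x "S y"] True assms by (simp add: psi_def algebra_simps)
next
  case False
  have "y * (x - S y) \<le> integral {S y..x} T"
    using False assms by (intro integral_T_ge less_imp_le[OF less_T_of_S_less]) auto
  then show ?thesis
    using phi_diff[of "S y" x] False assms S_range[of y] by (simp add: psi_def algebra_simps)
qed

lemma young_eq: assumes "x \<in> {a..b}" shows "x * T x = phi x + psi (T x)"
proof (rule antisym[OF young[OF assms]])
  have "T x * (S (T x) - x) \<le> integral {x..S (T x)} T"
    using le_S_T[OF assms] by (intro integral_T_ge monoD[OF T_mono]) auto
  then show "phi x + psi (T x) \<le> x * T x"
    using phi_diff[of x "S (T x)"] le_S_T[OF assms] assms by (simp add: psi_def algebra_simps)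
qed

lemma phi_lipschitz:
  assumes "x \<in> {a..b}" "y \<in> {a..b}" shows "\<bar>phi x - phi y\<bar> \<le> (\<bar>a\<bar> + \<bar>b\<bar>) * \<bar>x - y\<bar>"
proof -
  have *: "\<bar>phi y - phi x\<bar> \<le> (\<bar>a\<bar> + \<bar>b\<bar>) * (y - x)" if "x \<in> {a..b}" "y \<in> {a..b}" "x \<le> y" for x y
  proof -
    have "integral {x..y} T \<le> b * (y - x)" "a * (y - x) \<le> integral {x..y} T"
      using that T_range by (auto intro: integral_T_le integral_T_ge)
    moreover have "b * (y - x) \<le> (\<bar>a\<bar> + \<bar>b\<bar>) * (y - x)" "- (\<bar>a\<bar> + \<bar>b\<bar>) * (y - x) \<le> a * (y - x)"
      using that by (auto intro!: mult_right_mono)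
    ultimately have "integral {x..y} T \<le> (\<bar>a\<bar> + \<bar>b\<bar>) * (y - x)"
      "- integral {x..y} T \<le> (\<bar>a\<bar> + \<bar>b\<bar>) * (y - x)"
      by (auto simp: algebra_simps)
    then show ?thesis using phi_diff[of x y] that by (simp add: abs_le_iff)
  qed
  show ?thesis
    using *[of x y] *[of y x] assms by (cases "x \<le> y") (auto simp: abs_minus_commute)
qed

lemma potentials:
  obtains \<alpha> \<beta> :: "real \<Rightarrow> real" and c :: real where
    "\<alpha> \<in> borel_measurable borel" "\<beta> \<in> borel_measurable borel" "\<And>x. 0 \<le> \<alpha> x" "\<And>y. 0 \<le> \<beta> y" "0 \<le> c"
    "\<And>x y. x \<in> {a..b} \<Longrightarrow> y \<in> {a..b} \<Longrightarrow> \<alpha> x + \<beta> y \<le> (x - y)\<^sup>2 + c"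
    "\<And>x. x \<in> {a..b} \<Longrightarrow> \<alpha> x + \<beta> (T x) = (x - T x)\<^sup>2 + c"
proof -
  define L where "L = \<bar>a\<bar> + \<bar>b\<bar>"
  have contphi: "continuous_on {a..b} phi"
    by (rule lipschitz_on_continuous_on[of L])
      (use phi_lipschitz in \<open>auto simp: lipschitz_on_def L_def dist_real_def\<close>)
  have contphi': "continuous_on UNIV (\<lambda>x. phi (max a (min b x)))"
    by (rule continuous_on_compose2[OF contphi]) (use ab in \<open>auto intro!: continuous_intros\<close>)
  have [measurable]: "(\<lambda>x. phi (max a (min b x))) \<in> borel_measurable borel"
    by (rule borel_measurable_continuous_onI[OF contphi'])
  obtain B where B: "\<And>x. x \<in> {a..b} \<Longrightarrow> \<bar>phi x\<bar> \<le> B"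
    using compact_imp_bounded[OF compact_continuous_image[OF contphi compact_Icc]]
    unfolding bounded_iff by (metis imageI real_norm_def)
  define A where "A x = max 0 (x\<^sup>2 - 2 * phi (max a (min b x)) + 2 * B)" for x
  define C where "C y = max 0 (y\<^sup>2 - 2 * (y * S y - phi (max a (min b (S y)))) + 2 * (B + L * L))" for y
  have Aeq: "A x = x\<^sup>2 - 2 * phi x + 2 * B" if "x \<in> {a..b}" for x
  proof -
    have "max a (min b x) = x" using that by simp
    moreover have "0 \<le> x\<^sup>2 - 2 * phi x + 2 * B" using B[OF that] zero_le_power2[of x] by linarith
    ultimately show ?thesis by (simp add: A_def)
  qed
  have Ceq: "C y = y\<^sup>2 - 2 * psi y + 2 * (B + L * L)" if "y \<in> {a..b}" for y
  proof -
    have "\<bar>y * S y\<bar> \<le> L * L"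
      unfolding abs_mult using S_range[of y] that by (intro mult_mono) (auto simp: L_def)
    moreover have "\<bar>phi (S y)\<bar> \<le> B" using B[of "S y"] S_range[of y] by simp
    moreover have "max a (min b (S y)) = S y" using S_range[of y] by (simp add: max_def min_def)
    moreover have "0 \<le> y\<^sup>2" by simp
    ultimately have "0 \<le> y\<^sup>2 - 2 * (y * S y - phi (S y)) + 2 * (B + L * L)"
      by (smt (verit, best))
    then show ?thesis
      using \<open>max a (min b (S y)) = S y\<close> by (simp add: C_def psi_def)
  qed
  have "0 \<le> B" using B[of a] ab by (simp add: abs_le_iff)
  show ?thesis
  proof (rule that[of A C "2 * B + 2 * (B + L * L)"])
    show "A \<in> borel_measurable borel" unfolding A_def[abs_def] by measurable
    show "C \<in> borel_measurable borel" unfolding C_def[abs_def]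
      by (intro borel_measurable_max borel_measurable_add borel_measurable_diff borel_measurable_times
          measurable_compose[OF S_measurable \<open>(\<lambda>x. phi (max a (min b x))) \<in> borel_measurable borel\<close>]) measurable
    show "0 \<le> 2 * B + 2 * (B + L * L)" using \<open>0 \<le> B\<close> by simp
    show "A x + C y \<le> (x - y)\<^sup>2 + (2 * B + 2 * (B + L * L))" if "x \<in> {a..b}" "y \<in> {a..b}" for x y
      using young[of x y] that by (simp add: Aeq Ceq power2_diff)
    show "A x + C (T x) = (x - T x)\<^sup>2 + (2 * B + 2 * (B + L * L))" if "x \<in> {a..b}" for x
      using young_eq[of x] that T_range[of x] by (simp add: Aeq Ceq power2_diff)
  qed (auto simp: A_def C_def)
qed

end

lemma coupling_nn_integral:
  assumes "\<gamma> \<in> couplings \<mu> \<nu>" and [measurable]: "f \<in> borel_measurable borel"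
  shows "(\<integral>\<^sup>+z. f (fst z) \<partial>\<gamma>) = (\<integral>\<^sup>+x. f x \<partial>\<mu>)" "(\<integral>\<^sup>+z. f (snd z) \<partial>\<gamma>) = (\<integral>\<^sup>+x. f x \<partial>\<nu>)"
proof -
  have [measurable_cong]: "sets \<gamma> = sets (lborel \<Otimes>\<^sub>M lborel)"
    and "distr \<gamma> lborel fst = \<mu>" "distr \<gamma> lborel snd = \<nu>"
    using assms by (auto simp: couplings_def)
  then show "(\<integral>\<^sup>+z. f (fst z) \<partial>\<gamma>) = (\<integral>\<^sup>+x. f x \<partial>\<mu>)" "(\<integral>\<^sup>+z. f (snd z) \<partial>\<gamma>) = (\<integral>\<^sup>+x. f x \<partial>\<nu>)"
    by (auto simp: nn_integral_distr)
qed

lemma coupling_AE: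
  assumes "\<gamma> \<in> couplings \<mu> \<nu>" and [measurable]: "Measurable.pred borel P"
  shows "(AE x in \<mu>. P x) \<Longrightarrow> AE z in \<gamma>. P (fst z)" "(AE y in \<nu>. P y) \<Longrightarrow> AE z in \<gamma>. P (snd z)"
proof -
  have [measurable_cong]: "sets \<gamma> = sets (lborel \<Otimes>\<^sub>M lborel)"
    and "distr \<gamma> lborel fst = \<mu>" "distr \<gamma> lborel snd = \<nu>"
    using assms by (auto simp: couplings_def)
  then show "(AE x in \<mu>. P x) \<Longrightarrow> AE z in \<gamma>. P (fst z)" "(AE y in \<nu>. P y) \<Longrightarrow> AE z in \<gamma>. P (snd z)"
    by (auto simp: AE_distr_iff)
qed

abbreviation plan_cost :: "(real \<times> real) measure \<Rightarrow> ennreal" where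
  "plan_cost \<gamma> \<equiv> \<integral>\<^sup>+z. ennreal ((fst z - snd z)\<^sup>2) \<partial>\<gamma>"

abbreviation total_energy :: "(real \<Rightarrow> real) \<Rightarrow> (real \<Rightarrow> real) \<Rightarrow> ennreal" where
  "total_energy chi u \<equiv> \<integral>\<^sup>+x. ennreal (chi (u x) - chi 0) \<partial>lborel"

lemma W2sq_le: "\<gamma> \<in> couplings \<mu> \<nu> \<Longrightarrow> W2sq \<mu> \<nu> \<le> plan_cost \<gamma>"
  unfolding W2sq_def by (rule INF_lower)

lemma W2sq_ge_potentials:
  fixes p q \<alpha> \<beta> :: "real \<Rightarrow> real" and c :: real
  assumes [measurable]: "p \<in> borel_measurable borel" "q \<in> borel_measurable borel"
      "\<alpha> \<in> borel_measurable borel" "\<beta> \<in> borel_measurable borel"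
    and supp: "\<And>x. x \<notin> {a..b} \<Longrightarrow> p x = 0" "\<And>x. x \<notin> {a..b} \<Longrightarrow> q x = 0"
    and nonneg: "\<And>x. 0 \<le> \<alpha> x" "\<And>y. 0 \<le> \<beta> y" "0 \<le> c"
    and le: "\<And>x y. x \<in> {a..b} \<Longrightarrow> y \<in> {a..b} \<Longrightarrow> \<alpha> x + \<beta> y \<le> (x - y)\<^sup>2 + c"
    and fin: "(\<integral>\<^sup>+x. ennreal (p x) \<partial>lborel) < \<infinity>"
  shows "(\<integral>\<^sup>+x. ennreal (\<alpha> x) * ennreal (p x) \<partial>lborel) + (\<integral>\<^sup>+y. ennreal (\<beta> y) * ennreal (q y) \<partial>lborel)
    \<le> W2sq (density lborel p) (density lborel q) + ennreal c * (\<integral>\<^sup>+x. ennreal (p x) \<partial>lborel)"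
    (is "?A \<le> ?W + ?k")
proof -
  have k: "?k < \<infinity>" using fin by (simp add: ennreal_mult_less_top)
  have "?A - ?k \<le> ?W"
    unfolding W2sq_def
  proof (rule INF_greatest)
    fix \<gamma> assume \<gamma>: "\<gamma> \<in> couplings (density lborel p) (density lborel q)"
    then have [measurable_cong]: "sets \<gamma> = sets (lborel \<Otimes>\<^sub>M lborel)" by (auto simp: couplings_def)
    have "AE z in \<gamma>. fst z \<in> {a..b}"
      proof (rule coupling_AE(1)[OF \<gamma>])
      have "0 < p x \<Longrightarrow> x \<in> {a..b}" for x using supp(1)[of x] by force
      then show "AE x in density lborel p. x \<in> {a..b}" by (simp add: AE_density)
    qed measurable
    moreover have "AE z in \<gamma>. snd z \<in> {a..b}"
      proof (rule coupling_AE(2)[OF \<gamma>])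
      have "0 < q x \<Longrightarrow> x \<in> {a..b}" for x using supp(2)[of x] by force
      then show "AE x in density lborel q. x \<in> {a..b}" by (simp add: AE_density)
    qed measurable
    ultimately have AE: "AE z in \<gamma>. ennreal (\<alpha> (fst z)) + ennreal (\<beta> (snd z))
        \<le> ennreal ((fst z - snd z)\<^sup>2) + ennreal c"
      by eventually_elim (use le nonneg in \<open>auto simp flip: ennreal_plus\<close>)
    have "?A = (\<integral>\<^sup>+z. ennreal (\<alpha> (fst z)) \<partial>\<gamma>) + (\<integral>\<^sup>+z. ennreal (\<beta> (snd z)) \<partial>\<gamma>)"
      using coupling_nn_integral(1)[OF \<gamma>, of "\<lambda>x. ennreal (\<alpha> x)"]
        coupling_nn_integral(2)[OF \<gamma>, of "\<lambda>x. ennreal (\<beta> x)"]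
      by (simp add: nn_integral_density mult.commute)
    also have "\<dots> = (\<integral>\<^sup>+z. ennreal (\<alpha> (fst z)) + ennreal (\<beta> (snd z)) \<partial>\<gamma>)"
      by (rule nn_integral_add[symmetric]) measurable
    also have "\<dots> \<le> (\<integral>\<^sup>+z. ennreal ((fst z - snd z)\<^sup>2) + ennreal c \<partial>\<gamma>)"
      by (rule nn_integral_mono_AE[OF AE])
    also have "\<dots> = plan_cost \<gamma> + (\<integral>\<^sup>+z. ennreal c \<partial>\<gamma>)"
      by (rule nn_integral_add) measurable
    also have "(\<integral>\<^sup>+z. ennreal c \<partial>\<gamma>) = ?k"
      using coupling_nn_integral(1)[OF \<gamma>, of "\<lambda>x. ennreal c"]
      by (simp add: nn_integral_density nn_integral_cmult emeasure_density mult.commute)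
    finally show "?A - ?k \<le> plan_cost \<gamma>"
      using k by (auto simp: ennreal_minus_le_iff add.commute)
  qed
  then show ?thesis using k by (auto simp: ennreal_minus_le_iff add.commute)
qed

locale transport = monotone_map +
  fixes s h :: "real \<Rightarrow> real"
  assumes s_meas [measurable]: "s \<in> borel_measurable borel"
    and h_meas [measurable]: "h \<in> borel_measurable borel"
    and s_nonneg: "\<And>x. 0 \<le> s x" and h_nonneg: "\<And>x. 0 \<le> h x"
    and s_out: "\<And>x. x \<notin> {a<..<b} \<Longrightarrow> s x = 0" and h_out: "\<And>x. x \<notin> {a<..<b} \<Longrightarrow> h x = 0"
    and push: "distr (density lborel s) lborel T = density lborel h"
    and s_fin: "(\<integral>\<^sup>+x. ennreal (s x) \<partial>lborel) < \<infinity>"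
begin

abbreviation cost :: ennreal where
  "cost \<equiv> \<integral>\<^sup>+x. ennreal ((x - T x)\<^sup>2) * ennreal (s x) \<partial>lborel"

lemma nn_push:
  assumes [measurable]: "F \<in> borel_measurable borel"
  shows "(\<integral>\<^sup>+x. F (T x) * ennreal (s x) \<partial>lborel) = (\<integral>\<^sup>+y. F y * ennreal (h y) \<partial>lborel)"
proof -
  have "(\<integral>\<^sup>+y. F y \<partial>distr (density lborel s) lborel T) = (\<integral>\<^sup>+y. F y * ennreal (h y) \<partial>lborel)"
    unfolding push by (simp add: nn_integral_density mult.commute)
  then show ?thesis by (simp add: nn_integral_distr nn_integral_density mult.commute)
qed

lemma W2sq_sum_ge:
  fixes p1 p2 q1 q2 :: "real \<Rightarrow> real"
  assumes [measurable]: "p1 \<in> borel_measurable borel" "p2 \<in> borel_measurable borel"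
      "q1 \<in> borel_measurable borel" "q2 \<in> borel_measurable borel"
    and nonneg: "\<And>x. 0 \<le> p1 x" "\<And>x. 0 \<le> p2 x" "\<And>x. 0 \<le> q1 x" "\<And>x. 0 \<le> q2 x"
    and sum: "\<And>x. p1 x + p2 x = s x" "\<And>x. q1 x + q2 x = h x"
  shows "cost
    \<le> W2sq (density lborel p1) (density lborel q1) + W2sq (density lborel p2) (density lborel q2)"
proof -
  obtain \<alpha> \<beta> c where [measurable]: "\<alpha> \<in> borel_measurable borel" "\<beta> \<in> borel_measurable borel"
    and nn: "\<And>x. 0 \<le> \<alpha> x" "\<And>y. 0 \<le> \<beta> y" "0 \<le> c"
    and le: "\<And>x y. x \<in> {a..b} \<Longrightarrow> y \<in> {a..b} \<Longrightarrow> \<alpha> x + \<beta> y \<le> (x - y)\<^sup>2 + c"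
    and eq: "\<And>x. x \<in> {a..b} \<Longrightarrow> \<alpha> x + \<beta> (T x) = (x - T x)\<^sup>2 + c"
    using potentials by blast
  have outside: "p1 x = 0" "p2 x = 0" "q1 x = 0" "q2 x = 0" if "x \<notin> {a..b}" for x
    using that sum[of x] nonneg[of x] s_out[of x] h_out[of x] by auto
  have esum: "ennreal (s x) = ennreal (p1 x) + ennreal (p2 x)"
    "ennreal (h x) = ennreal (q1 x) + ennreal (q2 x)" for x
    using sum[of x] nonneg[of x] by (simp_all flip: ennreal_plus)
  let ?I = "\<lambda>f. \<integral>\<^sup>+x. f x \<partial>lborel"
  have m: "?I (\<lambda>x. ennreal (s x)) = ?I (\<lambda>x. ennreal (p1 x)) + ?I (\<lambda>x. ennreal (p2 x))"
    unfolding esum by (rule nn_integral_add) measurable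
  then have fin: "?I (\<lambda>x. ennreal (p1 x)) < \<infinity>" "?I (\<lambda>x. ennreal (p2 x)) < \<infinity>"
    using s_fin by auto
  let ?W = "W2sq (density lborel p1) (density lborel q1) + W2sq (density lborel p2) (density lborel q2)"
  let ?k = "ennreal c * ?I (\<lambda>x. ennreal (s x))"
  have "?I (\<lambda>x. ennreal ((x - T x)\<^sup>2) * ennreal (s x)) + ?k
      = ?I (\<lambda>x. (ennreal ((x - T x)\<^sup>2) + ennreal c) * ennreal (s x))"
    by (simp add: distrib_right nn_integral_add nn_integral_cmult)
  also have "\<dots> = ?I (\<lambda>x. ennreal (\<alpha> x) * ennreal (s x) + ennreal (\<beta> (T x)) * ennreal (s x))"
  proof (rule nn_integral_cong)
    fix x
    show "(ennreal ((x - T x)\<^sup>2) + ennreal c) * ennreal (s x)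
      = ennreal (\<alpha> x) * ennreal (s x) + ennreal (\<beta> (T x)) * ennreal (s x)"
      using eq[of x] nn s_out[of x]
      by (cases "x \<in> {a<..<b}") (auto simp flip: ennreal_plus distrib_right)
  qed
  also have "\<dots> = ?I (\<lambda>x. ennreal (\<alpha> x) * ennreal (s x)) + ?I (\<lambda>x. ennreal (\<beta> x) * ennreal (h x))"
    using nn_push[of "\<lambda>x. ennreal (\<beta> x)"] by (simp add: nn_integral_add)
  also have "\<dots> = (?I (\<lambda>x. ennreal (\<alpha> x) * ennreal (p1 x)) + ?I (\<lambda>x. ennreal (\<beta> x) * ennreal (q1 x)))
     + (?I (\<lambda>x. ennreal (\<alpha> x) * ennreal (p2 x)) + ?I (\<lambda>x. ennreal (\<beta> x) * ennreal (q2 x)))"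
    unfolding esum by (simp add: distrib_left nn_integral_add ac_simps)
  also have "\<dots> \<le> (W2sq (density lborel p1) (density lborel q1) + ennreal c * ?I (\<lambda>x. ennreal (p1 x)))
     + (W2sq (density lborel p2) (density lborel q2) + ennreal c * ?I (\<lambda>x. ennreal (p2 x)))"
    by (rule add_mono; rule W2sq_ge_potentials[where a=a and b=b]) (use outside nn le fin in auto)
  also have "\<dots> = ?W + ?k"
    unfolding m by (simp add: distrib_left ac_simps)
  finally show ?thesis
    using s_fin by (auto simp: add.commute[of _ ?k] ennreal_add_left_cancel_le ennreal_mult_eq_top_iff)
qed

end

lemma coupling_split:
  fixes t h q :: "real \<Rightarrow> real"
  assumes \<Gamma>: "\<Gamma> \<in> couplings (density lborel t) (density lborel h)"
    and [measurable]: "t \<in> borel_measurable borel" "h \<in> borel_measurable borel" "q \<in> borel_measurable borel"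
    and q: "\<And>x. 0 \<le> q x" "\<And>x. q x \<le> 1" and t: "\<And>x. 0 \<le> t x" and h: "\<And>x. 0 \<le> h x"
  obtains p1 p2 :: "real \<Rightarrow> real" where
    "p1 \<in> borel_measurable borel" "p2 \<in> borel_measurable borel" "\<And>x. 0 \<le> p1 x" "\<And>x. 0 \<le> p2 x"
    "\<And>x. p1 x + p2 x = t x"
    "emeasure (density lborel p1) UNIV = emeasure (density lborel (\<lambda>x. q x * h x)) UNIV"
    "emeasure (density lborel p2) UNIV = emeasure (density lborel (\<lambda>x. (1 - q x) * h x)) UNIV"
    "W2sq (density lborel p1) (density lborel (\<lambda>x. q x * h x))
      + W2sq (density lborel p2) (density lborel (\<lambda>x. (1 - q x) * h x))
      \<le> plan_cost \<Gamma>"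
proof -
  have \<Gamma>s [measurable_cong]: "sets \<Gamma> = sets (lborel \<Otimes>\<^sub>M lborel)" using \<Gamma> by (auto simp: couplings_def)
  define G where "G w = density \<Gamma> (\<lambda>z. ennreal (w (snd z)))" for w :: "real \<Rightarrow> real"
  have G_sets [measurable_cong]: "sets (G w) = sets (lborel \<Otimes>\<^sub>M lborel)" for w by (simp add: G_def \<Gamma>s)
  define \<mu> where "\<mu> w = distr (G w) lborel fst" for w
  have \<mu>_eq: "emeasure (\<mu> w) A = (\<integral>\<^sup>+z. ennreal (w (snd z)) * indicator A (fst z) \<partial>\<Gamma>)"
    if [measurable]: "A \<in> sets borel" "w \<in> borel_measurable borel" for A w
  proof -
    have "emeasure (\<mu> w) A = (\<integral>\<^sup>+x. indicator A x \<partial>\<mu> w)"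
      by (simp add: \<mu>_def)
    also have "\<dots> = (\<integral>\<^sup>+z. indicator A (fst z) \<partial>G w)"
      unfolding \<mu>_def by (rule nn_integral_distr) measurable
    also have "\<dots> = (\<integral>\<^sup>+z. ennreal (w (snd z)) * indicator A (fst z) \<partial>\<Gamma>)"
      unfolding G_def by (rule nn_integral_density) measurable
    finally show ?thesis .
  qed
  have \<mu>t: "(\<integral>\<^sup>+z. indicator A (fst z) \<partial>\<Gamma>) = emeasure (density lborel t) A" if [measurable]: "A \<in> sets borel" for A
    using coupling_nn_integral(1)[OF \<Gamma>, of "indicator A"] by simp
  have ex: "\<exists>f\<in>borel_measurable lborel. density lborel f = \<mu> w"
    if [measurable]: "w \<in> borel_measurable borel" and w1: "\<And>x. w x \<le> 1" for w
  proof (rule sigma_finite_measure.Radon_Nikodym[OF sigma_finite_lborel])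
    show "sets (\<mu> w) = sets lborel" by (simp add: \<mu>_def)
    show "absolutely_continuous lborel (\<mu> w)"
      unfolding absolutely_continuous_def
    proof
      fix A :: "real set" assume "A \<in> null_sets lborel"
      then have [measurable]: "A \<in> sets borel" and A: "A \<in> null_sets lborel" by auto
      have "emeasure (\<mu> w) A \<le> (\<integral>\<^sup>+z. indicator A (fst z) \<partial>\<Gamma>)"
        using w1 by (subst \<mu>_eq) (auto intro!: nn_integral_mono simp: indicator_def ennreal_le_1)
      also have "\<dots> = (\<integral>\<^sup>+x. ennreal (t x) * indicator A x \<partial>lborel)"
        by (simp add: \<mu>t emeasure_density)
      also have "\<dots> = 0"
        using A by (intro nn_integral_null_set)
      finally show "A \<in> null_sets (\<mu> w)" by (auto simp: null_sets_def \<mu>_def)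
    qed
  qed
  define w2 where "w2 = (\<lambda>x. 1 - q x)"
  have [measurable]: "w2 \<in> borel_measurable borel" unfolding w2_def by measurable
  obtain f1 where [measurable]: "f1 \<in> borel_measurable borel" and f1: "density lborel f1 = \<mu> q"
    using ex[of q] q by auto
  obtain f2 where [measurable]: "f2 \<in> borel_measurable borel" and f2: "density lborel f2 = \<mu> w2"
    using ex[of w2] q by (auto simp: w2_def)
  have "density lborel (\<lambda>x. f1 x + f2 x) = density lborel (\<lambda>x. ennreal (t x))"
  proof (rule measure_eqI)
    fix A :: "real set" assume "A \<in> sets (density lborel (\<lambda>x. f1 x + f2 x))"
    then have [measurable]: "A \<in> sets borel" by simp
    have "emeasure (density lborel (\<lambda>x. f1 x + f2 x)) A
        = emeasure (density lborel f1) A + emeasure (density lborel f2) A"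
      by (simp add: emeasure_density distrib_right nn_integral_add)
    also have "\<dots> = (\<integral>\<^sup>+z. ennreal (q (snd z)) * indicator A (fst z) + ennreal (w2 (snd z)) * indicator A (fst z) \<partial>\<Gamma>)"
      unfolding f1 f2 by (simp add: \<mu>_eq nn_integral_add)
    also have "\<dots> = (\<integral>\<^sup>+z. indicator A (fst z) \<partial>\<Gamma>)"
      using q by (intro nn_integral_cong) (auto simp: w2_def indicator_def simp flip: ennreal_plus)
    finally show "emeasure (density lborel (\<lambda>x. f1 x + f2 x)) A = emeasure (density lborel (\<lambda>x. ennreal (t x))) A"
      by (simp add: \<mu>t)
  qed simp
  then have "AE x in lborel. f1 x + f2 x = ennreal (t x)"
    by (subst (asm) sigma_finite_measure.density_unique_iff[OF sigma_finite_lborel]) auto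
  define p1 where "p1 x = enn2real (min (f1 x) (ennreal (t x)))" for x
  define p2 where "p2 x = t x - p1 x" for x
  have e1: "ennreal (p1 x) = min (f1 x) (ennreal (t x))" for x
    by (simp add: p1_def ennreal_enn2real_if min_def top_unique)
  have p1t: "p1 x \<le> t x" for x
    using t[of x] e1[of x] by (metis ennreal_le_iff min.cobounded2)
  have AE1: "AE x in lborel. ennreal (p1 x) = f1 x"
    using \<open>AE x in lborel. f1 x + f2 x = ennreal (t x)\<close>
    by eventually_elim (metis e1 le_iff_add min.absorb1)
  have AE2: "AE x in lborel. ennreal (p2 x) = f2 x"
    using \<open>AE x in lborel. f1 x + f2 x = ennreal (t x)\<close> AE1
  proof eventually_elim
    case (elim x)
    have "ennreal (p1 x) + ennreal (p2 x) = ennreal (t x)"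
      using p1t[of x] by (simp add: p2_def p1_def flip: ennreal_plus)
    with elim have "ennreal (p1 x) + ennreal (p2 x) = ennreal (p1 x) + f2 x" by simp
    then show ?case by (simp add: ennreal_add_left_cancel)
  qed
  have [measurable]: "p1 \<in> borel_measurable borel" unfolding p1_def[abs_def] by measurable
  have [measurable]: "p2 \<in> borel_measurable borel" unfolding p2_def[abs_def] by measurable
  have d1: "density lborel p1 = \<mu> q" unfolding f1[symmetric] using AE1 by (intro density_cong) auto
  have d2: "density lborel p2 = \<mu> w2" unfolding f2[symmetric] using AE2 by (intro density_cong) auto
  have snd: "distr (G w) lborel snd = density lborel (\<lambda>x. w x * h x)"
    if [measurable]: "w \<in> borel_measurable borel" and w: "\<And>x. 0 \<le> w x" for w
  proof (rule measure_eqI)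
    fix A assume "A \<in> sets (distr (G w) lborel snd)"
    then have [measurable]: "A \<in> sets borel" by simp
    have "emeasure (distr (G w) lborel snd) A = (\<integral>\<^sup>+z. indicator A (snd z) \<partial>G w)"
      by (subst nn_integral_indicator[symmetric], simp, subst nn_integral_distr) auto
    also have "\<dots> = (\<integral>\<^sup>+z. ennreal (w (snd z)) * indicator A (snd z) \<partial>\<Gamma>)"
      unfolding G_def by (rule nn_integral_density) measurable
    also have "\<dots> = (\<integral>\<^sup>+y. ennreal (w y) * indicator A y \<partial>density lborel h)"
      by (rule coupling_nn_integral(2)[OF \<Gamma>]) measurable
    also have "\<dots> = emeasure (density lborel (\<lambda>x. w x * h x)) A"
      using w h by (simp add: nn_integral_density emeasure_density ennreal_mult ac_simps)
    finally show "emeasure (distr (G w) lborel snd) A = emeasure (density lborel (\<lambda>x. w x * h x)) A" .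
  qed simp
  have c1: "G q \<in> couplings (density lborel p1) (density lborel (\<lambda>x. q x * h x))"
    unfolding couplings_def d1 using snd[of q] q by (simp add: G_sets \<mu>_def)
  have c2: "G w2 \<in> couplings (density lborel p2) (density lborel (\<lambda>x. w2 x * h x))"
    unfolding couplings_def d2 using snd[of w2] q by (simp add: G_sets \<mu>_def w2_def)
  have mass: "emeasure \<mu>' UNIV = emeasure \<nu>' UNIV" if "\<gamma> \<in> couplings \<mu>' \<nu>'" for \<gamma> \<mu>' \<nu>'
    using coupling_nn_integral[OF that, of "\<lambda>_. 1"] that
    by (auto simp: couplings_def)
  show ?thesis
  proof (rule that[of p1 p2])
    show "emeasure (density lborel p1) UNIV = emeasure (density lborel (\<lambda>x. q x * h x)) UNIV"
      by (rule mass[OF c1])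
    show "emeasure (density lborel p2) UNIV = emeasure (density lborel (\<lambda>x. (1 - q x) * h x)) UNIV"
      using mass[OF c2] by (simp add: w2_def)
    let ?d = "\<lambda>z::real \<times> real. ennreal ((fst z - snd z)\<^sup>2)"
    have "W2sq (density lborel p1) (density lborel (\<lambda>x. q x * h x))
      + W2sq (density lborel p2) (density lborel (\<lambda>x. w2 x * h x))
      \<le> (\<integral>\<^sup>+z. ?d z \<partial>G q) + (\<integral>\<^sup>+z. ?d z \<partial>G w2)"
      by (intro add_mono W2sq_le c1 c2)
    also have "\<dots> = (\<integral>\<^sup>+z. ennreal (q (snd z)) * ?d z + ennreal (w2 (snd z)) * ?d z \<partial>\<Gamma>)"
      unfolding G_def by (simp add: nn_integral_density nn_integral_add)
    also have "\<dots> = (\<integral>\<^sup>+z. ?d z \<partial>\<Gamma>)"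
      using q by (intro nn_integral_cong) (simp add: w2_def flip: distrib_right ennreal_plus)
    finally show "W2sq (density lborel p1) (density lborel (\<lambda>x. q x * h x))
      + W2sq (density lborel p2) (density lborel (\<lambda>x. (1 - q x) * h x)) \<le> (\<integral>\<^sup>+z. ?d z \<partial>\<Gamma>)"
      by (simp add: w2_def)
  qed (use p1t in \<open>auto simp: p2_def p1_def\<close>)
qed

lemma nn_integral_indicator_sections:
  fixes D :: "(real \<times> real) set"
  assumes [measurable]: "D \<in> sets (lborel \<Otimes>\<^sub>M lborel)" "w \<in> borel_measurable borel"
    and f1: "\<And>x. f1 x = (\<integral>\<^sup>+y. indicator D (x, y) \<partial>lborel)"
    and f2: "\<And>y. f2 y = (\<integral>\<^sup>+x. indicator D (x, y) \<partial>lborel)"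
  shows "(\<integral>\<^sup>+z. w (fst z) * indicator D z \<partial>(lborel \<Otimes>\<^sub>M lborel)) = (\<integral>\<^sup>+x. w x * f1 x \<partial>lborel)"
    "(\<integral>\<^sup>+z. w (snd z) * indicator D z \<partial>(lborel \<Otimes>\<^sub>M lborel)) = (\<integral>\<^sup>+y. w y * f2 y \<partial>lborel)"
  by (subst lborel.nn_integral_fst[symmetric], auto simp: nn_integral_cmult f1)
    (subst lborel_pair.nn_integral_snd[symmetric], auto simp: nn_integral_cmult f2)

subsection \<open>The optimality condition of a minimising step\<close>

locale jko_step = transport + energy_density +
  fixes \<tau> M :: real
  assumes tau: "0 < \<tau>" and M: "0 < M" and h_le: "AE x in lborel. h x \<le> M"
    and minimal: "\<And>\<Gamma> t. t \<in> borel_measurable borel \<Longrightarrow> (\<And>x. 0 \<le> t x) \<Longrightarrow>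
      (\<And>x. x \<notin> {a<..<b} \<Longrightarrow> t x = 0) \<Longrightarrow> \<Gamma> \<in> couplings (density lborel t) (density lborel h) \<Longrightarrow>
      cost / ennreal (2 * \<tau>)
        + total_energy chi s
      \<le> plan_cost \<Gamma> / ennreal (2 * \<tau>)
        + total_energy chi t"
begin

lemma energy_finite: "total_energy chi s < \<infinity>"
proof -
  let ?\<Gamma> = "distr (density lborel h) (lborel \<Otimes>\<^sub>M lborel) (\<lambda>x. (x, x))"
  have "distr ?\<Gamma> lborel fst = distr (density lborel h) lborel (\<lambda>x. x)"
    "distr ?\<Gamma> lborel snd = distr (density lborel h) lborel (\<lambda>x. x)"
    by (simp_all add: distr_distr comp_def)
  moreover have "distr (density lborel h) lborel (\<lambda>x. x) = density lborel h"
    by (rule distr_id2) simp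
  ultimately have "?\<Gamma> \<in> couplings (density lborel h) (density lborel h)"
    by (simp add: couplings_def)
  from minimal[OF h_meas h_nonneg h_out this]
  have "total_energy chi s
    \<le> plan_cost ?\<Gamma> / ennreal (2 * \<tau>)
      + total_energy chi h"
    by (rule order_trans[OF add_increasing, rotated 2]) auto
  also have "plan_cost ?\<Gamma> = 0"
    by (simp add: nn_integral_distr)
  also have "total_energy chi h
    \<le> (\<integral>\<^sup>+x. ennreal (chi M - chi 0) * indicator {a<..<b} x \<partial>lborel)"
  proof (rule nn_integral_mono_AE)
    show "AE x in lborel. ennreal (chi (h x) - chi 0) \<le> ennreal (chi M - chi 0) * indicator {a<..<b} x"
      using h_le
    proof eventually_elim
      case (elim x)
      then show ?case
        using h_out[of x] chi_mono[OF h_nonneg[of x], of M]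
        by (cases "x \<in> {a<..<b}") (auto intro!: ennreal_leI)
    qed
  qed
  also have "\<dots> < \<infinity>"
    using ab by (simp add: nn_integral_cmult ennreal_mult_less_top)
  finally show ?thesis by simp
qed

lemma cost_finite: "cost < \<infinity>"
proof -
  have "cost
    \<le> (\<integral>\<^sup>+x. ennreal ((b - a)\<^sup>2) * ennreal (s x) \<partial>lborel)"
  proof (rule nn_integral_mono)
    fix x
    show "ennreal ((x - T x)\<^sup>2) * ennreal (s x) \<le> ennreal ((b - a)\<^sup>2) * ennreal (s x)"
    proof (cases "x \<in> {a<..<b}")
      case True
      then have "\<bar>x - T x\<bar> \<le> \<bar>b - a\<bar>" using T_range[of x] by auto
      then show ?thesis by (intro mult_right_mono ennreal_leI) (auto simp: abs_le_square_iff)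
    qed (simp add: s_out)
  qed
  also have "\<dots> < \<infinity>" using s_fin by (simp add: nn_integral_cmult ennreal_mult_less_top)
  finally show ?thesis .
qed

text \<open>Mass with density epsilon on D is moved from x to y for (x, y) in D. The perturbed coupling is
  the image of one density on the plane: the points of D carry the moved mass, and a disjoint strip
  of unit height above b carries the mass that stays.\<close>

lemma perturbation:
  fixes D :: "(real \<times> real) set" and \<epsilon> :: real
  assumes D [measurable]: "D \<in> sets (lborel \<Otimes>\<^sub>M lborel)" and DI: "D \<subseteq> {a<..<b} \<times> {a<..<b}" and "0 < \<epsilon>"
    and [measurable]: "f1 \<in> borel_measurable borel" "f2 \<in> borel_measurable borel"
    and f1: "\<And>x. ennreal (f1 x) = (\<integral>\<^sup>+y. indicator D (x, y) \<partial>lborel)" "\<And>x. 0 \<le> f1 x"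
    and f2: "\<And>y. ennreal (f2 y) = (\<integral>\<^sup>+x. indicator D (x, y) \<partial>lborel)" "\<And>x. 0 \<le> f2 x"
    and small: "\<And>x. \<epsilon> * f1 x \<le> s x"
  obtains \<Gamma> where "\<Gamma> \<in> couplings (density lborel (\<lambda>x. s x - \<epsilon> * f1 x + \<epsilon> * f2 x)) (density lborel h)"
    "plan_cost \<Gamma>
      + ennreal \<epsilon> * (\<integral>\<^sup>+z. ennreal ((fst z - T (fst z))\<^sup>2) * indicator D z \<partial>(lborel \<Otimes>\<^sub>M lborel))
     = cost
      + ennreal \<epsilon> * (\<integral>\<^sup>+z. ennreal ((snd z - T (fst z))\<^sup>2) * indicator D z \<partial>(lborel \<Otimes>\<^sub>M lborel))"
proof -
  let ?P = "lborel \<Otimes>\<^sub>M (lborel :: real measure) :: (real \<times> real) measure"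
  define r where "r x = s x - \<epsilon> * f1 x" for x
  have r: "0 \<le> r x" for x using small[of x] by (simp add: r_def)
  have [measurable]: "r \<in> borel_measurable borel" unfolding r_def[abs_def] by measurable
  have rs: "ennreal (r x) + ennreal \<epsilon> * ennreal (f1 x) = ennreal (s x)" for x
    using r[of x] f1(2)[of x] \<open>0 < \<epsilon>\<close> by (simp add: r_def flip: ennreal_plus ennreal_mult)
  have rt: "ennreal (r x) + ennreal \<epsilon> * ennreal (f2 x) = ennreal (s x - \<epsilon> * f1 x + \<epsilon> * f2 x)" for x
    using r[of x] f2(2)[of x] \<open>0 < \<epsilon>\<close> by (simp add: r_def flip: ennreal_plus ennreal_mult)
  define W :: "real \<times> real \<Rightarrow> ennreal" where
    "W z = ennreal \<epsilon> * indicator D z + ennreal (r (fst z)) * indicator {b<..<b+1} (snd z)" for z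
  define H where "H z = (if snd z < b then snd z else fst z, T (fst z))" for z :: "real \<times> real"
  have [measurable]: "W \<in> borel_measurable ?P" unfolding W_def[abs_def] by measurable
  have [measurable]: "H \<in> ?P \<rightarrow>\<^sub>M ?P" unfolding H_def[abs_def] by measurable
  define \<Gamma> where "\<Gamma> = distr (density ?P W) ?P H"
  have \<Gamma>_int: "(\<integral>\<^sup>+z. F z \<partial>\<Gamma>) = ennreal \<epsilon> * (\<integral>\<^sup>+z. F (snd z, T (fst z)) * indicator D z \<partial>?P)
      + (\<integral>\<^sup>+x. F (x, T x) * ennreal (r x) \<partial>lborel)" if [measurable]: "F \<in> borel_measurable ?P" for F
  proof -
    have "(\<integral>\<^sup>+z. F z \<partial>\<Gamma>) = (\<integral>\<^sup>+z. W z * F (H z) \<partial>?P)"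
      by (simp add: \<Gamma>_def nn_integral_distr nn_integral_density)
    also have "\<dots> = (\<integral>\<^sup>+z. ennreal \<epsilon> * (F (snd z, T (fst z)) * indicator D z)
        + F (fst z, T (fst z)) * ennreal (r (fst z)) * indicator {b<..<b+1} (snd z) \<partial>?P)"
      using DI by (intro nn_integral_cong)
        (auto simp: W_def H_def indicator_def distrib_right distrib_left mult_ac)
    also have "\<dots> = ennreal \<epsilon> * (\<integral>\<^sup>+z. F (snd z, T (fst z)) * indicator D z \<partial>?P)
       + (\<integral>\<^sup>+z. F (fst z, T (fst z)) * ennreal (r (fst z)) * indicator {b<..<b+1} (snd z) \<partial>?P)"
      by (simp add: nn_integral_add nn_integral_cmult)
    also have "(\<integral>\<^sup>+z. F (fst z, T (fst z)) * ennreal (r (fst z)) * indicator {b<..<b+1} (snd z) \<partial>?P)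
       = (\<integral>\<^sup>+x. F (x, T x) * ennreal (r x) \<partial>lborel)"
      by (subst lborel.nn_integral_fst[symmetric]) (auto simp: nn_integral_cmult)
    finally show ?thesis .
  qed
  note D1 = nn_integral_indicator_sections(1)[OF D _ f1(1) f2(1)]
    and D2 = nn_integral_indicator_sections(2)[OF D _ f1(1) f2(1)]
  have sets_\<Gamma> [measurable_cong]: "sets \<Gamma> = sets ?P" by (simp add: \<Gamma>_def)
  have "distr \<Gamma> lborel fst = density lborel (\<lambda>x. s x - \<epsilon> * f1 x + \<epsilon> * f2 x)"
  proof (rule measure_eqI)
    fix A assume "A \<in> sets (distr \<Gamma> lborel fst)"
    then have [measurable]: "A \<in> sets borel" by simp
    have "emeasure (distr \<Gamma> lborel fst) A = (\<integral>\<^sup>+z. indicator A (fst z) \<partial>\<Gamma>)"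
      by (subst nn_integral_indicator[symmetric], simp, subst nn_integral_distr) auto
    also have "\<dots> = ennreal \<epsilon> * (\<integral>\<^sup>+x. indicator A x * ennreal (f2 x) \<partial>lborel)
        + (\<integral>\<^sup>+x. indicator A x * ennreal (r x) \<partial>lborel)"
      by (subst \<Gamma>_int) (auto simp: D2)
    also have "\<dots> = (\<integral>\<^sup>+x. indicator A x * (ennreal (r x) + ennreal \<epsilon> * ennreal (f2 x)) \<partial>lborel)"
      by (simp add: distrib_left nn_integral_add nn_integral_cmult ac_simps)
    finally show "emeasure (distr \<Gamma> lborel fst) A = emeasure (density lborel (\<lambda>x. s x - \<epsilon> * f1 x + \<epsilon> * f2 x)) A"
      by (simp add: rt emeasure_density mult.commute)
  qed simp
  moreover have "distr \<Gamma> lborel snd = density lborel h"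
  proof (rule measure_eqI)
    fix A assume "A \<in> sets (distr \<Gamma> lborel snd)"
    then have [measurable]: "A \<in> sets borel" by simp
    have "emeasure (distr \<Gamma> lborel snd) A = (\<integral>\<^sup>+z. indicator A (snd z) \<partial>\<Gamma>)"
      by (subst nn_integral_indicator[symmetric], simp, subst nn_integral_distr) auto
    also have "\<dots> = ennreal \<epsilon> * (\<integral>\<^sup>+x. indicator A (T x) * ennreal (f1 x) \<partial>lborel)
        + (\<integral>\<^sup>+x. indicator A (T x) * ennreal (r x) \<partial>lborel)"
      using D1[of "\<lambda>x. indicator A (T x)"] by (subst \<Gamma>_int) auto
    also have "\<dots> = (\<integral>\<^sup>+x. indicator A (T x) * (ennreal (r x) + ennreal \<epsilon> * ennreal (f1 x)) \<partial>lborel)"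
      by (simp add: distrib_left nn_integral_add nn_integral_cmult ac_simps)
    also have "\<dots> = (\<integral>\<^sup>+x. indicator A x * ennreal (h x) \<partial>lborel)"
      unfolding rs by (rule nn_push) measurable
    finally show "emeasure (distr \<Gamma> lborel snd) A = emeasure (density lborel h) A"
      by (simp add: emeasure_density mult.commute)
  qed simp
  ultimately have "\<Gamma> \<in> couplings (density lborel (\<lambda>x. s x - \<epsilon> * f1 x + \<epsilon> * f2 x)) (density lborel h)"
    by (simp add: couplings_def sets_\<Gamma>)
  moreover have "plan_cost \<Gamma>
      + ennreal \<epsilon> * (\<integral>\<^sup>+z. ennreal ((fst z - T (fst z))\<^sup>2) * indicator D z \<partial>?P)
     = cost
      + ennreal \<epsilon> * (\<integral>\<^sup>+z. ennreal ((snd z - T (fst z))\<^sup>2) * indicator D z \<partial>?P)"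
    using D1[of "\<lambda>x. ennreal ((x - T x)\<^sup>2)"] unfolding rs[symmetric]
    by (subst \<Gamma>_int) (auto simp: distrib_left nn_integral_add nn_integral_cmult ac_simps)
  ultimately show ?thesis by (rule that)
qed

definition excess :: "real \<Rightarrow> real \<Rightarrow> real" where
  "excess x y = dchi (s y) - dchi (s x) + ((y - T x)\<^sup>2 - (x - T x)\<^sup>2) / (2 * \<tau>)"

definition bad_set :: "nat \<Rightarrow> (real \<times> real) set" where
  "bad_set n = {z. fst z \<in> {a<..<b} \<and> snd z \<in> {a<..<b} \<and> 1 / Suc n \<le> s (fst z) \<and> s (fst z) \<le> Suc n
     \<and> s (snd z) \<le> Suc n \<and> excess (fst z) (snd z) \<le> - 1 / Suc n}"

lemma dchi_s_measurable [measurable]: "(\<lambda>x. dchi (s x)) \<in> borel_measurable borel"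
  by (rule borel_measurable_dchi) (auto simp: s_nonneg)

lemma bad_set_measurable [measurable]: "bad_set n \<in> sets (lborel \<Otimes>\<^sub>M lborel)"
proof -
  have "{z \<in> space (lborel \<Otimes>\<^sub>M lborel). fst z \<in> {a<..<b} \<and> snd z \<in> {a<..<b} \<and> 1 / Suc n \<le> s (fst z)
     \<and> s (fst z) \<le> Suc n \<and> s (snd z) \<le> Suc n \<and> excess (fst z) (snd z) \<le> - 1 / Suc n}
     \<in> sets (lborel \<Otimes>\<^sub>M lborel)"
    unfolding excess_def by measurable
  then show ?thesis by (simp add: bad_set_def space_pair_measure)
qed

text \<open>Restricting to the set where s is at most n+1 keeps the energy of the perturbation finite
  although s is not yet known to be bounded; s is at least 1/(n+1) where mass is removed.\<close>

lemma bad_set_null: "emeasure (lborel \<Otimes>\<^sub>M lborel) (bad_set n) = 0"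
proof (rule ccontr)
  assume pos: "emeasure (lborel \<Otimes>\<^sub>M lborel) (bad_set n) \<noteq> 0"
  let ?P = "lborel \<Otimes>\<^sub>M (lborel :: real measure) :: (real \<times> real) measure"
  define D where "D = bad_set n"
  define k where "k = real (Suc n)"
  have k: "1 \<le> k" by (simp add: k_def)
  have Dm [measurable]: "D \<in> sets ?P" unfolding D_def by measurable
  have DI: "D \<subseteq> {a<..<b} \<times> {a<..<b}" by (auto simp: D_def bad_set_def)
  have Dk: "1 / k \<le> s x" "s x \<le> k" "s y \<le> k" "excess x y \<le> - 1 / k" if "(x, y) \<in> D" for x y
    using that by (auto simp: D_def bad_set_def k_def)
  have Dfin: "emeasure ?P D < \<infinity>"
  proof -
    have "emeasure ?P D \<le> emeasure ?P ({a<..<b} \<times> {a<..<b})"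
      by (rule emeasure_mono[OF DI]) measurable
    also have "\<dots> < \<infinity>"
      using ab by (subst lborel.emeasure_pair_measure_Times) (auto simp: ennreal_mult_less_top)
    finally show ?thesis .
  qed
  define f1 where "f1 x = measure lborel (Pair x -` D)" for x
  define f2 where "f2 y = measure lborel ((\<lambda>x. (x, y)) -` D)" for y
  have sec1: "Pair x -` D \<in> sets lborel" "emeasure lborel (Pair x -` D) \<le> ennreal (b - a)" for x
  proof -
    show *: "Pair x -` D \<in> sets lborel" by (rule sets_Pair1) measurable
    have "emeasure lborel (Pair x -` D) \<le> emeasure lborel {a<..<b}"
      using DI by (intro emeasure_mono) auto
    then show "emeasure lborel (Pair x -` D) \<le> ennreal (b - a)" using ab by simp
  qed
  have sec2: "(\<lambda>x. (x, y)) -` D \<in> sets lborel" "emeasure lborel ((\<lambda>x. (x, y)) -` D) \<le> ennreal (b - a)" for y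
  proof -
    show *: "(\<lambda>x. (x, y)) -` D \<in> sets lborel" by (rule sets_Pair2) measurable
    have "emeasure lborel ((\<lambda>x. (x, y)) -` D) \<le> emeasure lborel {a<..<b}"
      using DI by (intro emeasure_mono) auto
    then show "emeasure lborel ((\<lambda>x. (x, y)) -` D) \<le> ennreal (b - a)" using ab by simp
  qed
  have ef1: "ennreal (f1 x) = emeasure lborel (Pair x -` D)" for x
    unfolding f1_def by (intro emeasure_eq_ennreal_measure[symmetric] neq_top_trans[OF _ sec1(2)]) simp
  have ef2: "ennreal (f2 y) = emeasure lborel ((\<lambda>x. (x, y)) -` D)" for y
    unfolding f2_def by (intro emeasure_eq_ennreal_measure[symmetric] neq_top_trans[OF _ sec2(2)]) simp
  have f1: "ennreal (f1 x) = (\<integral>\<^sup>+y. indicator D (x, y) \<partial>lborel)" "0 \<le> f1 x" for x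
    unfolding ef1 using sec1(1)[of x]
    by (auto simp: f1_def nn_integral_indicator[symmetric] indicator_def[abs_def] simp del: nn_integral_indicator)
  have f2: "ennreal (f2 y) = (\<integral>\<^sup>+x. indicator D (x, y) \<partial>lborel)" "0 \<le> f2 y" for y
    unfolding ef2 using sec2(1)[of y]
    by (auto simp: f2_def nn_integral_indicator[symmetric] indicator_def[abs_def] simp del: nn_integral_indicator)
  have f_le: "f1 x \<le> b - a" "f2 x \<le> b - a" for x
    using sec1(2)[of x] sec2(2)[of x] ab unfolding ef1[symmetric] ef2[symmetric]
    by (auto simp: ennreal_le_iff)
  have f1m [measurable]: "f1 \<in> borel_measurable borel"
  proof -
    have "(\<lambda>x. emeasure lborel (Pair x -` D)) \<in> borel_measurable lborel"
      by (rule lborel.measurable_emeasure_Pair[OF Dm])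
    then show ?thesis unfolding f1_def[abs_def] measure_def by simp
  qed
  have f2m [measurable]: "f2 \<in> borel_measurable borel"
  proof -
    have "(\<lambda>y. emeasure lborel ((\<lambda>x. (x, y)) -` D)) \<in> borel_measurable lborel"
      by (rule lborel_pair.measurable_emeasure_Pair2[OF Dm])
    then have "(\<lambda>y. enn2real (emeasure lborel ((\<lambda>x. (x, y)) -` D))) \<in> borel_measurable lborel"
      by (rule borel_measurable_enn2real)
    then show ?thesis unfolding f2_def[abs_def] measure_def by simp
  qed
  have "uniformly_continuous_on {0..k + 1} dchi"
    by (intro compact_uniformly_continuous continuous_on_subset[OF continuous_on_dchi]) auto
  moreover have "0 < 1 / (4 * k)" using k by simp
  ultimately obtain \<delta> where "0 < \<delta>"
    and "\<forall>x\<in>{0..k+1}. \<forall>y\<in>{0..k+1}. \<bar>y - x\<bar> < \<delta> \<longrightarrow> \<bar>dchi y - dchi x\<bar> < 1 / (4 * k)"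
    unfolding uniformly_continuous_on_def dist_real_def by meson
  then have \<delta>: "0 < \<delta>"
    "\<And>x y. x \<in> {0..k+1} \<Longrightarrow> y \<in> {0..k+1} \<Longrightarrow> \<bar>y - x\<bar> < \<delta> \<Longrightarrow> \<bar>dchi y - dchi x\<bar> < 1 / (4 * k)"
    by blast+
  define \<epsilon> where "\<epsilon> = min (\<delta> / 2) (1 / k) / (b - a)"
  have e: "0 < \<epsilon>" using \<delta> k ab by (auto simp: \<epsilon>_def)
  have "\<epsilon> * (b - a) = min (\<delta> / 2) (1 / k)" using ab by (simp add: \<epsilon>_def)
  moreover have "1 / k \<le> 1" using k by simp
  ultimately have e2: "\<epsilon> * (b - a) < \<delta>" "\<epsilon> * (b - a) \<le> 1 / k" "\<epsilon> * (b - a) \<le> 1"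
    using \<delta>(1) by linarith+
  have ef_le: "\<epsilon> * f1 x \<le> \<epsilon> * (b - a)" "\<epsilon> * f2 x \<le> \<epsilon> * (b - a)" for x
    using f_le[of x] e by auto
  have ef_nn: "0 \<le> \<epsilon> * f1 x" "0 \<le> \<epsilon> * f2 x" for x
    using f1(2)[of x] f2(2)[of x] e by auto
  have f1D: "\<exists>y. (x, y) \<in> D" if "f1 x \<noteq> 0" for x
  proof (rule ccontr)
    assume "\<not> ?thesis"
    then have "Pair x -` D = {}" by auto
    with that show False by (simp add: f1_def)
  qed
  have f2D: "\<exists>x. (x, y) \<in> D" if "f2 y \<noteq> 0" for y
  proof (rule ccontr)
    assume "\<not> ?thesis"
    then have "(\<lambda>x. (x, y)) -` D = {}" by auto
    with that show False by (simp add: f2_def)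
  qed
  have small: "\<epsilon> * f1 x \<le> s x" for x
  proof (cases "f1 x = 0")
    case False
    then obtain y where "(x, y) \<in> D" using f1D by blast
    then show ?thesis using Dk(1)[of x y] ef_le[of x] e2 by linarith
  qed (simp add: s_nonneg)
  define t where "t x = s x - \<epsilon> * f1 x + \<epsilon> * f2 x" for x
  obtain \<Gamma> where \<Gamma>: "\<Gamma> \<in> couplings (density lborel t) (density lborel h)"
    and cost: "plan_cost \<Gamma>
      + ennreal \<epsilon> * (\<integral>\<^sup>+z. ennreal ((fst z - T (fst z))\<^sup>2) * indicator D z \<partial>?P)
     = cost
      + ennreal \<epsilon> * (\<integral>\<^sup>+z. ennreal ((snd z - T (fst z))\<^sup>2) * indicator D z \<partial>?P)"
    using perturbation[OF Dm DI e f1m f2m f1 f2 small] unfolding t_def[abs_def] by blast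
  have t_nonneg: "0 \<le> t x" for x using small[of x] f2(2)[of x] e by (simp add: t_def)
  have [measurable]: "t \<in> borel_measurable borel" unfolding t_def[abs_def] by measurable
  have t_out: "t x = 0" if "x \<notin> {a<..<b}" for x
  proof -
    have "f1 x = 0" "f2 x = 0" using f1D[of x] f2D[of x] DI that by blast+
    then show ?thesis using s_out[OF that] by (simp add: t_def)
  qed
  have chi_t: "chi (t x) + \<epsilon> * (dchi (s x) * f1 x) \<le> chi (s x) + \<epsilon> * (dchi (s x) * f2 x) + \<epsilon> * (1 / (4 * k)) * (f1 x + f2 x)" for x
  proof (cases "f1 x = 0 \<and> f2 x = 0")
    case False
    then have "s x \<le> k" using f1D[of x] f2D[of x] Dk by blast
    moreover have ts: "\<bar>t x - s x\<bar> \<le> \<epsilon> * (b - a)"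
      using ef_le[of x] ef_nn[of x] unfolding t_def by linarith
    ultimately have "t x \<le> k + 1" using e2 by linarith
    then have "\<bar>dchi (t x) - dchi (s x)\<bar> < 1 / (4 * k)"
      using \<delta>(2)[of "s x" "t x"] ts e2 \<open>s x \<le> k\<close> s_nonneg[of x] t_nonneg[of x] by auto
    then have "\<bar>(dchi (t x) - dchi (s x)) * (t x - s x)\<bar> \<le> 1 / (4 * k) * (\<epsilon> * (f1 x + f2 x))"
      unfolding abs_mult using ef_nn[of x] k
      by (intro mult_mono) (auto simp: t_def abs_le_iff distrib_left)
    then have "dchi (t x) * (t x - s x) \<le> dchi (s x) * (t x - s x) + 1 / (4 * k) * (\<epsilon> * (f1 x + f2 x))"
      by (simp add: abs_le_iff left_diff_distrib)
    moreover have "chi (t x) - chi (s x) \<le> dchi (t x) * (t x - s x)"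
      by (rule chi_diff_le[OF s_nonneg t_nonneg])
    moreover have "dchi (s x) * (t x - s x) = \<epsilon> * (dchi (s x) * f2 x) - \<epsilon> * (dchi (s x) * f1 x)"
      by (simp add: t_def algebra_simps)
    moreover have "1 / (4 * k) * (\<epsilon> * (f1 x + f2 x)) = \<epsilon> * (1 / (4 * k)) * (f1 x + f2 x)" by simp
    ultimately show ?thesis by linarith
  qed (simp add: t_def)
  let ?X1 = "\<integral>\<^sup>+z. ennreal (dchi (s (fst z))) * indicator D z \<partial>?P"
  let ?X2 = "\<integral>\<^sup>+z. ennreal (dchi (s (snd z))) * indicator D z \<partial>?P"
  let ?Y1 = "\<integral>\<^sup>+z. ennreal ((fst z - T (fst z))\<^sup>2) * indicator D z \<partial>?P"
  let ?Y2 = "\<integral>\<^sup>+z. ennreal ((snd z - T (fst z))\<^sup>2) * indicator D z \<partial>?P"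
  let ?d = "emeasure ?P D"
  note D1 = nn_integral_indicator_sections(1)[OF Dm _ f1(1) f2(1)]
    and D2 = nn_integral_indicator_sections(2)[OF Dm _ f1(1) f2(1)]
  note [measurable] = borel_measurable_chi[OF s_meas s_nonneg]
  have [measurable]: "(\<lambda>x. chi (t x)) \<in> borel_measurable borel"
    by (rule borel_measurable_chi) (auto simp: t_nonneg)
  have ID: "(\<integral>\<^sup>+z. indicator D z \<partial>?P) = ?d" by (rule nn_integral_indicator[OF Dm])
  have energy: "total_energy chi t + ennreal \<epsilon> * ?X1 \<le> total_energy chi s + ennreal \<epsilon> * ?X2 + ennreal (\<epsilon> / (4 * k)) * (2 * ?d)"
  proof -
    have "total_energy chi t + ennreal \<epsilon> * ?X1
      = (\<integral>\<^sup>+x. ennreal (chi (t x) - chi 0) + ennreal \<epsilon> * (ennreal (dchi (s x)) * ennreal (f1 x)) \<partial>lborel)"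
      using D1[of "\<lambda>x. ennreal (dchi (s x))"] by (simp add: nn_integral_add nn_integral_cmult)
    also have "\<dots> \<le> (\<integral>\<^sup>+x. ennreal (chi (s x) - chi 0) + ennreal \<epsilon> * (ennreal (dchi (s x)) * ennreal (f2 x))
        + ennreal (\<epsilon> / (4 * k)) * (ennreal (f1 x) + ennreal (f2 x)) \<partial>lborel)"
    proof (rule nn_integral_mono)
      fix x
      show "ennreal (chi (t x) - chi 0) + ennreal \<epsilon> * (ennreal (dchi (s x)) * ennreal (f1 x))
        \<le> ennreal (chi (s x) - chi 0) + ennreal \<epsilon> * (ennreal (dchi (s x)) * ennreal (f2 x))
        + ennreal (\<epsilon> / (4 * k)) * (ennreal (f1 x) + ennreal (f2 x))"
        using chi_t[of x] chi_0_le[OF s_nonneg[of x]] chi_0_le[OF t_nonneg[of x]] dchi_nonneg[OF s_nonneg[of x]]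
          e k f1(2)[of x] f2(2)[of x]
        by (simp flip: ennreal_mult ennreal_plus add: ennreal_le_iff)
    qed
    also have "\<dots> = total_energy chi s + ennreal \<epsilon> * ?X2 + ennreal (\<epsilon> / (4 * k)) * (2 * ?d)"
      using D2[of "\<lambda>x. ennreal (dchi (s x))"] D1[of "\<lambda>x. 1"] D2[of "\<lambda>x. 1"]
      by (simp add: nn_integral_add nn_integral_cmult mult_2 ID)
    finally show ?thesis .
  qed
  have gain: "?X2 + ?Y2 / ennreal (2 * \<tau>) + ennreal (1 / k) * ?d \<le> ?X1 + ?Y1 / ennreal (2 * \<tau>)"
  proof -
    have div: "inverse (ennreal (2 * \<tau>)) * ennreal u = ennreal (u / (2 * \<tau>))" if "0 \<le> u" for u
      using divide_ennreal[OF that, of "2 * \<tau>"] tau by (simp add: divide_ennreal_def mult.commute)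
    let ?i = "inverse (ennreal (2 * \<tau>))"
    have "?X2 + ?i * ?Y2 + ennreal (1 / k) * ?d
      = (\<integral>\<^sup>+z. ennreal (dchi (s (snd z))) * indicator D z
          + ?i * (ennreal ((snd z - T (fst z))\<^sup>2) * indicator D z) + ennreal (1 / k) * indicator D z \<partial>?P)"
      by (simp add: nn_integral_add nn_integral_cmult ID)
    also have "\<dots> \<le> (\<integral>\<^sup>+z. ennreal (dchi (s (fst z))) * indicator D z
          + ?i * (ennreal ((fst z - T (fst z))\<^sup>2) * indicator D z) \<partial>?P)"
    proof (rule nn_integral_mono)
      fix z :: "real \<times> real"
      show "ennreal (dchi (s (snd z))) * indicator D z
          + ?i * (ennreal ((snd z - T (fst z))\<^sup>2) * indicator D z) + ennreal (1 / k) * indicator D z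
        \<le> ennreal (dchi (s (fst z))) * indicator D z
          + ?i * (ennreal ((fst z - T (fst z))\<^sup>2) * indicator D z)"
      proof (cases "z \<in> D")
        case True
        then have "excess (fst z) (snd z) \<le> - 1 / k" using Dk(4)[of "fst z" "snd z"] by simp
        then have "dchi (s (snd z)) + (snd z - T (fst z))\<^sup>2 / (2 * \<tau>) + 1 / k
            \<le> dchi (s (fst z)) + (fst z - T (fst z))\<^sup>2 / (2 * \<tau>)"
          by (simp add: excess_def diff_divide_distrib)
        then have "ennreal (dchi (s (snd z)) + (snd z - T (fst z))\<^sup>2 / (2 * \<tau>) + 1 / k)
            \<le> ennreal (dchi (s (fst z)) + (fst z - T (fst z))\<^sup>2 / (2 * \<tau>))"
          by (rule ennreal_leI)
        then show ?thesis
          using True k tau dchi_nonneg[OF s_nonneg]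
          by (simp add: div)
      qed simp
    qed
    also have "\<dots> = ?X1 + ?i * ?Y1"
      by (simp add: nn_integral_add nn_integral_cmult)
    finally show ?thesis by (simp add: divide_ennreal_def mult.commute)
  qed
  have bound: "(\<integral>\<^sup>+z. g z * indicator D z \<partial>?P) < \<infinity>" if "\<forall>z\<in>D. g z \<le> ennreal K" for g K
  proof -
    have "(\<integral>\<^sup>+z. g z * indicator D z \<partial>?P) \<le> (\<integral>\<^sup>+z. ennreal K * indicator D z \<partial>?P)"
      using that by (intro nn_integral_mono) (auto simp: indicator_def)
    also have "\<dots> < \<infinity>" using Dfin by (simp add: nn_integral_cmult ennreal_mult_less_top ID)
    finally show ?thesis .
  qed
  have bX: "\<forall>z\<in>D. ennreal (dchi (s (fst z))) \<le> ennreal (dchi k)" "\<forall>z\<in>D. ennreal (dchi (s (snd z))) \<le> ennreal (dchi k)"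
    using Dk(2,3) s_nonneg by (auto intro!: ennreal_leI dchi_mono)
  note X1 = bound[OF bX(1)] and X2 = bound[OF bX(2)]
  have sq: "(x - T y)\<^sup>2 \<le> (b - a)\<^sup>2" if "x \<in> {a<..<b}" for x y
  proof -
    have "\<bar>x - T y\<bar> \<le> \<bar>b - a\<bar>" using T_range[of y] that by auto
    then show ?thesis by (simp add: abs_le_square_iff)
  qed
  have bY: "\<forall>z\<in>D. ennreal ((fst z - T (fst z))\<^sup>2) \<le> ennreal ((b - a)\<^sup>2)"
    "\<forall>z\<in>D. ennreal ((snd z - T (fst z))\<^sup>2) \<le> ennreal ((b - a)\<^sup>2)"
    using DI by (auto intro!: ennreal_leI sq)
  note Y1 = bound[OF bY(1)] and Y2 = bound[OF bY(2)]
  have min: "cost / ennreal (2 * \<tau>) + total_energy chi s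
      \<le> plan_cost \<Gamma> / ennreal (2 * \<tau>) + total_energy chi t"
    by (rule minimal[OF _ t_nonneg t_out \<Gamma>]) measurable
  obtain x1 where x1: "0 \<le> x1" "?X1 = ennreal x1" using X1 by (cases "?X1") auto
  obtain x2 where x2: "0 \<le> x2" "?X2 = ennreal x2" using X2 by (cases "?X2") auto
  obtain y1 where y1: "0 \<le> y1" "?Y1 = ennreal y1" using Y1 by (cases "?Y1") auto
  obtain y2 where y2: "0 \<le> y2" "?Y2 = ennreal y2" using Y2 by (cases "?Y2") auto
  obtain d where d: "0 \<le> d" "?d = ennreal d" using Dfin by (cases "?d") auto
  obtain es where es: "0 \<le> es" "total_energy chi s = ennreal es" using energy_finite by (cases "total_energy chi s") auto
  obtain c0 where c0: "0 \<le> c0" "cost = ennreal c0"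
    using cost_finite by (cases cost) auto
  have "plan_cost \<Gamma>
      \<le> plan_cost \<Gamma> + ennreal \<epsilon> * ?Y1" by simp
  also have "\<dots> = ennreal c0 + ennreal \<epsilon> * ennreal y2" unfolding cost c0 y2 ..
  finally have "plan_cost \<Gamma> \<noteq> top"
    by (rule neq_top_trans[rotated]) (simp add: ennreal_mult_eq_top_iff)
  then obtain c1 where c1: "0 \<le> c1" "plan_cost \<Gamma> = ennreal c1"
    by (cases "plan_cost \<Gamma>") auto
  have two: "2 * ennreal d = ennreal (2 * d)" using ennreal_mult[of 2 d] d(1) by simp
  have "total_energy chi t \<le> total_energy chi t + ennreal \<epsilon> * ?X1" by simp
  also have "\<dots> \<le> ennreal es + ennreal \<epsilon> * ennreal x2 + ennreal (\<epsilon> / (4 * k)) * ennreal (2 * d)"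
    using energy unfolding es x2 d two .
  finally have "total_energy chi t \<noteq> top"
    by (rule neq_top_trans[rotated]) (simp add: ennreal_mult_eq_top_iff)
  then obtain et where et: "0 \<le> et" "total_energy chi t = ennreal et" by (cases "total_energy chi t") auto
  have r1: "c0 / (2 * \<tau>) + es \<le> c1 / (2 * \<tau>) + et"
    using min tau unfolding c0 es c1 et
    by (simp add: divide_ennreal c0(1) c1(1) es(1) et(1) flip: ennreal_plus)
  have r2: "et + \<epsilon> * x1 \<le> es + \<epsilon> * x2 + \<epsilon> / (4 * k) * (2 * d)"
    using energy e k unfolding x1 x2 es d et two
    by (simp add: x1(1) x2(1) es(1) et(1) d(1) flip: ennreal_plus ennreal_mult)
  have r3: "c1 + \<epsilon> * y1 = c0 + \<epsilon> * y2"
    using cost e unfolding y1 y2 c0 c1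
    by (simp add: y1(1) y2(1) c0(1) c1(1) flip: ennreal_plus ennreal_mult)
  have r4: "x2 + y2 / (2 * \<tau>) + 1 / k * d \<le> x1 + y1 / (2 * \<tau>)"
    using gain tau k unfolding x1 x2 y1 y2 d
    by (simp add: divide_ennreal x1(1) x2(1) y1(1) y2(1) d(1) flip: ennreal_plus ennreal_mult)
  have "(c0 - c1) / (2 * \<tau>) \<le> et - es" using r1 by (simp add: diff_divide_distrib)
  moreover have "c0 - c1 = \<epsilon> * (y1 - y2)" using r3 by (simp add: algebra_simps)
  ultimately have "\<epsilon> * ((y1 - y2) / (2 * \<tau>)) \<le> \<epsilon> * (x2 - x1 + d / (2 * k))"
    using r2 by (simp add: algebra_simps)
  then have "(y1 - y2) / (2 * \<tau>) \<le> x2 - x1 + d / (2 * k)" using e by (rule mult_left_le_imp_le)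
  then have "d / k \<le> d / (2 * k)" using r4 by (simp add: diff_divide_distrib)
  then have "d \<le> 0" using k by (simp add: field_simps)
  then show False using pos d by (simp add: D_def)
qed

lemma optimality:
  "AE x in lborel. 0 < s x \<longrightarrow> (AE y in lborel. y \<in> {a<..<b} \<longrightarrow>
     dchi (s x) + (x - T x)\<^sup>2 / (2 * \<tau>) \<le> dchi (s y) + (y - T x)\<^sup>2 / (2 * \<tau>))"
proof -
  have "AE z in lborel \<Otimes>\<^sub>M lborel. \<forall>n. z \<notin> bad_set n"
    unfolding AE_all_countable using bad_set_null bad_set_measurable by (intro allI AE_not_in null_setsI)
  from lborel_pair.AE_pair[OF this] show ?thesis
  proof eventually_elim
    case (elim x)
    show ?case
    proof
      assume sx: "0 < s x"
      then have xI: "x \<in> {a<..<b}" using s_out by force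
      from elim show "AE y in lborel. y \<in> {a<..<b} \<longrightarrow>
        dchi (s x) + (x - T x)\<^sup>2 / (2 * \<tau>) \<le> dchi (s y) + (y - T x)\<^sup>2 / (2 * \<tau>)"
      proof eventually_elim
        case (elim y)
        show ?case
        proof (intro impI, rule ccontr)
          assume y: "y \<in> {a<..<b}" and
            "\<not> dchi (s x) + (x - T x)\<^sup>2 / (2 * \<tau>) \<le> dchi (s y) + (y - T x)\<^sup>2 / (2 * \<tau>)"
          then have "0 < - excess x y" by (simp add: excess_def diff_divide_distrib)
          then have "0 < min (s x) (- excess x y)" using sx by simp
          then obtain n1 where n1: "inverse (real (Suc n1)) < min (s x) (- excess x y)"
            using reals_Archimedean by blast
          obtain n2 where n2: "max (s x) (s y) \<le> real n2" using real_arch_simple by blast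
          define n where "n = max n1 n2"
          have "inverse (real (Suc n)) \<le> inverse (real (Suc n1))" by (simp add: n_def)
          moreover have "real n2 \<le> real (Suc n)" by (simp add: n_def)
          ultimately have "(x, y) \<in> bad_set n"
            using n1 n2 xI y by (auto simp: bad_set_def inverse_eq_divide)
          with elim show False by blast
        qed
      qed
    qed
  qed
qed

end

subsection \<open>Regularity of chi' of the minimiser\<close>

text \<open>Integrating the difference quotients of f from either side of each point bounds the integral
  of G from both sides, so no differentiability of f is needed.\<close>

lemma integral_of_supporting_slopes:
  fixes f G :: "real \<Rightarrow> real"
  assumes cont: "continuous_on UNIV f" and [measurable]: "G \<in> borel_measurable borel"
    and bnd: "\<And>x. \<bar>G x\<bar> \<le> L" and cd: "c \<le> d"
    and supp: "AE x in lborel. x \<in> {c..d} \<longrightarrow> (\<forall>y. f x + (y - x) * G x \<le> f y)"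
  shows "f d - f c = (LBINT x:{c..d}. G x)"
proof -
  define P where "P x = integral {c - 1..x} f" for x
  have f_int: "f integrable_on {x..y}" for x y
    by (intro integrable_continuous_real continuous_on_subset[OF cont]) auto
  have f_sint: "set_integrable lborel {x..y} f" for x y
    by (intro borel_integrable_atLeastAtMost' continuous_on_subset[OF cont]) auto
  have cont_shift: "continuous_on UNIV (\<lambda>x. f (x + \<eta>))" for \<eta>
    by (rule continuous_on_compose2[OF cont]) (auto intro!: continuous_intros)
  have sint_shift: "set_integrable lborel {x..y} (\<lambda>x. f (x + \<eta>))" for x y \<eta>
    by (intro borel_integrable_atLeastAtMost' continuous_on_subset[OF cont_shift]) auto
  have P_deriv: "(P has_real_derivative f x) (at x)" if "x \<in> {c..d}" for x
  proof -
    have "(P has_real_derivative f x) (at x within {c - 1..d + 1})"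
      unfolding P_def[abs_def]
      by (rule integral_has_real_derivative[OF continuous_on_subset[OF cont]]) (use that in auto)
    then show ?thesis using that by (simp add: at_within_Icc_at)
  qed
  have G_int: "set_integrable lborel {c..d} G"
    unfolding set_integrable_def
    by (rule integrableI_bounded_set_indicator[where B=L]) (use bnd in \<open>auto simp: emeasure_lborel_Icc_eq\<close>)
  have quot: "(LBINT x:{c..d}. f (x + \<eta>) - f x) = (P (d + \<eta>) - P d) - (P (c + \<eta>) - P c)" if "\<bar>\<eta>\<bar> < 1" for \<eta>
  proof -
    have "- 1 \<le> \<eta>" using that by linarith
    have "(LBINT x:{c..d}. f (x + \<eta>)) = integral {c..d} (\<lambda>x. f (x + \<eta>))"
      by (intro set_borel_integral_eq_integral(2) sint_shift)
    also have "\<dots> = integral {c + \<eta>..d + \<eta>} f"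
      using integral_shift_real_ivl[of "c + \<eta>" \<eta> "d + \<eta>" f] by simp
    also have "\<dots> = P (d + \<eta>) - P (c + \<eta>)"
      using Henstock_Kurzweil_Integration.integral_combine[of "c - 1" "c + \<eta>" "d + \<eta>" f] f_int \<open>- 1 \<le> \<eta>\<close> cd
      by (simp add: P_def)
    finally have 1: "(LBINT x:{c..d}. f (x + \<eta>)) = P (d + \<eta>) - P (c + \<eta>)" .
    have "(LBINT x:{c..d}. f x) = integral {c..d} f"
      by (intro set_borel_integral_eq_integral(2) f_sint)
    also have "\<dots> = P d - P c"
      using Henstock_Kurzweil_Integration.integral_combine[of "c - 1" c d f] f_int cd
      by (simp add: P_def)
    finally have 2: "(LBINT x:{c..d}. f x) = P d - P c" .
    show ?thesis using set_integral_diff(2)[OF sint_shift f_sint, of c d \<eta>] 1 2 by simp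
  qed
  define q where "q \<eta> = (P (d + \<eta>) - P d) / \<eta> - (P (c + \<eta>) - P c) / \<eta>" for \<eta>
  have lim: "(q \<longlongrightarrow> f d - f c) (at 0)"
    unfolding q_def[abs_def] using P_deriv[of d] P_deriv[of c] cd
    by (intro tendsto_diff) (auto simp: DERIV_def)
  have key: "\<eta> * (LBINT x:{c..d}. G x) \<le> (P (d + \<eta>) - P d) - (P (c + \<eta>) - P c)" if "\<bar>\<eta>\<bar> < 1" for \<eta>
  proof -
    have "(LBINT x:{c..d}. \<eta> * G x) \<le> (LBINT x:{c..d}. f (x + \<eta>) - f x)"
    proof (rule set_integral_mono_AE)
      show "AE x \<in> {c..d} in lborel. \<eta> * G x \<le> f (x + \<eta>) - f x"
        using supp
      proof eventually_elim
        case (elim x)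
        show ?case
        proof
          assume "x \<in> {c..d}"
          with elim have "f x + (x + \<eta> - x) * G x \<le> f (x + \<eta>)" by blast
          then show "\<eta> * G x \<le> f (x + \<eta>) - f x" by simp
        qed
      qed
    qed (use G_int sint_shift f_sint in auto)
    then show ?thesis using quot[OF that] by simp
  qed
  let ?I = "LBINT x:{c..d}. G x"
  have "eventually (\<lambda>\<eta>. ?I \<le> q \<eta>) (at_right 0)"
    unfolding eventually_at_right_field
  proof (intro exI[of _ 1] conjI allI impI)
    fix \<eta> :: real assume "0 < \<eta>" "\<eta> < 1"
    then show "?I \<le> q \<eta>"
      using key[of \<eta>] by (simp add: q_def field_simps flip: diff_divide_distrib)
  qed simp
  then have "?I \<le> f d - f c"
    using lim by (intro tendsto_lowerbound[of q _ "at_right 0"]) (auto simp: filterlim_at_split)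
  moreover have "eventually (\<lambda>\<eta>. q \<eta> \<le> ?I) (at_left 0)"
    unfolding eventually_at_left_field
  proof (intro exI[of _ "-1"] conjI allI impI)
    fix \<eta> :: real assume "-1 < \<eta>" "\<eta> < 0"
    then show "q \<eta> \<le> ?I"
      using key[of \<eta>] by (simp add: q_def field_simps flip: diff_divide_distrib)
  qed simp
  then have "f d - f c \<le> ?I"
    using lim by (intro tendsto_upperbound[of q _ "at_left 0"]) (auto simp: filterlim_at_split)
  ultimately show ?thesis by simp
qed

context jko_step begin

definition g :: "real \<Rightarrow> real" where
  "g x = (if 0 < s x then (T x - x) / \<tau> else 0)"

lemma g_measurable [measurable]: "g \<in> borel_measurable borel"
  unfolding g_def[abs_def] by measurable

lemma g_out: "x \<notin> {a<..<b} \<Longrightarrow> g x = 0"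
  using s_out by (simp add: g_def)

lemma g_bound: "\<bar>g x\<bar> \<le> (b - a) / \<tau>"
proof (cases "0 < s x")
  case True
  then have "x \<in> {a<..<b}" using s_out by force
  then have "\<bar>T x - x\<bar> \<le> b - a" using T_range[of x] by auto
  then show ?thesis using True tau by (simp add: g_def divide_right_mono)
qed (use ab tau in \<open>simp add: g_def\<close>)

definition parabola :: "real \<times> real \<times> real \<Rightarrow> real \<Rightarrow> real" where
  "parabola p y = fst (snd p) + ((fst p - snd (snd p))\<^sup>2 - (y - snd (snd p))\<^sup>2) / (2 * \<tau>)"

lemma parabola_lipschitz:
  assumes "snd (snd p) \<in> {a..b}"
  shows "parabola p y \<le> parabola p z + \<bar>y - z\<bar> * ((\<bar>y\<bar> + \<bar>z\<bar> + 2 * (\<bar>a\<bar> + \<bar>b\<bar>)) / (2 * \<tau>))"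
proof -
  define t where "t = snd (snd p)"
  have "parabola p y - parabola p z = ((z - t)\<^sup>2 - (y - t)\<^sup>2) / (2 * \<tau>)"
    by (simp add: parabola_def t_def diff_divide_distrib)
  also have "(z - t)\<^sup>2 - (y - t)\<^sup>2 = (z - y) * (y + z - 2 * t)"
    by (simp add: power2_eq_square algebra_simps)
  also have "(z - y) * (y + z - 2 * t) \<le> \<bar>y - z\<bar> * (\<bar>y\<bar> + \<bar>z\<bar> + 2 * (\<bar>a\<bar> + \<bar>b\<bar>))"
  proof -
    have "\<bar>y + z - 2 * t\<bar> \<le> \<bar>y\<bar> + \<bar>z\<bar> + 2 * (\<bar>a\<bar> + \<bar>b\<bar>)" using assms by (auto simp: t_def)
    then have "\<bar>(z - y) * (y + z - 2 * t)\<bar> \<le> \<bar>y - z\<bar> * (\<bar>y\<bar> + \<bar>z\<bar> + 2 * (\<bar>a\<bar> + \<bar>b\<bar>))"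
      unfolding abs_mult by (subst abs_minus_commute) (intro mult_left_mono, auto)
    then show ?thesis by (rule order_trans[OF abs_ge_self])
  qed
  finally show ?thesis using tau by (simp add: divide_right_mono)
qed

definition envelope :: "(real \<Rightarrow> real) \<Rightarrow> bool" where
  "envelope u \<longleftrightarrow> continuous_on UNIV u \<and> (\<forall>y. 0 \<le> u y) \<and>
    (AE x\<in>{a<..<b} in lborel. u x = dchi (s x)) \<and>
    (AE x\<in>{a<..<b} in lborel. (\<forall>y. u x + (y - x) * g x - (y - x)\<^sup>2 / (2 * \<tau>) \<le> u y))"

text \<open>The upper envelope of the parabolas given by the optimality condition. A countable dense
  family of parabolas suffices, which avoids an uncountable union of null sets.\<close>

lemma envelope_exists: "\<exists>u. envelope u"
proof -
  define good where "good = {x. 0 < s x \<and> (AE y in lborel. y \<in> {a<..<b} \<longrightarrow>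
     dchi (s x) + (x - T x)\<^sup>2 / (2 * \<tau>) \<le> dchi (s y) + (y - T x)\<^sup>2 / (2 * \<tau>))}"
  define c where "c x = (x, dchi (s x), T x)" for x
  obtain Q where Q: "countable Q" "Q \<subseteq> c ` good" "c ` good \<subseteq> closure Q"
    using separable by blast
  have Qt: "snd (snd p) \<in> {a..b}" if "p \<in> Q" for p
    using that Q(2) T_range by (auto simp: c_def)
  have Q_AE: "AE y in lborel. y \<in> {a<..<b} \<longrightarrow> (\<forall>p\<in>Q. parabola p y \<le> dchi (s y))"
  proof -
    have "AE y in lborel. y \<in> {a<..<b} \<longrightarrow> parabola p y \<le> dchi (s y)" if p: "p \<in> Q" for p
    proof -
      from p Q(2) obtain x where x: "x \<in> good" "p = c x" by blast
      then have "AE y in lborel. y \<in> {a<..<b} \<longrightarrow>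
          dchi (s x) + (x - T x)\<^sup>2 / (2 * \<tau>) \<le> dchi (s y) + (y - T x)\<^sup>2 / (2 * \<tau>)"
        by (simp add: good_def)
      then show ?thesis
        by eventually_elim (auto simp: x c_def parabola_def diff_divide_distrib)
    qed
    then have "AE y in lborel. \<forall>p\<in>Q. y \<in> {a<..<b} \<longrightarrow> parabola p y \<le> dchi (s y)"
      by (subst AE_ball_countable[OF Q(1)]) blast
    then show ?thesis by eventually_elim blast
  qed
  have "\<exists>y0\<in>{a<..<b}. \<forall>p\<in>Q. parabola p y0 \<le> dchi (s y0)"
  proof (rule ccontr)
    assume "\<not> ?thesis"
    with Q_AE have "AE y in lborel. y \<notin> {a<..<b}" by (auto elim!: eventually_mono)
    then have "emeasure lborel {a<..<b} = 0" by (subst (asm) AE_iff_measurable[of "{a<..<b}"]) auto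
    then show False using ab by simp
  qed
  then obtain y0 where y0: "\<And>p. p \<in> Q \<Longrightarrow> parabola p y0 \<le> dchi (s y0)" by blast
  define vh where "vh y = Sup (insert 0 ((\<lambda>p. parabola p y) ` Q))" for y
  define w where "w y z = \<bar>y - z\<bar> * ((\<bar>y\<bar> + \<bar>z\<bar> + 2 * (\<bar>a\<bar> + \<bar>b\<bar>)) / (2 * \<tau>))" for y z :: real
  have w_sym: "w y z = w z y" for y z by (simp add: w_def abs_minus_commute add.commute)
  have w: "0 \<le> w y z" for y z using tau by (simp add: w_def)
  have lip: "parabola p y \<le> parabola p z + w y z" if "p \<in> Q" for p y z
    unfolding w_def by (rule parabola_lipschitz[OF Qt[OF that]])
  have bdd: "bdd_above (insert 0 ((\<lambda>p. parabola p y) ` Q))" for y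
  proof (rule bdd_aboveI)
    fix u assume "u \<in> insert 0 ((\<lambda>p. parabola p y) ` Q)"
    then consider "u = 0" | p where "p \<in> Q" "u = parabola p y" by blast
    then show "u \<le> dchi (s y0) + w y y0"
    proof cases
      case 1
      then show ?thesis using w[of y y0] dchi_nonneg[OF s_nonneg[of y0]] by simp
    next
      case 2
      then show ?thesis using lip[of p y y0] y0[of p] by linarith
    qed
  qed
  have vh_nonneg: "0 \<le> vh y" for y unfolding vh_def using bdd by (intro cSup_upper) auto
  have vh_upper: "parabola p y \<le> vh y" if "p \<in> Q" for p y
    unfolding vh_def using bdd that by (intro cSup_upper) auto
  have vh_lip: "vh y \<le> vh z + w y z" for y z
    unfolding vh_def[of y]
  proof (rule cSup_least)
    fix u assume "u \<in> insert 0 ((\<lambda>p. parabola p y) ` Q)"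
    then consider "u = 0" | p where "p \<in> Q" "u = parabola p y" by blast
    then show "u \<le> vh z + w y z"
    proof cases
      case 1
      then show ?thesis using w[of y z] vh_nonneg[of z] by simp
    next
      case 2
      then show ?thesis using lip[of p y z] vh_upper[of p z] by linarith
    qed
  qed auto
  have "isCont vh z" for z
  proof -
    have "\<bar>vh y - vh z\<bar> \<le> w y z" for y
      using vh_lip[of y z] vh_lip[of z y] w_sym[of y z] by linarith
    then have "\<forall>\<^sub>F y in at z. norm (vh y - vh z) \<le> w y z" by simp
    moreover have "isCont (\<lambda>y. w y z) z"
      unfolding w_def using tau by (intro continuous_intros) simp
    then have "(\<lambda>y. w y z) \<midarrow>z\<rightarrow> 0" by (simp add: isCont_def w_def)
    ultimately have "(\<lambda>y. vh y - vh z) \<midarrow>z\<rightarrow> 0" by (rule Lim_null_comparison)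
    then show ?thesis unfolding isCont_def by (rule Lim_null[THEN iffD2])
  qed
  then have cont: "continuous_on UNIV vh" by (simp add: continuous_at_imp_continuous_on)
  have closure_upper: "parabola p y \<le> vh y" if "p \<in> closure Q" for p y
  proof -
    have "closed {p. parabola p y \<le> vh y}"
      unfolding parabola_def using tau by (intro closed_Collect_le continuous_intros) auto
    then have "closure Q \<subseteq> {p. parabola p y \<le> vh y}"
      by (intro closure_minimal) (use vh_upper in auto)
    then show ?thesis using that by blast
  qed
  have good_upper: "parabola (c x) y \<le> vh y" if "x \<in> good" for x y
    using closure_upper[of "c x" y] Q(3) that by blast
  have AE_good: "AE x in lborel. 0 < s x \<longrightarrow> x \<in> good"
    using optimality by eventually_elim (simp add: good_def)
  have eq: "AE x\<in>{a<..<b} in lborel. vh x = dchi (s x)"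
    using AE_good Q_AE
  proof eventually_elim
    case (elim x)
    show ?case
    proof (intro impI antisym)
      assume "x \<in> {a<..<b}"
      then show "vh x \<le> dchi (s x)"
        unfolding vh_def using elim dchi_nonneg[OF s_nonneg[of x]] by (intro cSup_least) auto
      show "dchi (s x) \<le> vh x"
      proof (cases "0 < s x")
        case True
        then show ?thesis using elim good_upper[of x x] by (simp add: c_def parabola_def)
      next
        case False
        then have "s x = 0" using s_nonneg[of x] by simp
        then show ?thesis using vh_nonneg[of x] by simp
      qed
    qed
  qed
  have "AE x\<in>{a<..<b} in lborel. (\<forall>y. vh x + (y - x) * g x - (y - x)\<^sup>2 / (2 * \<tau>) \<le> vh y)"
    using AE_good eq
  proof eventually_elim
    case (elim x)
    show ?case
    proof (intro impI allI)
      fix y assume xI: "x \<in> {a<..<b}"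
      show "vh x + (y - x) * g x - (y - x)\<^sup>2 / (2 * \<tau>) \<le> vh y"
      proof (cases "0 < s x")
        case True
        have "(x - T x)\<^sup>2 - (y - T x)\<^sup>2 = 2 * ((y - x) * (T x - x)) - (y - x)\<^sup>2"
          by (simp add: power2_eq_square algebra_simps)
        then have "((x - T x)\<^sup>2 - (y - T x)\<^sup>2) / (2 * \<tau>) = (y - x) * g x - (y - x)\<^sup>2 / (2 * \<tau>)"
          using True tau by (simp add: g_def diff_divide_distrib right_diff_distrib)
        then show ?thesis
          using good_upper[of x y] elim xI True by (simp add: c_def parabola_def)
      next
        case False
        then have "s x = 0" using s_nonneg[of x] by simp
        moreover have "0 \<le> (y - x)\<^sup>2 / (2 * \<tau>)" using tau by simp
        ultimately show ?thesis using elim xI vh_nonneg[of y] by (simp add: g_def)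
      qed
    qed
  qed
  with cont vh_nonneg eq show ?thesis unfolding envelope_def by (intro exI[of _ vh] conjI allI)
qed

definition vh :: "real \<Rightarrow> real" where
  "vh = (SOME u. envelope u)"

lemmas vh_props = someI_ex[OF envelope_exists, folded vh_def, unfolded envelope_def]

lemma continuous_on_vh: "continuous_on X vh"
  using vh_props continuous_on_subset by blast

lemma vh_measurable [measurable]: "vh \<in> borel_measurable borel"
  by (rule borel_measurable_continuous_onI[OF continuous_on_vh])

lemma vh_nonneg: "0 \<le> vh y"
  using vh_props by blast

lemma vh_eq: "AE x\<in>{a<..<b} in lborel. vh x = dchi (s x)"
  using vh_props by blast

lemma g_set_integrable: "set_integrable lborel {c..d} g"
  unfolding set_integrable_def
  by (rule integrableI_bounded_set_indicator[where B="(b - a) / \<tau>"])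
    (use g_bound in \<open>auto simp: emeasure_lborel_Icc_eq\<close>)

lemma vh_diff:
  assumes "a \<le> c" "c \<le> d" "d \<le> b" shows "vh d - vh c = (LBINT x:{c..d}. g x)"
proof -
  define G where "G x = (if 0 < s x then T x else max a (min b x))" for x
  have [measurable]: "G \<in> borel_measurable borel" unfolding G_def[abs_def] by measurable
  have G_eq: "G x = \<tau> * g x + x" if "x \<in> {c..d}" for x
    using that assms tau by (simp add: G_def g_def)
  define f where "f y = \<tau> * vh y + y\<^sup>2 / 2" for y
  have "f d - f c = (LBINT x:{c..d}. G x)"
  proof (rule integral_of_supporting_slopes)
    show "continuous_on UNIV f"
      unfolding f_def by (intro continuous_intros continuous_on_vh) simp
    show "\<bar>G x\<bar> \<le> \<bar>a\<bar> + \<bar>b\<bar>" for x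
      using T_range[of x] ab by (auto simp: G_def max_def min_def)
    have "AE x in lborel. x \<notin> {a, b}"
      by (rule AE_not_in) (simp add: finite_imp_null_set_lborel)
    moreover have "AE x\<in>{a<..<b} in lborel. (\<forall>y. vh x + (y - x) * g x - (y - x)\<^sup>2 / (2 * \<tau>) \<le> vh y)"
      using vh_props by blast
    ultimately show "AE x in lborel. x \<in> {c..d} \<longrightarrow> (\<forall>y. f x + (y - x) * G x \<le> f y)"
    proof eventually_elim
      case (elim x)
      show ?case
      proof (intro impI allI)
        fix y assume x: "x \<in> {c..d}"
        then have "vh x + (y - x) * g x - (y - x)\<^sup>2 / (2 * \<tau>) \<le> vh y"
          using elim assms by auto
        then have "\<tau> * (vh x + (y - x) * g x - (y - x)\<^sup>2 / (2 * \<tau>)) \<le> \<tau> * vh y"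
          using tau by simp
        moreover have "\<tau> * (vh x + (y - x) * g x - (y - x)\<^sup>2 / (2 * \<tau>)) = \<tau> * vh x + (y - x) * (\<tau> * g x) - (y - x)\<^sup>2 / 2"
          using tau by (simp add: field_simps)
        moreover have "x\<^sup>2 / 2 + (y - x) * x = y\<^sup>2 / 2 - (y - x)\<^sup>2 / 2"
          by (simp add: power2_eq_square field_simps)
        ultimately show "f x + (y - x) * G x \<le> f y"
          unfolding f_def G_eq[OF x] distrib_left by linarith
      qed
    qed
  qed (use assms in auto)
  also have "\<dots> = (LBINT x:{c..d}. \<tau> * g x + x)"
    by (rule set_lebesgue_integral_cong) (auto simp: G_eq)
  also have "\<dots> = \<tau> * (LBINT x:{c..d}. g x) + (LBINT x:{c..d}. x)"
    using g_set_integrable borel_integrable_atLeastAtMost'[of c d "\<lambda>x. x"]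
    by (subst set_integral_add) (auto intro!: continuous_intros)
  also have "(LBINT x:{c..d}. x) = d\<^sup>2 / 2 - c\<^sup>2 / 2"
  proof -
    have "(LBINT x:{c..d}. x) = integral {c..d} (\<lambda>x. x)"
      by (intro set_borel_integral_eq_integral(2) borel_integrable_atLeastAtMost') (auto intro!: continuous_intros)
    also have "\<dots> = d\<^sup>2 / 2 - c\<^sup>2 / 2"
      using assms(2) ident_has_integral[of c d] by (simp add: diff_divide_distrib integral_unique)
    finally show ?thesis .
  qed
  finally have "\<tau> * (vh d - vh c) = \<tau> * (LBINT x:{c..d}. g x)"
    by (simp add: f_def algebra_simps)
  then show ?thesis using tau by simp
qed

lemma vh_S_le:
  assumes "y \<in> {a..b}" shows "vh (S y) \<le> vh y"
proof (cases "S y \<le> y")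
  case True
  have "0 \<le> (LBINT x:{S y..y}. g x)"
    unfolding set_lebesgue_integral_def
  proof (rule integral_nonneg_AE)
    have "AE x in lborel. x \<noteq> S y" by (rule AE_lborel_singleton)
    then show "AE x in lborel. 0 \<le> indicator {S y..y} x *\<^sub>R g x"
    proof eventually_elim
      case (elim x)
      have "0 \<le> g x" if "x \<in> {S y..y}"
        using less_T_of_S_less[of y x] elim that assms tau by (auto simp: g_def)
      then show ?case by (simp add: indicator_def)
    qed
  qed
  then show ?thesis using vh_diff[of "S y" y] True assms S_range[of y] by simp
next
  case False
  have "0 \<le> (LBINT x:{y..S y}. - g x)"
    unfolding set_lebesgue_integral_def
  proof (rule integral_nonneg_AE)
    have "AE x in lborel. x \<noteq> S y" by (rule AE_lborel_singleton)
    then show "AE x in lborel. 0 \<le> indicator {y..S y} x *\<^sub>R - g x"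
    proof eventually_elim
      case (elim x)
      have "g x \<le> 0" if "x \<in> {y..S y}"
        using T_le_of_less_S[of x y] elim that assms tau by (auto simp: g_def divide_nonpos_pos)
      then show ?case by (simp add: indicator_def)
    qed
  qed
  then show ?thesis using vh_diff[of y "S y"] False assms S_range[of y] by (simp add: set_lebesgue_integral_def)
qed

end

subsection \<open>Maximum principle and entropy dissipation\<close>

lemma integrable_on_interval:
  fixes f :: "real \<Rightarrow> real" and a b :: real
  assumes [measurable]: "f \<in> borel_measurable borel"
    and "\<And>x. x \<notin> {a..b} \<Longrightarrow> f x = 0" "AE x in lborel. \<bar>f x\<bar> \<le> B"
  shows "integrable lborel f"
  by (rule integrableI_bounded_set[where A="{a..b}" and B=B])
    (use assms in \<open>auto simp: emeasure_lborel_Icc_eq elim: eventually_mono\<close>)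

lemma (in energy_density) entropy_integrable:
  fixes a b M :: real
  assumes [measurable]: "u \<in> borel_measurable borel" and u: "\<And>x. 0 \<le> u x" "\<And>x. x \<notin> {a<..<b} \<Longrightarrow> u x = 0"
    "AE x in lborel. u x \<le> M"
  shows "integrable lborel (\<lambda>x. u x * kappa chi (u x))" "integrable lborel (\<lambda>x. dchi (u x))"
    "integrable lborel (\<lambda>x. entropy (u x))"
proof -
  have "AE x in lborel. \<bar>u x * kappa chi (u x)\<bar> \<le> dchi 1 + \<bar>M\<bar> * \<bar>kappa chi (max 1 M)\<bar>"
    using u(3) by eventually_elim (use u(1) kappa_times_bounded in blast)
  then show 1: "integrable lborel (\<lambda>x. u x * kappa chi (u x))"
    by (intro integrable_on_interval[where a=a and b=b, OF borel_measurable_kappa]) (use u in auto)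
  have "AE x in lborel. \<bar>dchi (u x)\<bar> \<le> dchi M"
    using u(3) by eventually_elim (use u(1) dchi_mono dchi_nonneg in auto)
  then show 2: "integrable lborel (\<lambda>x. dchi (u x))"
    by (intro integrable_on_interval[where a=a and b=b, OF borel_measurable_dchi]) (use u in auto)
  show "integrable lborel (\<lambda>x. entropy (u x))"
    unfolding entropy_def using 1 2 by simp
qed

context jko_step begin

lemma S_T_eq: "AE x in lborel. 0 < s x \<longrightarrow> S (T x) = x"
proof -
  have count: "countable (T ` \<rat>)" by (intro countable_image countable_rat)
  then have [measurable]: "T ` \<rat> \<in> sets borel"
    by (rule sets.countable[rotated]) simp
  have "(\<integral>\<^sup>+x. indicator (T ` \<rat>) (T x) * ennreal (s x) \<partial>lborel) = (\<integral>\<^sup>+y. ennreal (h y) * indicator (T ` \<rat>) y \<partial>lborel)"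
    by (subst nn_push) (auto simp: mult.commute)
  also have "\<dots> = 0"
    using count by (intro nn_integral_null_set countable_imp_null_set_lborel)
  finally have "AE x in lborel. indicator (T ` \<rat>) (T x) * ennreal (s x) = 0"
    by (subst (asm) nn_integral_0_iff_AE) auto
  then show ?thesis
  proof eventually_elim
    case (elim x)
    show ?case
    proof (rule impI, rule ccontr)
      assume sx: "0 < s x" and ne: "S (T x) \<noteq> x"
      then have xI: "x \<in> {a<..<b}" using s_out by force
      with ne have "x < S (T x)" using le_S_T[of x] by auto
      then obtain q where q: "q \<in> \<rat>" "x < q" "q < S (T x)" using Rats_dense_in_real by blast
      then have "T q \<le> T x" using T_le_of_less_S[of q "T x"] xI by auto
      moreover have "T x \<le> T q" using monoD[OF T_mono, of x q] q by simp
      ultimately have "T x \<in> T ` \<rat>" using q(1) by (metis antisym image_eqI)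
      with elim sx show False by (auto simp: indicator_def)
    qed
  qed
qed

lemma nn_integral_pull:
  assumes [measurable]: "F \<in> borel_measurable borel"
  shows "(\<integral>\<^sup>+y. F (S y) * ennreal (h y) \<partial>lborel) = (\<integral>\<^sup>+x. F x * ennreal (s x) \<partial>lborel)"
proof -
  have "(\<integral>\<^sup>+y. F (S y) * ennreal (h y) \<partial>lborel) = (\<integral>\<^sup>+x. F (S (T x)) * ennreal (s x) \<partial>lborel)"
    by (rule nn_push[symmetric]) measurable
  also have "\<dots> = (\<integral>\<^sup>+x. F x * ennreal (s x) \<partial>lborel)"
    using S_T_eq by (intro nn_integral_cong_AE, eventually_elim) (use s_nonneg in \<open>force simp: less_le\<close>)
  finally show ?thesis .
qed

lemma integral_pull:
  fixes F :: "real \<Rightarrow> real"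
  assumes [measurable]: "F \<in> borel_measurable borel"
  shows "(\<integral>y. F (S y) * h y \<partial>lborel) = (\<integral>x. F x * s x \<partial>lborel)"
    and "integrable lborel (\<lambda>x. F x * s x) \<Longrightarrow> integrable lborel (\<lambda>y. F (S y) * h y)"
proof -
  have eq: "AE x in lborel. s x *\<^sub>R F (S (T x)) = s x *\<^sub>R F x"
    using S_T_eq
  proof eventually_elim
    case (elim x)
    then show ?case using s_nonneg[of x] by (cases "s x = 0") auto
  qed
  have "(\<integral>y. F (S y) * h y \<partial>lborel) = (\<integral>y. F (S y) \<partial>density lborel h)"
    by (subst integral_density) (auto simp: h_nonneg mult.commute)
  also have "\<dots> = (\<integral>x. F (S (T x)) \<partial>density lborel s)"
    unfolding push[symmetric] by (rule integral_distr) auto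
  also have "\<dots> = (\<integral>x. s x *\<^sub>R F (S (T x)) \<partial>lborel)"
    by (subst integral_density) (auto simp: s_nonneg)
  also have "\<dots> = (\<integral>x. s x *\<^sub>R F x \<partial>lborel)"
    using eq by (intro integral_cong_AE) auto
  finally show "(\<integral>y. F (S y) * h y \<partial>lborel) = (\<integral>x. F x * s x \<partial>lborel)"
    by (simp add: mult.commute)
  assume int: "integrable lborel (\<lambda>x. F x * s x)"
  then have "integrable lborel (\<lambda>x. s x *\<^sub>R F x)" by (simp add: mult.commute)
  then have "integrable lborel (\<lambda>x. s x *\<^sub>R F (S (T x)))"
    by (rule integrable_cong_AE_imp) (use eq in auto)
  then have "integrable (density lborel s) (\<lambda>x. F (S (T x)))"
    by (subst integrable_density) (auto simp: s_nonneg)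
  then have "integrable (distr (density lborel s) lborel T) (\<lambda>y. F (S y))"
    by (subst integrable_distr_eq) auto
  then show "integrable lborel (\<lambda>y. F (S y) * h y)"
    unfolding push by (subst (asm) integrable_density) (auto simp: h_nonneg mult.commute)
qed

text \<open>As vh increases from S y to y, the set where vh exceeds chi'(M) contains its preimage under
  S; hence its s-mass is at most M times its length.\<close>

lemma s_le: "AE x in lborel. s x \<le> M"
proof -
  define A where "A = {x \<in> {a<..<b}. dchi M < vh x}"
  have [measurable]: "A \<in> sets borel" unfolding A_def by measurable
  have AI: "A \<subseteq> {a<..<b}" by (auto simp: A_def)
  have big: "AE x in lborel. x \<in> A \<longrightarrow> M < s x"
    using vh_eq
  proof eventually_elim
    case (elim x)
    show ?case
    proof
      assume "x \<in> A"
      then have "dchi M < dchi (s x)" using elim by (auto simp: A_def)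
      then show "M < s x" using dchi_mono[OF s_nonneg[of x], of M] by linarith
    qed
  qed
  let ?mA = "(\<integral>\<^sup>+x. ennreal M * indicator A x \<partial>lborel)"
  have fin: "?mA \<noteq> top"
  proof -
    have "emeasure lborel A \<le> emeasure lborel {a<..<b}" using AI by (intro emeasure_mono) auto
    also have "\<dots> < top" using ab by simp
    finally show ?thesis by (simp add: nn_integral_cmult_indicator ennreal_mult_eq_top_iff)
  qed
  have "?mA + (\<integral>\<^sup>+x. ennreal (s x - M) * indicator A x \<partial>lborel)
     = (\<integral>\<^sup>+x. ennreal M * indicator A x + ennreal (s x - M) * indicator A x \<partial>lborel)"
    by (rule nn_integral_add[symmetric]) measurable
  also have "\<dots> = (\<integral>\<^sup>+x. indicator A x * ennreal (s x) \<partial>lborel)"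
    using big
  proof (intro nn_integral_cong_AE, eventually_elim)
    case (elim x)
    then show ?case using M by (auto simp: indicator_def simp flip: ennreal_plus)
  qed
  also have "\<dots> = (\<integral>\<^sup>+y. indicator A (S y) * ennreal (h y) \<partial>lborel)"
    by (rule nn_integral_pull[symmetric]) measurable
  also have "\<dots> \<le> ?mA"
    using h_le
  proof (intro nn_integral_mono_AE, eventually_elim)
    case (elim y)
    show ?case
    proof (cases "S y \<in> A \<and> y \<in> {a<..<b}")
      case True
      then have "y \<in> A" using vh_S_le[of y] by (auto simp: A_def)
      then show ?thesis using True elim by (simp add: ennreal_leI)
    qed (use h_out[of y] in \<open>auto simp: indicator_def\<close>)
  qed
  finally have "(\<integral>\<^sup>+x. ennreal (s x - M) * indicator A x \<partial>lborel) \<le> 0"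
    using fin by (metis add.right_neutral ennreal_add_left_cancel_le infinity_ennreal_def)
  then have "(\<integral>\<^sup>+x. ennreal (s x - M) * indicator A x \<partial>lborel) = 0" by simp
  then have "AE x in lborel. ennreal (s x - M) * indicator A x = 0"
    by (subst (asm) nn_integral_0_iff_AE) auto
  then show ?thesis
    using big vh_eq
  proof eventually_elim
    case (elim x)
    show ?case
    proof (cases "x \<in> {a<..<b}")
      case True
      have "x \<notin> A" using elim by (auto simp: indicator_def)
      then have "dchi (s x) \<le> dchi M" using True elim by (auto simp: A_def)
      then show ?thesis using dchi_strict_mono[of M "s x"] M by linarith
    qed (use s_out M in simp)
  qed
qed

text \<open>Displacement convexity: the tangent of the entropy density at s (S y) is integrated in y.\<close>

lemma entropy_gap_ge:
  "(\<integral>x. entropy (s x) \<partial>lborel) + (\<integral>y. (vh y - vh (S y)) * indicator {a<..<b} y \<partial>lborel) \<le> (\<integral>x. entropy (h x) \<partial>lborel)"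
proof -
  define k where "k x = (if 0 < s x then kappa chi (s x) else 0)" for x
  have ks: "k x * s x = s x * kappa chi (s x)" for x
    using s_nonneg[of x] by (cases "s x = 0") (auto simp: k_def)
  have [measurable]: "k \<in> borel_measurable borel"
  proof -
    have [measurable]: "(\<lambda>x. s x * kappa chi (s x)) \<in> borel_measurable borel"
      by (rule borel_measurable_kappa) (auto simp: s_nonneg)
    have "k = (\<lambda>x. if 0 < s x then (s x * kappa chi (s x)) / s x else 0)" by (auto simp: k_def)
    also have "\<dots> \<in> borel_measurable borel" by measurable
    finally show ?thesis .
  qed
  note ints = entropy_integrable[OF s_meas s_nonneg s_out s_le]
  have ik: "integrable lborel (\<lambda>x. k x * s x)" unfolding ks by (rule ints(1))
  obtain B where B: "\<And>x. x \<in> {a..b} \<Longrightarrow> \<bar>vh x\<bar> \<le> B"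
    using compact_imp_bounded[OF compact_continuous_image[OF continuous_on_vh compact_Icc]]
    unfolding bounded_iff by (metis imageI real_norm_def)
  have B0: "0 \<le> B" using B[of a] ab by force
  have i1: "integrable lborel (\<lambda>y. vh y * indicator {a<..<b} y)"
    by (rule integrable_on_interval[where a=a and b=b and B=B]) (use B B0 in \<open>auto simp: indicator_def\<close>)
  have i2: "integrable lborel (\<lambda>y. vh (S y) * indicator {a<..<b} y)"
    by (rule integrable_on_interval[where a=a and b=b and B=B]) (use B B0 S_range in \<open>auto simp: indicator_def\<close>)
  define N where "N = {x. \<not> (0 < s x \<and> dchi (s x) = vh x)}"
  have [measurable]: "N \<in> sets borel" unfolding N_def by measurable
  have "(\<integral>\<^sup>+y. indicator N (S y) * ennreal (h y) \<partial>lborel) = (\<integral>\<^sup>+x. indicator N x * ennreal (s x) \<partial>lborel)"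
    by (rule nn_integral_pull) measurable
  also have "\<dots> = 0"
  proof (subst nn_integral_0_iff_AE)
    show "AE x in lborel. indicator N x * ennreal (s x) = 0"
      using vh_eq
    proof eventually_elim
      case (elim x)
      then show ?case using s_nonneg[of x] s_out[of x]
        by (cases "0 < s x") (auto simp: N_def indicator_def less_le)
    qed
  qed measurable
  finally have "AE y in lborel. indicator N (S y) * ennreal (h y) = 0"
    by (subst (asm) nn_integral_0_iff_AE) auto
  then have le: "AE y in lborel. k (S y) * h y - vh (S y) * indicator {a<..<b} y \<le> entropy (h y)"
  proof eventually_elim
    case (elim y)
    show ?case
    proof (cases "h y = 0")
      case True
      then show ?thesis using vh_nonneg[of "S y"] by simp
    next
      case False
      then have "0 < h y" using h_nonneg[of y] by simp
      with elim have "S y \<notin> N" by (auto simp: indicator_def)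
      then have "0 < s (S y)" "dchi (s (S y)) = vh (S y)" by (auto simp: N_def)
      moreover have "y \<in> {a<..<b}" using False h_out by blast
      ultimately show ?thesis using entropy_tangent[of "s (S y)" "h y"] h_nonneg[of y] by (simp add: k_def)
    qed
  qed
  have "(\<integral>y. k (S y) * h y - vh (S y) * indicator {a<..<b} y \<partial>lborel) \<le> (\<integral>y. entropy (h y) \<partial>lborel)"
    using le by (intro integral_mono_AE Bochner_Integration.integrable_diff integral_pull(2) ik i2
        entropy_integrable(3)[OF h_meas h_nonneg h_out h_le]) auto
  moreover have "(\<integral>y. k (S y) * h y - vh (S y) * indicator {a<..<b} y \<partial>lborel)
     = (\<integral>x. s x * kappa chi (s x) \<partial>lborel) - (\<integral>y. vh (S y) * indicator {a<..<b} y \<partial>lborel)"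
    using integral_pull(1)[of k] integral_pull(2)[of k] ik i2 by (simp add: ks)
  moreover have "(\<integral>x. s x * kappa chi (s x) \<partial>lborel) = (\<integral>x. entropy (s x) \<partial>lborel) + (\<integral>x. dchi (s x) \<partial>lborel)"
    unfolding entropy_def using ints(1,2) by simp
  moreover have "(\<integral>x. dchi (s x) \<partial>lborel) = (\<integral>y. vh y * indicator {a<..<b} y \<partial>lborel)"
  proof (rule integral_cong_AE)
    show "AE x in lborel. dchi (s x) = vh x * indicator {a<..<b} x"
      using vh_eq by eventually_elim (auto simp: indicator_def s_out)
  qed auto
  moreover have "(\<integral>y. (vh y - vh (S y)) * indicator {a<..<b} y \<partial>lborel)
     = (\<integral>y. vh y * indicator {a<..<b} y \<partial>lborel) - (\<integral>y. vh (S y) * indicator {a<..<b} y \<partial>lborel)"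
    using i1 i2 by (simp add: left_diff_distrib)
  ultimately show ?thesis by linarith
qed

lemma integrable_on_square:
  fixes f :: "real \<times> real \<Rightarrow> real"
  assumes [measurable]: "f \<in> borel_measurable (lborel \<Otimes>\<^sub>M lborel)"
    and "\<And>z. z \<notin> {a..b} \<times> {a..b} \<Longrightarrow> f z = 0" "\<And>z. \<bar>f z\<bar> \<le> B"
  shows "integrable (lborel \<Otimes>\<^sub>M lborel) f"
proof (rule integrableI_bounded_set[where A="{a..b} \<times> {a..b}" and B=B])
  show "emeasure (lborel \<Otimes>\<^sub>M lborel) ({a..b} \<times> {a..b}) < \<infinity>"
    using ab by (subst lborel.emeasure_pair_measure_Times) (auto simp: ennreal_mult_less_top)
qed (use assms in auto)

text \<open>Both sides integrate the slope g over the region between the graph of T and the diagonal.\<close>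

lemma integral_vh_diff:
  "(\<integral>y. (vh y - vh (S y)) * indicator {a<..<b} y \<partial>lborel) = \<tau> * (\<integral>x. (g x)\<^sup>2 \<partial>lborel)"
proof -
  define F :: "real \<Rightarrow> real \<Rightarrow> real"
    where "F x y = g x * ((if x < y \<and> y < T x then 1 else 0) - (if T x \<le> y \<and> y < x then 1 else 0))" for x y
  have [measurable]: "case_prod F \<in> borel_measurable (lborel \<Otimes>\<^sub>M lborel)"
    unfolding F_def split_beta' by measurable
  have F0: "F x y = 0" if "x \<notin> {a<..<b} \<or> y \<notin> {a..b}" for x y
  proof (cases "x \<in> {a<..<b}")
    case True
    with that have "y \<notin> {a..b}" by simp
    then have "\<not> (x < y \<and> y < T x)" "\<not> (T x \<le> y \<and> y < x)"
      using True T_range[of x] by auto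
    then show ?thesis by (auto simp: F_def)
  qed (simp add: F_def g_out)
  have int: "integrable (lborel \<Otimes>\<^sub>M lborel) (case_prod F)"
  proof (rule integrable_on_square[where B="(b - a) / \<tau>"])
    show "case_prod F z = 0" if "z \<notin> {a..b} \<times> {a..b}" for z
      using that F0[of "fst z" "snd z"] by (cases z) auto
    show "\<bar>case_prod F z\<bar> \<le> (b - a) / \<tau>" for z
      using g_bound[of "fst z"] ab tau by (cases z) (auto simp: F_def)
  qed simp
  have "(\<integral>y. F x y \<partial>lborel) = \<tau> * (g x)\<^sup>2" for x
  proof -
    have "(\<integral>y. F x y \<partial>lborel) = g x * (T x - x)"
    proof (cases "x \<le> T x")
      case True
      then have "F x = (\<lambda>y. g x * indicator {x<..<T x} y)"
        by (auto simp: F_def indicator_def)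
      then show ?thesis using True by simp
    next
      case False
      then have "F x = (\<lambda>y. - g x * indicator {T x..<x} y)"
        by (auto simp: F_def indicator_def)
      then show ?thesis using False by (simp add: algebra_simps)
    qed
    also have "\<dots> = \<tau> * (g x)\<^sup>2"
      using tau by (simp add: g_def power2_eq_square)
    finally show ?thesis .
  qed
  then have "(\<integral>y. (\<integral>x. F x y \<partial>lborel) \<partial>lborel) = \<tau> * (\<integral>x. (g x)\<^sup>2 \<partial>lborel)"
    by (subst lborel_pair.Fubini_integral[OF int]) simp
  moreover have "AE y in lborel. (vh y - vh (S y)) * indicator {a<..<b} y = (\<integral>x. F x y \<partial>lborel)"
  proof -
    have "AE y in lborel. y \<notin> {a, b}"
      by (rule AE_not_in) (simp add: finite_imp_null_set_lborel)
    then show ?thesis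
    proof eventually_elim
      case (elim y)
      show ?case
      proof (cases "y \<in> {a<..<b}")
        case False
        then have "F x y = 0" for x using elim by (intro F0) auto
        then show ?thesis using False by simp
      next
        case yI: True
        have ne: "AE x in lborel. x \<noteq> S y \<and> x \<noteq> y"
          using AE_lborel_singleton[of "S y"] AE_lborel_singleton[of y] by eventually_elim simp
        show ?thesis
        proof (cases "S y \<le> y")
          case True
          have "(\<integral>x. F x y \<partial>lborel) = (\<integral>x. indicator {S y..y} x *\<^sub>R g x \<partial>lborel)"
          proof (rule integral_cong_AE)
            show "AE x in lborel. F x y = indicator {S y..y} x *\<^sub>R g x"
              using ne
            proof eventually_elim
              case (elim x)
              show ?case
              proof (cases "x \<in> {a<..<b}")
                case xI: True
                show ?thesis
                  using less_T_of_S_less[of y x] T_le_of_less_S[of x y] xI elim True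
                  by (cases "x < S y") (auto simp: F_def indicator_def)
              qed (simp add: F_def g_out)
            qed
          qed (auto simp: F_def)
          also have "\<dots> = vh y - vh (S y)"
            using vh_diff[of "S y" y] True yI S_range[of y] by (simp add: set_lebesgue_integral_def)
          finally show ?thesis using yI by simp
        next
          case False
          have "(\<integral>x. F x y \<partial>lborel) = (\<integral>x. - (indicator {y..S y} x *\<^sub>R g x) \<partial>lborel)"
          proof (rule integral_cong_AE)
            show "AE x in lborel. F x y = - (indicator {y..S y} x *\<^sub>R g x)"
              using ne
            proof eventually_elim
              case (elim x)
              show ?case
              proof (cases "x \<in> {a<..<b}")
                case xI: True
                show ?thesis
                  using less_T_of_S_less[of y x] T_le_of_less_S[of x y] xI elim False
                  by (cases "x < S y") (auto simp: F_def indicator_def)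
              qed (simp add: F_def g_out)
            qed
          qed (auto simp: F_def)
          also have "\<dots> = vh y - vh (S y)"
            using vh_diff[of y "S y"] False yI S_range[of y] by (simp add: set_lebesgue_integral_def)
          finally show ?thesis using yI by simp
        qed
      qed
    qed
  qed
  then have "(\<integral>y. (vh y - vh (S y)) * indicator {a<..<b} y \<partial>lborel) = (\<integral>y. (\<integral>x. F x y \<partial>lborel) \<partial>lborel)"
    by (intro integral_cong_AE lborel.borel_measurable_lebesgue_integral) measurable
  ultimately show ?thesis by simp
qed

lemma integration_by_parts:
  assumes \<phi>: "\<And>x. (\<phi> has_real_derivative \<phi>' x) (at x)" and cont: "continuous_on UNIV \<phi>'"
    and bd: "\<phi> a = 0" "\<phi> b = 0"
  shows "(\<integral>x. dchi (s x) * \<phi>' x * indicator {a<..<b} x \<partial>lborel) = - (\<integral>x. g x * \<phi> x \<partial>lborel)"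
proof -
  have [measurable]: "\<phi>' \<in> borel_measurable borel" by (rule borel_measurable_continuous_onI[OF cont])
  obtain B where B: "\<And>x. x \<in> {a..b} \<Longrightarrow> \<bar>\<phi>' x\<bar> \<le> B"
    using compact_imp_bounded[OF compact_continuous_image[OF continuous_on_subset[OF cont] compact_Icc[of a b]]]
    unfolding bounded_iff by (metis imageI real_norm_def subset_UNIV)
  have B0: "0 \<le> B" using B[of a] ab by force
  obtain C where C: "\<And>x. x \<in> {a..b} \<Longrightarrow> \<bar>vh x\<bar> \<le> C"
    using compact_imp_bounded[OF compact_continuous_image[OF continuous_on_vh compact_Icc]]
    unfolding bounded_iff by (metis imageI real_norm_def)
  have C0: "0 \<le> C" using C[of a] ab by force
  have \<phi>_int: "(\<integral>x. \<phi>' x * indicator {t..b} x \<partial>lborel) = \<phi> b - \<phi> t" if "t \<le> b" for t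
    using integral_FTC_Icc_real[of t b \<phi> \<phi>'] that \<phi> continuous_on_eq_continuous_at[of UNIV \<phi>'] cont
    by (simp add: DERIV_subset mult.commute)
  define F :: "real \<Rightarrow> real \<Rightarrow> real"
    where "F t x = g t * (\<phi>' x * indicator {a<..<b} x * (if t < x then 1 else 0))" for t x
  have [measurable]: "case_prod F \<in> borel_measurable (lborel \<Otimes>\<^sub>M lborel)"
    unfolding F_def split_beta' by measurable
  have int: "integrable (lborel \<Otimes>\<^sub>M lborel) (case_prod F)"
  proof (rule integrable_on_square[where B="(b - a) / \<tau> * B"])
    show "case_prod F z = 0" if "z \<notin> {a..b} \<times> {a..b}" for z
      using that g_out[of "fst z"] by (cases z) (auto simp: F_def indicator_def)
    show "\<bar>case_prod F z\<bar> \<le> (b - a) / \<tau> * B" for z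
    proof -
      have "\<bar>\<phi>' (snd z) * indicator {a<..<b} (snd z) * (if fst z < snd z then 1 else 0)\<bar> \<le> B"
        using B[of "snd z"] B0 by (auto simp: indicator_def)
      then show ?thesis
        unfolding F_def split_beta' abs_mult[of "g (fst z)"] using g_bound[of "fst z"] ab tau
        by (intro mult_mono) auto
    qed
  qed simp
  have inner1: "(\<integral>x. F t x \<partial>lborel) = - (g t * \<phi> t)" for t
  proof (cases "t \<in> {a<..<b}")
    case True
    have "(\<integral>x. F t x \<partial>lborel) = (\<integral>x. g t * (\<phi>' x * indicator {t..b} x) \<partial>lborel)"
    proof (rule integral_cong_AE)
      have "AE x in lborel. x \<noteq> t \<and> x \<noteq> b"
        using AE_lborel_singleton[of t] AE_lborel_singleton[of b] by eventually_elim simp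
      then show "AE x in lborel. F t x = g t * (\<phi>' x * indicator {t..b} x)"
        by eventually_elim (use True in \<open>auto simp: F_def indicator_def\<close>)
    qed (auto simp: F_def)
    also have "\<dots> = - (g t * \<phi> t)" using \<phi>_int[of t] True bd by simp
    finally show ?thesis .
  qed (simp add: F_def g_out)
  have inner2: "(\<integral>t. F t x \<partial>lborel) = (vh x - vh a) * \<phi>' x * indicator {a<..<b} x" for x
  proof (cases "x \<in> {a<..<b}")
    case True
    have "(\<integral>t. F t x \<partial>lborel) = (\<integral>t. \<phi>' x * (indicator {a..x} t *\<^sub>R g t) \<partial>lborel)"
    proof (rule integral_cong_AE)
      show "AE t in lborel. F t x = \<phi>' x * (indicator {a..x} t *\<^sub>R g t)"
        using AE_lborel_singleton[of x]
      proof eventually_elim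
        case (elim t)
        show ?case using elim True g_out[of t]
          by (cases "t \<in> {a<..<b}") (auto simp: F_def indicator_def)
      qed
    qed (auto simp: F_def)
    also have "\<dots> = \<phi>' x * (vh x - vh a)"
      using vh_diff[of a x] True by (simp add: set_lebesgue_integral_def)
    finally show ?thesis using True by simp
  qed (simp add: F_def)
  have i1: "integrable lborel (\<lambda>x. vh x * \<phi>' x * indicator {a<..<b} x)"
    by (rule integrable_on_interval[where a=a and b=b and B="C * B"])
      (use B B0 C C0 in \<open>auto simp: indicator_def abs_mult intro!: mult_mono\<close>)
  have i2: "integrable lborel (\<lambda>x. vh a * \<phi>' x * indicator {a<..<b} x)"
    by (rule integrable_on_interval[where a=a and b=b and B="C * B"])
      (use B B0 C C0 ab in \<open>auto simp: indicator_def abs_mult intro!: mult_mono\<close>)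
  have zero: "(\<integral>x. vh a * \<phi>' x * indicator {a<..<b} x \<partial>lborel) = 0"
  proof -
    have "(\<integral>x. vh a * \<phi>' x * indicator {a<..<b} x \<partial>lborel) = (\<integral>x. vh a * (\<phi>' x * indicator {a..b} x) \<partial>lborel)"
    proof (rule integral_cong_AE)
      have "AE x in lborel. x \<noteq> a \<and> x \<noteq> b"
        using AE_lborel_singleton[of a] AE_lborel_singleton[of b] by eventually_elim simp
      then show "AE x in lborel. vh a * \<phi>' x * indicator {a<..<b} x = vh a * (\<phi>' x * indicator {a..b} x)"
        by eventually_elim (auto simp: indicator_def)
    qed auto
    then show ?thesis using \<phi>_int[of a] ab bd by simp
  qed
  have "(\<integral>x. dchi (s x) * \<phi>' x * indicator {a<..<b} x \<partial>lborel) = (\<integral>x. vh x * \<phi>' x * indicator {a<..<b} x \<partial>lborel)"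
  proof (rule integral_cong_AE)
    show "AE x in lborel. dchi (s x) * \<phi>' x * indicator {a<..<b} x = vh x * \<phi>' x * indicator {a<..<b} x"
      using vh_eq by eventually_elim (auto simp: indicator_def)
  qed auto
  also have "\<dots> = (\<integral>x. (vh x - vh a) * \<phi>' x * indicator {a<..<b} x \<partial>lborel)"
    using i1 i2 zero by (simp add: left_diff_distrib)
  also have "\<dots> = (\<integral>x. (\<integral>t. F t x \<partial>lborel) \<partial>lborel)" by (simp add: inner2)
  also have "\<dots> = (\<integral>t. (\<integral>x. F t x \<partial>lborel) \<partial>lborel)"
    by (rule lborel_pair.Fubini_integral[OF int])
  also have "\<dots> = - (\<integral>x. g x * \<phi> x \<partial>lborel)" by (simp add: inner1)
  finally show ?thesis .
qed

lemma weak_deriv_L2_g: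
  assumes u: "\<And>x. x \<in> {a<..<b} \<Longrightarrow> u x = s x"
  shows "weak_deriv_L2 a b (\<lambda>x. dchi (u x)) g"
  unfolding weak_deriv_L2_def
proof (intro conjI allI impI)
  have int: "integrable lborel (\<lambda>x. dchi (s x))"
    by (rule entropy_integrable(2)[OF s_meas s_nonneg s_out s_le])
  show "set_integrable lborel {c..d} (\<lambda>x. dchi (u x))" if "a < c" "d < b" for c d
  proof -
    have "(\<lambda>x. indicator {c..d} x *\<^sub>R dchi (u x)) = (\<lambda>x. indicator {c..d} x *\<^sub>R dchi (s x))"
      using that u by (intro ext) (auto simp: indicator_def)
    then show ?thesis
      unfolding set_integrable_def using integrable_mult_indicator[OF _ int, of "{c..d}"] by simp
  qed
  show "g \<in> borel_measurable lborel" by simp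
  have "\<bar>(g x)\<^sup>2\<bar> \<le> ((b - a) / \<tau>)\<^sup>2" for x
    using power_mono[OF g_bound[of x], of 2] by simp
  then have "integrable lborel (\<lambda>x. (g x)\<^sup>2)"
    by (intro integrable_on_interval[where a=a and b=b and B="((b - a) / \<tau>)\<^sup>2"]) (auto simp: g_out)
  from integrable_mult_indicator[OF _ this, of "{a<..<b}"]
  show "set_integrable lborel {a<..<b} (\<lambda>x. (g x)\<^sup>2)" by (simp add: set_integrable_def)
  fix \<phi> assume test: "test_fun a b \<phi>"
  then obtain c d where cd: "a < c" "d < b" "\<And>x. x \<notin> {c..d} \<Longrightarrow> \<phi> x = 0"
    unfolding test_fun_def by blast
  have diff: "((deriv ^^ k) \<phi>) differentiable (at x)" for k x using test by (simp add: test_fun_def)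
  have "(\<phi> has_real_derivative deriv \<phi> x) (at x)" for x
    using diff[of 0 x] by (simp add: DERIV_deriv_iff_real_differentiable)
  moreover have "continuous_on UNIV (deriv \<phi>)"
    using diff[of 1] by (intro differentiable_imp_continuous_on) (auto simp: differentiable_on_def)
  ultimately have "(\<integral>x. dchi (s x) * deriv \<phi> x * indicator {a<..<b} x \<partial>lborel) = - (\<integral>x. g x * \<phi> x \<partial>lborel)"
    by (rule integration_by_parts) (use cd in auto)
  moreover have "(LINT x:{a<..<b}|lborel. dchi (u x) * deriv \<phi> x) = (\<integral>x. dchi (s x) * deriv \<phi> x * indicator {a<..<b} x \<partial>lborel)"
    unfolding set_lebesgue_integral_def using u
    by (intro Bochner_Integration.integral_cong) (auto simp: indicator_def)
  moreover have "(LINT x:{a<..<b}|lborel. g x * \<phi> x) = (\<integral>x. g x * \<phi> x \<partial>lborel)"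
    unfolding set_lebesgue_integral_def using g_out
    by (intro Bochner_Integration.integral_cong) (auto simp: indicator_def)
  ultimately show "(LINT x:{a<..<b}|lborel. dchi (u x) * deriv \<phi> x) = - (LINT x:{a<..<b}|lborel. g x * \<phi> x)" by simp
qed

lemma entropy_dissipation:
  "(\<integral>x. entropy (s x) \<partial>lborel) + \<tau> * (LINT x:{a<..<b}|lborel. (g x)\<^sup>2) \<le> (\<integral>x. entropy (h x) \<partial>lborel)"
proof -
  have "(LINT x:{a<..<b}|lborel. (g x)\<^sup>2) = (\<integral>x. (g x)\<^sup>2 \<partial>lborel)"
    unfolding set_lebesgue_integral_def using g_out
    by (intro Bochner_Integration.integral_cong) (auto simp: indicator_def)
  then show ?thesis using entropy_gap_ge by (simp add: integral_vh_diff)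
qed

end

subsection \<open>The reaction step\<close>

lemma variation_snoc:
  fixes f :: "real \<Rightarrow> real"
  shows "(\<Sum>i<length (xs @ [x, y]) - 1. \<bar>f ((xs @ [x, y]) ! Suc i) - f ((xs @ [x, y]) ! i)\<bar>)
    = (\<Sum>i<length (xs @ [x]) - 1. \<bar>f ((xs @ [x]) ! Suc i) - f ((xs @ [x]) ! i)\<bar>) + \<bar>f y - f x\<bar>"
proof -
  have "(\<Sum>i<length xs. \<bar>f ((xs @ [x, y]) ! Suc i) - f ((xs @ [x, y]) ! i)\<bar>)
    = (\<Sum>i<length xs. \<bar>f ((xs @ [x]) ! Suc i) - f ((xs @ [x]) ! i)\<bar>)"
    by (intro sum.cong) (auto simp: nth_append nth_Cons' less_Suc_eq)
  then show ?thesis by (simp add: nth_append)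
qed

lemma is_BV_measurable:
  assumes "is_BV f a b" "a < b" shows "f \<in> borel_measurable (restrict_space borel {a..b})"
proof -
  define var where "var xs = (\<Sum>i<length xs - 1. \<bar>f (xs ! Suc i) - f (xs ! i)\<bar>)" for xs
  define P where "P = {xs. sorted_wrt (<) xs \<and> set xs \<subseteq> {a<..<b}}"
  have tv: "total_var f a b = (SUP xs\<in>P. ereal (var xs))"
    by (simp add: total_var_def P_def var_def)
  have le: "ereal (var xs) \<le> total_var f a b" if "xs \<in> P" for xs
    unfolding tv using that by (rule SUP_upper)
  have "ereal (var []) \<le> total_var f a b" by (rule le) (simp add: P_def)
  then obtain B where B: "total_var f a b = ereal B"
    using assms(1) by (cases "total_var f a b") (auto simp: is_BV_def var_def)
  define V where "V x = Sup {var (xs @ [x]) | xs. xs @ [x] \<in> P}" for x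
  have bdd: "bdd_above {var (xs @ [x]) | xs. xs @ [x] \<in> P}" for x
    using le B by (intro bdd_aboveI[of _ B]) auto
  have V_step: "V x + \<bar>f y - f x\<bar> \<le> V y" if x: "x \<in> {a<..<b}" and y: "y \<in> {a<..<b}" and "x < y" for x y
  proof -
    have "V x \<le> V y - \<bar>f y - f x\<bar>"
      unfolding V_def[of x]
    proof (rule cSup_least)
      have "[] @ [x] \<in> P" using x by (simp add: P_def)
      then show "{var (xs @ [x]) | xs. xs @ [x] \<in> P} \<noteq> {}" by blast
      fix u assume "u \<in> {var (xs @ [x]) | xs. xs @ [x] \<in> P}"
      then obtain xs where xs: "u = var (xs @ [x])" "xs @ [x] \<in> P" by blast
      then have "(xs @ [x]) @ [y] \<in> P"
        using y \<open>x < y\<close> by (auto simp: P_def sorted_wrt_append)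
      then have "var ((xs @ [x]) @ [y]) \<le> V y"
        unfolding V_def by (intro cSup_upper bdd) blast
      then show "u \<le> V y - \<bar>f y - f x\<bar>"
        using variation_snoc[where xs=xs and x=x and y=y and f=f] xs by (simp add: var_def)
    qed
    then show ?thesis by simp
  qed
  have "mono_on {a<..<b} V" "mono_on {a<..<b} (\<lambda>x. V x - f x)"
    using V_step by (force simp: mono_on_def le_less)+
  then have "(\<lambda>x. V x - (V x - f x)) \<in> borel_measurable (restrict_space borel {a<..<b})"
    by (intro borel_measurable_diff borel_measurable_mono_on_fnc)
  then have [measurable]: "(\<lambda>x. indicator {a<..<b} x *\<^sub>R f x) \<in> borel_measurable borel"
    by (simp add: borel_measurable_restrict_space_iff)
  have "(\<lambda>x. indicator {a..b} x *\<^sub>R f x)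
    = (\<lambda>x. indicator {a<..<b} x *\<^sub>R f x + indicator {a} x * f a + indicator {b} x * f b)"
    using \<open>a < b\<close> by (intro ext) (auto simp: indicator_def)
  also have "\<dots> \<in> borel_measurable borel" by measurable
  finally show ?thesis by (simp add: borel_measurable_restrict_space_iff)
qed

lemma nonincreasing_within:
  fixes f :: "real \<Rightarrow> real"
  assumes "0 \<le> t" "t \<le> \<tau>"
    and "\<And>x. x \<in> {0..\<tau>} \<Longrightarrow> (f has_real_derivative f' x) (at x within {0..\<tau>})"
    and "\<And>x. x \<in> {0..\<tau>} \<Longrightarrow> f' x \<le> 0"
  shows "f t \<le> f 0"
proof (cases "t = 0")
  case False
  then have "0 < t" using assms by simp
  have "(f has_derivative (*) (f' x)) (at x within {0..t})" if "0 \<le> x" "x \<le> t" for x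
    using assms(3)[of x] assms(2) that DERIV_subset[of f "f' x" x "{0..\<tau>}" "{0..t}"]
    by (auto simp: has_field_derivative_def)
  from mvt_simple[OF \<open>0 < t\<close> this] obtain x where "x \<in> {0<..<t}" "f t - f 0 = f' x * (t - 0)" by auto
  then show ?thesis using assms(4)[of x] assms(1,2) mult_nonpos_nonneg[of "f' x" t] by auto
qed simp

lemma reaction_sol_growth:
  assumes sol: "reaction_sol Sig R \<tau> s0 q0 s q" and t: "0 \<le> t" "t \<le> \<tau>"
    and bnd: "\<And>u v. 0 \<le> u \<Longrightarrow> 0 \<le> v \<Longrightarrow> v \<le> 1 \<Longrightarrow> \<bar>Sig u v\<bar> \<le> B * u"
  shows "s t \<le> exp (B * t) * s0" "s0 \<le> exp (B * t) * s t"
proof -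
  have d: "(s has_real_derivative Sig (s x) (q x)) (at x within {0..\<tau>})"
    and r: "0 \<le> s x" "0 \<le> q x" "q x \<le> 1" if "x \<in> {0..\<tau>}" for x
    using sol that by (auto simp: reaction_sol_def)
  have s0: "s 0 = s0" using sol by (simp add: reaction_sol_def)
  have "s t * exp (- B * t) \<le> s 0 * exp (- B * 0)"
  proof (rule nonincreasing_within[OF t])
    fix x assume x: "x \<in> {0..\<tau>}"
    show "((\<lambda>t. s t * exp (- B * t)) has_real_derivative (Sig (s x) (q x) - B * s x) * exp (- B * x)) (at x within {0..\<tau>})"
      by (rule derivative_eq_intros d[OF x] refl)+ (simp add: algebra_simps)
    show "(Sig (s x) (q x) - B * s x) * exp (- B * x) \<le> 0"
      using bnd[OF r[OF x]] by (intro mult_nonpos_nonneg) auto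
  qed
  then show "s t \<le> exp (B * t) * s0" by (simp add: s0 exp_minus field_simps)
  have "- (s t * exp (B * t)) \<le> - (s 0 * exp (B * 0))"
  proof (rule nonincreasing_within[OF t])
    fix x assume x: "x \<in> {0..\<tau>}"
    show "((\<lambda>t. - (s t * exp (B * t))) has_real_derivative - (Sig (s x) (q x) + B * s x) * exp (B * x)) (at x within {0..\<tau>})"
      by (rule derivative_eq_intros d[OF x] refl)+ (simp add: algebra_simps)
    show "- (Sig (s x) (q x) + B * s x) * exp (B * x) \<le> 0"
      using bnd[OF r[OF x]] by (intro mult_nonpos_nonneg) auto
  qed
  then show "s0 \<le> exp (B * t) * s t" by (simp add: s0 mult.commute)
qed

definition bdd_lip_on :: "(real \<times> real) set \<Rightarrow> (real \<Rightarrow> real \<Rightarrow> real) \<Rightarrow> bool" where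
  "bdd_lip_on X f \<longleftrightarrow> (\<exists>L\<ge>0. \<forall>p\<in>X. \<bar>f (fst p) (snd p)\<bar> \<le> L \<and>
     (\<forall>p'\<in>X. \<bar>f (fst p) (snd p) - f (fst p') (snd p')\<bar> \<le> L * dist p p'))"

lemma bdd_lip_on_const: "bdd_lip_on X (\<lambda>_ _. c)"
  unfolding bdd_lip_on_def by (intro exI[of _ "\<bar>c\<bar>"]) auto

lemma bdd_lip_on_fst: assumes "X \<subseteq> {0..R} \<times> {0..1}" shows "bdd_lip_on X (\<lambda>s q. s)"
  unfolding bdd_lip_on_def
proof (intro exI[of _ "1 + \<bar>R\<bar>"] conjI ballI)
  fix p p' assume "p \<in> X" "p' \<in> X"
  have "\<bar>fst p - fst p'\<bar> \<le> 1 * dist p p'" using dist_fst_le[of p p'] by (simp add: dist_real_def)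
  also have "\<dots> \<le> (1 + \<bar>R\<bar>) * dist p p'" by (intro mult_right_mono) auto
  finally show "\<bar>fst p - fst p'\<bar> \<le> (1 + \<bar>R\<bar>) * dist p p'" .
qed (use assms in auto)

lemma bdd_lip_on_snd: assumes "X \<subseteq> {0..R} \<times> {0..1}" shows "bdd_lip_on X (\<lambda>s q. q)"
  unfolding bdd_lip_on_def
proof (intro exI[of _ 1] conjI ballI)
  fix p p' assume "p \<in> X" "p' \<in> X"
  show "\<bar>snd p - snd p'\<bar> \<le> 1 * dist p p'" using dist_snd_le[of p p'] by (simp add: dist_real_def)
qed (use assms in auto)

lemma bdd_lip_on_add: assumes "bdd_lip_on X f" "bdd_lip_on X g" shows "bdd_lip_on X (\<lambda>s q. f s q + g s q)"
proof -
  obtain L where L: "0 \<le> L" "\<And>p. p \<in> X \<Longrightarrow> \<bar>f (fst p) (snd p)\<bar> \<le> L"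
    "\<And>p p'. p \<in> X \<Longrightarrow> p' \<in> X \<Longrightarrow> \<bar>f (fst p) (snd p) - f (fst p') (snd p')\<bar> \<le> L * dist p p'"
    using assms(1) unfolding bdd_lip_on_def by blast
  obtain K where K: "0 \<le> K" "\<And>p. p \<in> X \<Longrightarrow> \<bar>g (fst p) (snd p)\<bar> \<le> K"
    "\<And>p p'. p \<in> X \<Longrightarrow> p' \<in> X \<Longrightarrow> \<bar>g (fst p) (snd p) - g (fst p') (snd p')\<bar> \<le> K * dist p p'"
    using assms(2) unfolding bdd_lip_on_def by blast
  show ?thesis
    unfolding bdd_lip_on_def
  proof (intro exI[of _ "L + K"] conjI ballI)
    fix p assume p: "p \<in> X"
    show "\<bar>f (fst p) (snd p) + g (fst p) (snd p)\<bar> \<le> L + K" using L(2)[OF p] K(2)[OF p] by linarith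
    fix p' assume p': "p' \<in> X"
    show "\<bar>f (fst p) (snd p) + g (fst p) (snd p) - (f (fst p') (snd p') + g (fst p') (snd p'))\<bar> \<le> (L + K) * dist p p'"
      using L(3)[OF p p'] K(3)[OF p p'] unfolding distrib_right by linarith
  qed (use L K in simp)
qed

lemma bdd_lip_on_mult: assumes "bdd_lip_on X f" "bdd_lip_on X g" shows "bdd_lip_on X (\<lambda>s q. f s q * g s q)"
proof -
  obtain L where L: "0 \<le> L" "\<And>p. p \<in> X \<Longrightarrow> \<bar>f (fst p) (snd p)\<bar> \<le> L"
    "\<And>p p'. p \<in> X \<Longrightarrow> p' \<in> X \<Longrightarrow> \<bar>f (fst p) (snd p) - f (fst p') (snd p')\<bar> \<le> L * dist p p'"
    using assms(1) unfolding bdd_lip_on_def by blast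
  obtain K where K: "0 \<le> K" "\<And>p. p \<in> X \<Longrightarrow> \<bar>g (fst p) (snd p)\<bar> \<le> K"
    "\<And>p p'. p \<in> X \<Longrightarrow> p' \<in> X \<Longrightarrow> \<bar>g (fst p) (snd p) - g (fst p') (snd p')\<bar> \<le> K * dist p p'"
    using assms(2) unfolding bdd_lip_on_def by blast
  show ?thesis
    unfolding bdd_lip_on_def
  proof (intro exI[of _ "2 * (L * K)"] conjI ballI)
    fix p assume p: "p \<in> X"
    have "\<bar>f (fst p) (snd p) * g (fst p) (snd p)\<bar> \<le> L * K"
      unfolding abs_mult using L K p by (intro mult_mono) auto
    moreover have "0 \<le> L * K" using L K by simp
    ultimately show "\<bar>f (fst p) (snd p) * g (fst p) (snd p)\<bar> \<le> 2 * (L * K)" by linarith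
    fix p' assume p': "p' \<in> X"
    let ?f = "f (fst p) (snd p)" and ?g = "g (fst p) (snd p)" and ?f' = "f (fst p') (snd p')" and ?g' = "g (fst p') (snd p')"
    have "\<bar>(?f - ?f') * ?g\<bar> \<le> (L * dist p p') * K"
      unfolding abs_mult using L K p p' by (intro mult_mono) auto
    moreover have "\<bar>?f' * (?g - ?g')\<bar> \<le> L * (K * dist p p')"
      unfolding abs_mult using L K p p' by (intro mult_mono) auto
    moreover have "?f * ?g - ?f' * ?g' = (?f - ?f') * ?g + ?f' * (?g - ?g')" by (simp add: algebra_simps)
    ultimately show "\<bar>?f * ?g - ?f' * ?g'\<bar> \<le> 2 * (L * K) * dist p p'"
      by (simp add: algebra_simps)
  qed (use L K in simp)
qed

lemma bdd_lip_on_diff: assumes "bdd_lip_on X f" "bdd_lip_on X g" shows "bdd_lip_on X (\<lambda>s q. f s q - g s q)"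
  using bdd_lip_on_add[OF assms(1) bdd_lip_on_mult[OF bdd_lip_on_const[of X "-1"] assms(2)]] by simp

lemma bdd_lip_on_tilde:
  assumes F: "bdd_lip F" and X: "X \<subseteq> {0..R} \<times> {0..1}" shows "bdd_lip_on X (tilde F)"
proof -
  obtain B where B: "\<And>u v. 0 \<le> u \<Longrightarrow> 0 \<le> v \<Longrightarrow> \<bar>F u v\<bar> \<le> B"
    using F unfolding bdd_lip_def bounded_iff by fastforce
  obtain L where L: "lipschitz_on L ({0..} \<times> {0..}) (\<lambda>(u,v). F u v)"
    using F unfolding bdd_lip_def by blast
  have "bdd_lip_on X (\<lambda>s q. q * s)" by (intro bdd_lip_on_mult bdd_lip_on_fst[OF X] bdd_lip_on_snd[OF X])
  then obtain K1 where K1: "0 \<le> K1"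
    "\<And>p p'. p \<in> X \<Longrightarrow> p' \<in> X \<Longrightarrow> \<bar>snd p * fst p - snd p' * fst p'\<bar> \<le> K1 * dist p p'"
    unfolding bdd_lip_on_def by blast
  have "bdd_lip_on X (\<lambda>s q. (1 - q) * s)" by (intro bdd_lip_on_mult bdd_lip_on_diff bdd_lip_on_const bdd_lip_on_fst[OF X] bdd_lip_on_snd[OF X])
  then obtain K2 where K2: "0 \<le> K2"
    "\<And>p p'. p \<in> X \<Longrightarrow> p' \<in> X \<Longrightarrow> \<bar>(1 - snd p) * fst p - (1 - snd p') * fst p'\<bar> \<le> K2 * dist p p'"
    unfolding bdd_lip_on_def by blast
  have L0: "0 \<le> L" using lipschitz_on_nonneg[OF L] .
  show ?thesis
    unfolding bdd_lip_on_def
  proof (intro exI[of _ "max B (L * (K1 + K2))"] conjI ballI)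
    show "0 \<le> max B (L * (K1 + K2))" using L0 K1 K2 by (simp add: le_max_iff_disj)
    fix p assume p: "p \<in> X"
    then have p0: "0 \<le> snd p * fst p" "0 \<le> (1 - snd p) * fst p" using X by (auto intro!: mult_nonneg_nonneg)
    then show "\<bar>tilde F (fst p) (snd p)\<bar> \<le> max B (L * (K1 + K2))"
      using B[of "snd p * fst p" "(1 - snd p) * fst p"] by (simp add: tilde_def)
    fix p' assume p': "p' \<in> X"
    then have p0': "0 \<le> snd p' * fst p'" "0 \<le> (1 - snd p') * fst p'" using X by (auto intro!: mult_nonneg_nonneg)
    let ?u = "(snd p * fst p, (1 - snd p) * fst p)" and ?u' = "(snd p' * fst p', (1 - snd p') * fst p')"
    have "\<bar>tilde F (fst p) (snd p) - tilde F (fst p') (snd p')\<bar> \<le> L * dist ?u ?u'"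
      using lipschitz_onD[OF L, of ?u ?u'] p0 p0' by (simp add: tilde_def dist_real_def)
    also have "\<dots> \<le> L * (K1 * dist p p' + K2 * dist p p')"
    proof (rule mult_left_mono[OF _ L0])
      have "dist ?u ?u' \<le> \<bar>snd p * fst p - snd p' * fst p'\<bar> + \<bar>(1 - snd p) * fst p - (1 - snd p') * fst p'\<bar>"
        unfolding dist_Pair_Pair dist_real_def using sqrt_sum_squares_le_sum_abs by simp
      then show "dist ?u ?u' \<le> K1 * dist p p' + K2 * dist p p'"
        using K1(2)[OF p p'] K2(2)[OF p p'] by linarith
    qed
    also have "\<dots> = (L * (K1 + K2)) * dist p p'" by (simp add: algebra_simps)
    also have "\<dots> \<le> max B (L * (K1 + K2)) * dist p p'" by (intro mult_right_mono) auto
    finally show "\<bar>tilde F (fst p) (snd p) - tilde F (fst p') (snd p')\<bar> \<le> max B (L * (K1 + K2)) * dist p p'" .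
  qed
qed

lemma bdd_lip_on_SigmaF_RF:
  assumes F: "bdd_lip F1" "bdd_lip F2" "bdd_lip G1" "bdd_lip G2" and X: "X \<subseteq> {0..R} \<times> {0..1}"
  shows "bdd_lip_on X (SigmaF F1 F2 G1 G2)" "bdd_lip_on X (RF F1 F2 G1 G2)"
  unfolding SigmaF_def[abs_def] RF_def[abs_def] power2_eq_square
  by (intro bdd_lip_on_mult bdd_lip_on_add bdd_lip_on_diff bdd_lip_on_const bdd_lip_on_fst[OF X] bdd_lip_on_snd[OF X] bdd_lip_on_tilde[OF _ X] F)+

lemma SigmaF_bound:
  assumes F: "bdd_lip F1" "bdd_lip F2" "bdd_lip G1" "bdd_lip G2"
  obtains B where "0 < B" "\<And>u v. 0 \<le> u \<Longrightarrow> 0 \<le> v \<Longrightarrow> v \<le> 1 \<Longrightarrow> \<bar>SigmaF F1 F2 G1 G2 u v\<bar> \<le> B * u"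
proof -
  have ex: "\<exists>B. \<forall>u v. 0 \<le> u \<longrightarrow> 0 \<le> v \<longrightarrow> \<bar>F u v\<bar> \<le> B" if "bdd_lip F" for F
    using that unfolding bdd_lip_def bounded_iff by fastforce
  obtain B1 where B1: "\<And>u v. 0 \<le> u \<Longrightarrow> 0 \<le> v \<Longrightarrow> \<bar>F1 u v\<bar> \<le> B1" using ex[OF F(1)] by blast
  obtain B2 where B2: "\<And>u v. 0 \<le> u \<Longrightarrow> 0 \<le> v \<Longrightarrow> \<bar>F2 u v\<bar> \<le> B2" using ex[OF F(2)] by blast
  obtain B3 where B3: "\<And>u v. 0 \<le> u \<Longrightarrow> 0 \<le> v \<Longrightarrow> \<bar>G1 u v\<bar> \<le> B3" using ex[OF F(3)] by blast
  obtain B4 where B4: "\<And>u v. 0 \<le> u \<Longrightarrow> 0 \<le> v \<Longrightarrow> \<bar>G2 u v\<bar> \<le> B4" using ex[OF F(4)] by blast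
  have pos: "0 \<le> B1" "0 \<le> B2" "0 \<le> B3" "0 \<le> B4" using B1[of 0 0] B2[of 0 0] B3[of 0 0] B4[of 0 0] by auto
  define B where "B = B1 + B2 + B3 + B4 + 1"
  show ?thesis
  proof (rule that[of B])
    show "0 < B" using pos by (simp add: B_def)
    fix u v :: real assume u: "0 \<le> u" and v: "0 \<le> v" "v \<le> 1"
    have nn: "0 \<le> v * u" "0 \<le> (1 - v) * u" using u v by auto
    have 1: "\<bar>tilde F1 u v + tilde G2 u v\<bar> \<le> B" "\<bar>tilde G1 u v + tilde F2 u v\<bar> \<le> B"
      using B1[OF nn] B2[OF nn] B3[OF nn] B4[OF nn] pos by (auto simp: tilde_def B_def)
    have "\<bar>v * (tilde F1 u v + tilde G2 u v)\<bar> \<le> v * B" "\<bar>(1 - v) * (tilde G1 u v + tilde F2 u v)\<bar> \<le> (1 - v) * B"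
      unfolding abs_mult using v 1 by (auto intro!: mult_mono)
    then have "\<bar>v * (tilde F1 u v + tilde G2 u v) + (1 - v) * (tilde G1 u v + tilde F2 u v)\<bar> \<le> B"
      by (simp add: algebra_simps)
    then have "u * \<bar>v * (tilde F1 u v + tilde G2 u v) + (1 - v) * (tilde G1 u v + tilde F2 u v)\<bar> \<le> u * B"
      using u by (rule mult_left_mono)
    then show "\<bar>SigmaF F1 F2 G1 G2 u v\<bar> \<le> B * u"
      using u by (simp add: SigmaF_def abs_mult mult.commute)
  qed
qed

lemma reaction_sol_stability:
  assumes sol: "reaction_sol Sig R \<tau> s0 q0 s q" "reaction_sol Sig R \<tau> s0' q0' s' q'" and tau: "0 \<le> \<tau>"
    and L: "0 \<le> L"
    "\<And>t. t \<in> {0..\<tau>} \<Longrightarrow> \<bar>Sig (s t) (q t) - Sig (s' t) (q' t)\<bar> \<le> L * dist (s t, q t) (s' t, q' t)"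
    "\<And>t. t \<in> {0..\<tau>} \<Longrightarrow> \<bar>R (s t) (q t) - R (s' t) (q' t)\<bar> \<le> L * dist (s t, q t) (s' t, q' t)"
  shows "dist (s \<tau>, q \<tau>) (s' \<tau>, q' \<tau>) \<le> exp (2 * L * \<tau>) * dist (s0, q0) (s0', q0')"
proof -
  define E where "E t = (s t - s' t)\<^sup>2 + (q t - q' t)\<^sup>2" for t
  have dE: "dist (s t, q t) (s' t, q' t) = sqrt (E t)" for t
    by (simp add: E_def dist_Pair_Pair dist_real_def)
  have E0: "0 \<le> E t" for t by (simp add: E_def)
  define D where "D t = 2 * (s t - s' t) * (Sig (s t) (q t) - Sig (s' t) (q' t))
      + 2 * (q t - q' t) * (R (s t) (q t) - R (s' t) (q' t))" for t
  have d: "(s has_real_derivative Sig (s x) (q x)) (at x within {0..\<tau>})"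
    "(q has_real_derivative R (s x) (q x)) (at x within {0..\<tau>})"
    "(s' has_real_derivative Sig (s' x) (q' x)) (at x within {0..\<tau>})"
    "(q' has_real_derivative R (s' x) (q' x)) (at x within {0..\<tau>})" if "x \<in> {0..\<tau>}" for x
    using sol that by (auto simp: reaction_sol_def)
  have "E \<tau> * exp (- (4 * L) * \<tau>) \<le> E 0 * exp (- (4 * L) * 0)"
  proof (rule nonincreasing_within[where f="\<lambda>t. E t * exp (- (4 * L) * t)"])
    fix x assume x: "x \<in> {0..\<tau>}"
    show "((\<lambda>t. E t * exp (- (4 * L) * t)) has_real_derivative (D x - 4 * L * E x) * exp (- (4 * L) * x)) (at x within {0..\<tau>})"
      unfolding E_def
      by (rule derivative_eq_intros d[OF x] refl)+ (simp add: D_def algebra_simps)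
    have "\<bar>s x - s' x\<bar> \<le> sqrt (E x)" "\<bar>q x - q' x\<bar> \<le> sqrt (E x)"
      by (auto intro!: real_le_rsqrt simp: E_def)
    then have "\<bar>(s x - s' x) * (Sig (s x) (q x) - Sig (s' x) (q' x))\<bar> \<le> sqrt (E x) * (L * sqrt (E x))"
      "\<bar>(q x - q' x) * (R (s x) (q x) - R (s' x) (q' x))\<bar> \<le> sqrt (E x) * (L * sqrt (E x))"
      unfolding abs_mult using L(2,3)[OF x] E0[of x] by (auto intro!: mult_mono simp: dE)
    moreover have "sqrt (E x) * (L * sqrt (E x)) = L * E x" using E0[of x] by simp
    moreover have "D x = 2 * ((s x - s' x) * (Sig (s x) (q x) - Sig (s' x) (q' x)))
        + 2 * ((q x - q' x) * (R (s x) (q x) - R (s' x) (q' x)))"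
      unfolding D_def by (simp only: mult.assoc)
    moreover have "4 * L * E x = 4 * (L * E x)" by simp
    ultimately have "D x \<le> 4 * L * E x" by linarith
    then show "(D x - 4 * L * E x) * exp (- (4 * L) * x) \<le> 0" by (intro mult_nonpos_nonneg) auto
  qed (use tau in auto)
  then have "E \<tau> \<le> exp (4 * L * \<tau>) * E 0" by (simp add: exp_minus field_simps)
  also have "exp (4 * L * \<tau>) = (exp (2 * L * \<tau>))\<^sup>2" by (simp add: exp_double[symmetric] flip: exp_of_nat_mult)
  finally have "sqrt (E \<tau>) \<le> sqrt ((exp (2 * L * \<tau>))\<^sup>2 * E 0)" by (rule real_sqrt_le_mono)
  also have "\<dots> = exp (2 * L * \<tau>) * sqrt (E 0)" by (simp add: real_sqrt_mult)
  finally show ?thesis using dE[of \<tau>] dE[of 0] sol by (simp add: reaction_sol_def)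
qed

lemma reaction_step_measurable:
  fixes F1 F2 G1 G2 :: "real \<Rightarrow> real \<Rightarrow> real"
  defines "Sg \<equiv> SigmaF F1 F2 G1 G2" and "Rr \<equiv> RF F1 F2 G1 G2"
  assumes F: "bdd_lip F1" "bdd_lip F2" "bdd_lip G1" "bdd_lip G2" and tau: "0 \<le> \<tau>"
    and meas: "u \<in> borel_measurable (restrict_space borel X)" "w \<in> borel_measurable (restrict_space borel X)"
    and step: "\<And>x. x \<in> X \<Longrightarrow> \<exists>s q. reaction_sol Sg Rr \<tau> (u x) (w x) s q \<and> u' x = s \<tau> \<and> w' x = q \<tau>"
  shows "u' \<in> borel_measurable (restrict_space borel X)" "w' \<in> borel_measurable (restrict_space borel X)"
proof -
  obtain B where B: "0 < B" "\<And>u v. 0 \<le> u \<Longrightarrow> 0 \<le> v \<Longrightarrow> v \<le> 1 \<Longrightarrow> \<bar>Sg u v\<bar> \<le> B * u"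
    using SigmaF_bound[OF F] unfolding Sg_def by blast
  define ends where "ends p e \<longleftrightarrow> (\<exists>s q. reaction_sol Sg Rr \<tau> (fst p) (snd p) s q \<and> e = (s \<tau>, q \<tau>))" for p e
  have stab: "\<exists>K\<ge>0. \<forall>p p' e e'. fst p \<le> k \<longrightarrow> fst p' \<le> k \<longrightarrow> ends p e \<longrightarrow> ends p' e' \<longrightarrow> dist e e' \<le> K * dist p p'"
    if "0 \<le> k" for k
  proof -
    define R where "R = exp (B * \<tau>) * k"
    have "bdd_lip_on ({0..R} \<times> {0..1}) Sg" "bdd_lip_on ({0..R} \<times> {0..1}) Rr"
      unfolding Sg_def Rr_def by (rule bdd_lip_on_SigmaF_RF[OF F order_refl])+
    then obtain L1 L2 where L1: "0 \<le> L1" "\<And>p p'. p \<in> {0..R} \<times> {0..1} \<Longrightarrow> p' \<in> {0..R} \<times> {0..1} \<Longrightarrow>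
        \<bar>Sg (fst p) (snd p) - Sg (fst p') (snd p')\<bar> \<le> L1 * dist p p'"
      and L2: "0 \<le> L2" "\<And>p p'. p \<in> {0..R} \<times> {0..1} \<Longrightarrow> p' \<in> {0..R} \<times> {0..1} \<Longrightarrow>
        \<bar>Rr (fst p) (snd p) - Rr (fst p') (snd p')\<bar> \<le> L2 * dist p p'"
      unfolding bdd_lip_on_def by metis
    define L where "L = max L1 L2"
    have box: "(s t, q t) \<in> {0..R} \<times> {0..1}"
      if "reaction_sol Sg Rr \<tau> s0 q0 s q" "s0 \<le> k" "t \<in> {0..\<tau>}" for s0 q0 s q t
    proof -
      have "0 \<le> s t" "0 \<le> q t" "q t \<le> 1" "s 0 = s0" "0 \<le> s 0"
        using that tau by (auto simp: reaction_sol_def)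
      moreover have "s t \<le> exp (B * t) * s0"
        by (rule reaction_sol_growth(1)[OF that(1)]) (use that B in auto)
      moreover have "exp (B * t) * s0 \<le> R"
        unfolding R_def using that B \<open>s 0 = s0\<close> \<open>0 \<le> s 0\<close> by (intro mult_mono) auto
      ultimately show ?thesis by auto
    qed
    show ?thesis
    proof (intro exI[of _ "exp (2 * L * \<tau>)"] conjI allI impI)
      fix p p' e e' assume k: "fst p \<le> k" "fst p' \<le> k" and "ends p e" "ends p' e'"
      then obtain s q s' q' where sol: "reaction_sol Sg Rr \<tau> (fst p) (snd p) s q" "e = (s \<tau>, q \<tau>)"
        "reaction_sol Sg Rr \<tau> (fst p') (snd p') s' q'" "e' = (s' \<tau>, q' \<tau>)"
        unfolding ends_def by blast
      have le: "L1 * d \<le> L * d" "L2 * d \<le> L * d" if "0 \<le> d" for d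
        using that by (auto simp: L_def intro!: mult_right_mono)
      have "dist (s \<tau>, q \<tau>) (s' \<tau>, q' \<tau>) \<le> exp (2 * L * \<tau>) * dist (fst p, snd p) (fst p', snd p')"
      proof (rule reaction_sol_stability[OF sol(1,3) tau])
        show "0 \<le> L" using L1(1) by (simp add: L_def)
        fix t assume t: "t \<in> {0..\<tau>}"
        note b = box[OF sol(1) k(1) t] box[OF sol(3) k(2) t]
        show "\<bar>Sg (s t) (q t) - Sg (s' t) (q' t)\<bar> \<le> L * dist (s t, q t) (s' t, q' t)"
          using L1(2)[OF b] le(1)[of "dist (s t, q t) (s' t, q' t)"] by simp
        show "\<bar>Rr (s t) (q t) - Rr (s' t) (q' t)\<bar> \<le> L * dist (s t, q t) (s' t, q' t)"
          using L2(2)[OF b] le(2)[of "dist (s t, q t) (s' t, q' t)"] by simp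
      qed
      then show "dist e e' \<le> exp (2 * L * \<tau>) * dist p p'" using sol by simp
    qed simp
  qed
  define D where "D = {p. \<exists>e. ends p e}"
  define \<Phi> where "\<Phi> p = (SOME e. ends p e)" for p
  have \<Phi>: "ends p (\<Phi> p)" if "p \<in> D" for p
    using that unfolding \<Phi>_def D_def by (auto intro: someI_ex)
  have unique: "e = \<Phi> p" if "ends p e" for p e
  proof -
    have "p \<in> D" using that unfolding D_def by blast
    obtain K where "\<forall>p' e e'. ends p e \<longrightarrow> ends p' e' \<longrightarrow> fst p' \<le> \<bar>fst p\<bar> \<longrightarrow> dist e e' \<le> K * dist p p'"
      using stab[of "\<bar>fst p\<bar>"] by (metis abs_ge_self abs_ge_zero)
    then have "dist e (\<Phi> p) \<le> K * dist p p" using that \<Phi>[OF \<open>p \<in> D\<close>] abs_ge_self[of "fst p"] by blast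
    then show ?thesis by simp
  qed
  have cont: "continuous_on D \<Phi>"
    unfolding continuous_on_iff
  proof (intro ballI allI impI)
    fix p and \<epsilon> :: real assume p: "p \<in> D" and "0 < \<epsilon>"
    obtain K where K: "0 \<le> K" "\<And>p' e e'. fst p' \<le> \<bar>fst p\<bar> + 1 \<Longrightarrow> ends p e \<Longrightarrow> ends p' e' \<Longrightarrow> dist e e' \<le> K * dist p p'"
    proof -
      obtain K where "K \<ge> 0" "\<forall>q p' e e'. fst q \<le> \<bar>fst p\<bar> + 1 \<longrightarrow> fst p' \<le> \<bar>fst p\<bar> + 1 \<longrightarrow> ends q e \<longrightarrow> ends p' e' \<longrightarrow> dist e e' \<le> K * dist q p'"
        using stab[of "\<bar>fst p\<bar> + 1"] by auto
      moreover have "fst p \<le> \<bar>fst p\<bar> + 1" by linarith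
      ultimately show ?thesis using that by blast
    qed
    define \<delta> where "\<delta> = min 1 (\<epsilon> / (K + 1))"
    have "0 < \<delta>" using K \<open>0 < \<epsilon>\<close> by (simp add: \<delta>_def)
    moreover have "dist (\<Phi> p') (\<Phi> p) < \<epsilon>" if p': "p' \<in> D" and "dist p' p < \<delta>" for p'
    proof -
      have d1: "dist p p' < 1" and d2: "dist p p' < \<epsilon> / (K + 1)"
        using that(2) by (auto simp: \<delta>_def dist_commute)
      have "\<bar>fst p - fst p'\<bar> < 1" using dist_fst_le[of p p'] d1 by (simp add: dist_real_def)
      then have "fst p' \<le> \<bar>fst p\<bar> + 1" by linarith
      from K(2)[OF this \<Phi>[OF p] \<Phi>[OF p']] have "dist (\<Phi> p) (\<Phi> p') \<le> K * dist p p'" .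
      also have "\<dots> \<le> (K + 1) * dist p p'" by (intro mult_right_mono) auto
      also have "\<dots> < \<epsilon>" using d2 K(1) by (simp add: field_simps)
      finally show ?thesis by (simp add: dist_commute)
    qed
    ultimately show "\<exists>d>0. \<forall>x'\<in>D. dist x' p < d \<longrightarrow> dist (\<Phi> x') (\<Phi> p) < \<epsilon>" by blast
  qed
  have eq: "(u' x, w' x) = \<Phi> (u x, w x) \<and> (u x, w x) \<in> D" if "x \<in> X" for x
  proof -
    have "ends (u x, w x) (u' x, w' x)" using step[OF that] by (auto simp: ends_def)
    then show ?thesis using unique by (auto simp: D_def)
  qed
  have "(\<lambda>x. (u x, w x)) \<in> restrict_space borel X \<rightarrow>\<^sub>M borel"
    using meas by (simp add: borel_prod[symmetric])
  then have "(\<lambda>x. (u x, w x)) \<in> restrict_space borel X \<rightarrow>\<^sub>M restrict_space borel D"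
    using eq by (intro measurable_restrict_space2) (auto simp: space_restrict_space)
  then have m: "(\<lambda>x. \<Phi> (u x, w x)) \<in> restrict_space borel X \<rightarrow>\<^sub>M borel"
    by (rule measurable_compose) (rule borel_measurable_continuous_on_restrict[OF cont])
  have "(\<lambda>x. fst (\<Phi> (u x, w x))) \<in> borel_measurable (restrict_space borel X)"
    "(\<lambda>x. snd (\<Phi> (u x, w x))) \<in> borel_measurable (restrict_space borel X)"
    using measurable_compose[OF m[unfolded borel_prod[symmetric]] measurable_fst]
      measurable_compose[OF m[unfolded borel_prod[symmetric]] measurable_snd] by auto
  moreover have "u' x = fst (\<Phi> (u x, w x))" "w' x = snd (\<Phi> (u x, w x))" if "x \<in> space (restrict_space borel X)" for x
    using eq[of x] that by (auto simp: space_restrict_space prod_eq_iff)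
  ultimately show "u' \<in> borel_measurable (restrict_space borel X)" "w' \<in> borel_measurable (restrict_space borel X)"
    by (auto cong: measurable_cong)
qed

subsection \<open>From the splitting scheme to the one-species step\<close>

lemma dens_eq_density: "dens a b f = density lborel (\<lambda>x. ennreal (if x \<in> {a<..<b} then f x else 0))"
  unfolding dens_def by (rule arg_cong[where f="density lborel"]) (auto simp: indicator_def)

lemma dens_cong: "(\<And>x. x \<in> {a<..<b} \<Longrightarrow> f x = f' x) \<Longrightarrow> dens a b f = dens a b f'"
  unfolding dens_eq_density by (rule arg_cong[where f="density lborel"]) auto

lemma dens_eq_density_of_support: "(\<And>x. x \<notin> {a<..<b} \<Longrightarrow> f x = 0) \<Longrightarrow> dens a b f = density lborel f"
  unfolding dens_eq_density by (rule arg_cong[where f="density lborel"]) auto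

lemma Energy_cong:
  "(\<And>x. x \<in> {a<..<b} \<Longrightarrow> \<rho> x + \<eta> x = t x) \<Longrightarrow> (\<And>x. x \<notin> {a<..<b} \<Longrightarrow> t x = 0) \<Longrightarrow>
    Energy chi a b \<rho> \<eta> = enn2ereal (total_energy chi t) + ereal (chi 0 * (b - a))"
  unfolding Energy_def
  by (intro arg_cong2[where f="(+)"] arg_cong[where f=enn2ereal] nn_integral_cong) (auto simp: indicator_def)

lemma enn2ereal_add_le_cancel:
  assumes "enn2ereal A + (enn2ereal E + ereal c) \<le> enn2ereal A' + (enn2ereal E' + ereal c)"
  shows "A + E \<le> A' + E'"
proof -
  have "enn2ereal (A + E) + ereal c \<le> enn2ereal (A' + E') + ereal c"
    using assms by (simp add: plus_ennreal.rep_eq add.assoc)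
  then have "enn2ereal (A + E) \<le> enn2ereal (A' + E')"
    by (metis abs_ereal.simps(1) ereal_add_le_add_iff2 ereal_infty_less(1) PInfty_neq_ereal(1) MInfty_neq_ereal(1))
  then show ?thesis by (simp add: less_eq_ennreal.rep_eq)
qed

text \<open>Adding up the two couplings bounds the two transport costs below by the cost of the total
  density, and splitting a coupling according to the ratio at its target point attains this bound.
  So the total density minimises the one-species functional.\<close>

lemma (in transport) one_species_minimal:
  fixes chi q p1 p2 t :: "real \<Rightarrow> real" and \<tau> :: real
  defines "qh \<equiv> \<lambda>x. q x * h x" and "qh' \<equiv> \<lambda>x. (1 - q x) * h x"
  assumes [measurable]: "q \<in> borel_measurable borel" "p1 \<in> borel_measurable borel" "p2 \<in> borel_measurable borel"
    and q: "\<And>x. 0 \<le> q x" "\<And>x. q x \<le> 1"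
    and p: "\<And>x. 0 \<le> p1 x" "\<And>x. 0 \<le> p2 x" "\<And>x. p1 x + p2 x = s x"
    and min: "\<And>\<rho> \<eta>. admissible a b (emeasure (dens a b qh) UNIV) \<rho> \<Longrightarrow>
        admissible a b (emeasure (dens a b qh') UNIV) \<eta> \<Longrightarrow>
        JKO chi a b \<tau> qh qh' p1 p2 \<le> JKO chi a b \<tau> qh qh' \<rho> \<eta>"
    and [measurable]: "t \<in> borel_measurable borel" and t: "\<And>x. 0 \<le> t x" "\<And>x. x \<notin> {a<..<b} \<Longrightarrow> t x = 0"
    and \<Gamma>: "\<Gamma> \<in> couplings (density lborel t) (density lborel h)"
  shows "cost / ennreal (2 * \<tau>)
        + total_energy chi s
      \<le> plan_cost \<Gamma> / ennreal (2 * \<tau>)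
        + total_energy chi t"
proof -
  obtain u1 u2 where [measurable]: "u1 \<in> borel_measurable borel" "u2 \<in> borel_measurable borel"
    and u: "\<And>x. 0 \<le> u1 x" "\<And>x. 0 \<le> u2 x" "\<And>x. u1 x + u2 x = t x"
    and mass: "emeasure (density lborel u1) UNIV = emeasure (density lborel qh) UNIV"
      "emeasure (density lborel u2) UNIV = emeasure (density lborel qh') UNIV"
    and W: "W2sq (density lborel u1) (density lborel qh) + W2sq (density lborel u2) (density lborel qh')
      \<le> plan_cost \<Gamma>"
    unfolding qh_def qh'_def by (rule coupling_split[OF \<Gamma>, of q]) (use q t h_nonneg in auto)
  have out: "p1 x = 0" "p2 x = 0" "u1 x = 0" "u2 x = 0" "qh x = 0" "qh' x = 0" if "x \<notin> {a<..<b}" for x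
    using p(1,2)[of x] p(3)[of x] u(1,2)[of x] u(3)[of x] t(2)[OF that] s_out[OF that] h_out[OF that]
    by (auto simp: qh_def qh'_def)
  have d: "dens a b p1 = density lborel p1" "dens a b p2 = density lborel p2"
    "dens a b u1 = density lborel u1" "dens a b u2 = density lborel u2"
    "dens a b qh = density lborel qh" "dens a b qh' = density lborel qh'"
    using out by (auto intro!: dens_eq_density_of_support simp del: greaterThanLessThan_iff)
  let ?c = "ereal (chi 0 * (b - a))"
  let ?W = "W2sq (density lborel p1) (density lborel qh) + W2sq (density lborel p2) (density lborel qh')"
  let ?W' = "W2sq (density lborel u1) (density lborel qh) + W2sq (density lborel u2) (density lborel qh')"
  have "JKO chi a b \<tau> qh qh' p1 p2 \<le> JKO chi a b \<tau> qh qh' u1 u2"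
    by (rule min) (use u mass in \<open>auto simp: admissible_def d\<close>)
  moreover have "Energy chi a b p1 p2 = enn2ereal (total_energy chi s) + ?c"
    by (rule Energy_cong) (use p s_out in auto)
  moreover have "Energy chi a b u1 u2 = enn2ereal (total_energy chi t) + ?c"
    by (rule Energy_cong) (use u t in auto)
  ultimately have le: "?W / ennreal (2 * \<tau>) + total_energy chi s
      \<le> ?W' / ennreal (2 * \<tau>) + total_energy chi t"
    unfolding JKO_def d by (intro enn2ereal_add_le_cancel) simp
  have "cost \<le> ?W"
  proof (rule W2sq_sum_ge)
    show "qh \<in> borel_measurable borel" "qh' \<in> borel_measurable borel" unfolding qh_def qh'_def by measurable
    show "0 \<le> qh x" "0 \<le> qh' x" "qh x + qh' x = h x" for x
      using q[of x] h_nonneg[of x] unfolding qh_def qh'_def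
      by (auto intro!: mult_nonneg_nonneg) (simp add: algebra_simps)
  qed (use p in auto)
  then have "cost / ennreal (2 * \<tau>)
      + total_energy chi s
      \<le> ?W / ennreal (2 * \<tau>) + total_energy chi s"
    by (intro add_mono divide_right_mono_ennreal) auto
  also note le
  also have "?W' / ennreal (2 * \<tau>) + total_energy chi t
      \<le> plan_cost \<Gamma> / ennreal (2 * \<tau>) + total_energy chi t"
    using W by (intro add_mono divide_right_mono_ennreal) auto
  finally show ?thesis .
qed

lemma measurable_restrict_interval:
  fixes f :: "real \<Rightarrow> real" and a b :: real
  assumes "f \<in> borel_measurable (restrict_space borel {a..b})"
  shows "(\<lambda>x. if x \<in> {a<..<b} then f x else 0) \<in> borel_measurable borel"
proof -
  have [measurable]: "(\<lambda>x. indicator {a..b} x *\<^sub>R f x) \<in> borel_measurable borel"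
    using assms by (simp add: borel_measurable_restrict_space_iff)
  have "(\<lambda>x. if x \<in> {a<..<b} then f x else 0) = (\<lambda>x. indicator {a<..<b} x * (indicator {a..b} x *\<^sub>R f x))"
    by (intro ext) (auto simp: indicator_def)
  also have "\<dots> \<in> borel_measurable borel" by measurable
  finally show ?thesis .
qed

lemma jko_stepI:
  fixes a b \<tau> M :: real and chi sg sh rh \<rho> \<eta> Tm :: "real \<Rightarrow> real"
  defines "s \<equiv> \<lambda>x. if x \<in> {a<..<b} then sg x else 0" and "h \<equiv> \<lambda>x. if x \<in> {a<..<b} then sh x else 0"
  assumes ab: "a < b" and tau: "0 < \<tau>" and chi: "internal_energy_density chi" and M: "0 < M"
    and sh: "sh \<in> borel_measurable (restrict_space borel {a..b})" "\<And>x. x \<in> {a..b} \<Longrightarrow> 0 \<le> sh x"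
    and rh: "rh \<in> borel_measurable (restrict_space borel {a..b})" "\<And>x. x \<in> {a..b} \<Longrightarrow> 0 \<le> rh x \<and> rh x \<le> 1"
    and h_le: "AE x\<in>{a<..<b} in lborel. sh x \<le> M"
    and adm: "admissible a b (emeasure (dens a b (\<lambda>x. rh x * sh x)) UNIV) \<rho>"
      "admissible a b (emeasure (dens a b (\<lambda>x. (1 - rh x) * sh x)) UNIV) \<eta>"
    and min: "\<And>\<rho>' \<eta>'. admissible a b (emeasure (dens a b (\<lambda>x. rh x * sh x)) UNIV) \<rho>' \<Longrightarrow>
        admissible a b (emeasure (dens a b (\<lambda>x. (1 - rh x) * sh x)) UNIV) \<eta>' \<Longrightarrow>
        JKO chi a b \<tau> (\<lambda>x. rh x * sh x) (\<lambda>x. (1 - rh x) * sh x) \<rho> \<eta>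
          \<le> JKO chi a b \<tau> (\<lambda>x. rh x * sh x) (\<lambda>x. (1 - rh x) * sh x) \<rho>' \<eta>'"
    and sg: "\<And>x. x \<in> {a..b} \<Longrightarrow> sg x = \<rho> x + \<eta> x"
    and Tm: "Tm \<in> borel_measurable lborel" "mono_on {a..b} Tm" "Tm ` {a..b} \<subseteq> {a..b}"
    and push: "distr (dens a b sg) lborel Tm = dens a b sh"
  shows "jko_step a b (\<lambda>x. Tm (max a (min b x))) s h chi \<tau> M"
proof -
  define T where "T x = Tm (max a (min b x))" for x
  define q where "q x = (if x \<in> {a<..<b} then rh x else 0)" for x
  define p1 where "p1 x = (if x \<in> {a<..<b} then \<rho> x else 0)" for x
  define p2 where "p2 x = (if x \<in> {a<..<b} then \<eta> x else 0)" for x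
  have [measurable]: "\<rho> \<in> borel_measurable borel" "\<eta> \<in> borel_measurable borel"
    using adm by (auto simp: admissible_def)
  have nn: "0 \<le> \<rho> x" "0 \<le> \<eta> x" if "x \<in> {a..b}" for x using adm that by (auto simp: admissible_def)
  have [measurable]: "p1 \<in> borel_measurable borel" "p2 \<in> borel_measurable borel"
    unfolding p1_def[abs_def] p2_def[abs_def] by measurable
  have p: "0 \<le> p1 x" "0 \<le> p2 x" "p1 x + p2 x = s x" for x
    using nn[of x] sg[of x] by (auto simp: p1_def p2_def s_def)
  have s_eq: "s = (\<lambda>x. p1 x + p2 x)" using p by auto
  have [measurable]: "s \<in> borel_measurable borel" unfolding s_eq by measurable
  have [measurable]: "h \<in> borel_measurable borel"
    unfolding h_def by (rule measurable_restrict_interval[OF sh(1)])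
  have [measurable]: "q \<in> borel_measurable borel"
    unfolding q_def[abs_def] by (rule measurable_restrict_interval[OF rh(1)])
  have h: "0 \<le> h x" for x using sh(2)[of x] by (auto simp: h_def)
  have h_le': "AE x in lborel. h x \<le> M"
    using h_le by eventually_elim (use M in \<open>auto simp: h_def\<close>)
  have q: "0 \<le> q x" "q x \<le> 1" for x using rh(2)[of x] by (auto simp: q_def)
  have clamp: "max a (min b x) \<in> {a..b}" for x using ab by auto
  have clamp_id: "max a (min b x) = x" if "x \<in> {a<..<b}" for x using that by auto
  have T_mono: "mono T"
    unfolding T_def mono_def using Tm(2) clamp by (auto intro!: mono_onD[OF Tm(2)] simp: max_def min_def)
  have "T x \<in> {a..b}" for x unfolding T_def by (rule subsetD[OF Tm(3)]) (rule imageI[OF clamp])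
  then have T_range: "a \<le> T x" "T x \<le> b" for x by auto
  have T_meas [measurable]: "T \<in> borel_measurable borel" by (rule borel_measurable_mono[OF T_mono])
  have ds: "dens a b sg = density lborel s" and dh: "dens a b sh = density lborel h"
    by (simp_all add: dens_eq_density s_def h_def)
  have push': "distr (density lborel s) lborel T = density lborel h"
  proof -
    have [measurable]: "Tm \<in> borel_measurable borel" using Tm(1) by simp
    have "distr (density lborel s) lborel T = distr (density lborel s) lborel Tm"
    proof (rule measure_eqI)
      fix A assume "A \<in> sets (distr (density lborel s) lborel T)"
      then have [measurable]: "A \<in> sets borel" by simp
      have "emeasure (distr (density lborel s) lborel T) A = (\<integral>\<^sup>+x. indicator A (T x) \<partial>density lborel s)"
        by (subst nn_integral_indicator[symmetric], simp, subst nn_integral_distr) auto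
      also have "\<dots> = (\<integral>\<^sup>+x. indicator A (Tm x) \<partial>density lborel s)"
      proof -
        have "ennreal (s x) * indicator A (T x) = ennreal (s x) * indicator A (Tm x)" for x
          by (cases "x \<in> {a<..<b}") (simp_all add: T_def clamp_id s_def del: greaterThanLessThan_iff)
        then show ?thesis by (simp add: nn_integral_density)
      qed
      also have "\<dots> = emeasure (distr (density lborel s) lborel Tm) A"
        by (subst nn_integral_indicator[symmetric], simp, subst nn_integral_distr) auto
      finally show "emeasure (distr (density lborel s) lborel T) A = emeasure (distr (density lborel s) lborel Tm) A" .
    qed simp
    then show ?thesis using push unfolding ds dh by simp
  qed
  have s_fin: "(\<integral>\<^sup>+x. ennreal (s x) \<partial>lborel) < \<infinity>"
  proof -
    have "emeasure (distr (density lborel s) lborel T) UNIV = emeasure (density lborel h) UNIV"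
      by (simp add: push')
    then have "(\<integral>\<^sup>+x. ennreal (s x) \<partial>lborel) = (\<integral>\<^sup>+x. ennreal (h x) \<partial>lborel)"
      by (simp add: emeasure_distr emeasure_density)
    also have "\<dots> \<le> (\<integral>\<^sup>+x. ennreal M * indicator {a<..<b} x \<partial>lborel)"
      using h_le' by (intro nn_integral_mono_AE, eventually_elim) (auto simp: h_def indicator_def intro!: ennreal_leI)
    also have "\<dots> < \<infinity>" using ab by (simp add: nn_integral_cmult ennreal_mult_less_top)
    finally show ?thesis .
  qed
  have s_nonneg: "0 \<le> s x" for x using p[of x] by simp
  have s_out: "s x = 0" and h_out: "h x = 0" if "x \<notin> {a<..<b}" for x
    using that by (auto simp: s_def h_def)
  interpret transport a b T s h
  proof unfold_locales
    show "s \<in> borel_measurable borel" "h \<in> borel_measurable borel" by measurable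
  qed (fact ab T_mono T_range s_nonneg h s_out h_out push' s_fin)+
  have eq1: "dens a b (\<lambda>x. rh x * sh x) = dens a b (\<lambda>x. q x * h x)"
    "dens a b (\<lambda>x. (1 - rh x) * sh x) = dens a b (\<lambda>x. (1 - q x) * h x)"
    "dens a b \<rho> = dens a b p1" "dens a b \<eta> = dens a b p2"
    by (auto intro!: dens_cong simp: q_def h_def p1_def p2_def)
  have JKO_eq: "JKO chi a b \<tau> (\<lambda>x. rh x * sh x) (\<lambda>x. (1 - rh x) * sh x) \<rho>' \<eta>'
      = JKO chi a b \<tau> (\<lambda>x. q x * h x) (\<lambda>x. (1 - q x) * h x) \<rho>' \<eta>'" for \<rho>' \<eta>'
    by (simp only: JKO_def eq1)
  have "Energy chi a b \<rho> \<eta> = Energy chi a b p1 p2"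
  proof -
    have "Energy chi a b \<rho> \<eta> = enn2ereal (total_energy chi s) + ereal (chi 0 * (b - a))"
      by (rule Energy_cong) (auto simp: s_def sg)
    moreover have "Energy chi a b p1 p2 = enn2ereal (total_energy chi s) + ereal (chi 0 * (b - a))"
      by (rule Energy_cong) (use p in \<open>auto simp: s_def\<close>)
    ultimately show ?thesis by simp
  qed
  then have JKO_eq2: "JKO chi a b \<tau> (\<lambda>x. q x * h x) (\<lambda>x. (1 - q x) * h x) \<rho> \<eta>
      = JKO chi a b \<tau> (\<lambda>x. q x * h x) (\<lambda>x. (1 - q x) * h x) p1 p2"
    by (simp only: JKO_def eq1)
  have min': "JKO chi a b \<tau> (\<lambda>x. q x * h x) (\<lambda>x. (1 - q x) * h x) p1 p2
      \<le> JKO chi a b \<tau> (\<lambda>x. q x * h x) (\<lambda>x. (1 - q x) * h x) \<rho>' \<eta>'"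
    if "admissible a b (emeasure (dens a b (\<lambda>x. q x * h x)) UNIV) \<rho>'"
       "admissible a b (emeasure (dens a b (\<lambda>x. (1 - q x) * h x)) UNIV) \<eta>'" for \<rho>' \<eta>'
    using min[of \<rho>' \<eta>'] that by (simp only: eq1 JKO_eq JKO_eq2)
  have "jko_step a b T s h chi \<tau> M"
  proof unfold_locales
    show "internal_energy_density chi" "0 < \<tau>" "0 < M" "AE x in lborel. h x \<le> M"
      using chi tau M h_le' by auto
    fix \<Gamma> and t :: "real \<Rightarrow> real" assume "t \<in> borel_measurable borel" "\<And>x. 0 \<le> t x" "\<And>x. x \<notin> {a<..<b} \<Longrightarrow> t x = 0"
      and "\<Gamma> \<in> couplings (density lborel t) (density lborel h)"
    then show "cost / ennreal (2 * \<tau>)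
        + total_energy chi s
      \<le> plan_cost \<Gamma> / ennreal (2 * \<tau>)
        + total_energy chi t"
      by (intro one_species_minimal[of q p1 p2] min') (use q p in auto)
  qed
  then show ?thesis by (simp only: T_def[abs_def])
qed

lemma (in energy_density) entropy_increment:
  assumes "0 \<le> x" "0 \<le> y" "y \<le> M" "x \<le> e * y" "y \<le> e * x" "1 \<le> e"
  shows "entropy y - entropy x \<le> (dchi 1 + \<bar>M\<bar> * \<bar>kappa chi (max 1 M)\<bar>) * (e - 1)"
proof (cases "y = 0")
  case True
  then have "x = 0" using assms by simp
  then show ?thesis using True assms dchi_nonneg[of 1] by (auto intro!: mult_nonneg_nonneg add_nonneg_nonneg)
next
  case False
  then have y: "0 < y" using assms by simp
  have "y - x \<le> (e - 1) * y"
  proof (cases "x \<le> y")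
    case True
    have "y - x \<le> (e - 1) * x" using assms by (simp add: algebra_simps)
    also have "\<dots> \<le> (e - 1) * y" using True assms by (intro mult_left_mono) auto
    finally show ?thesis .
  qed (use assms in \<open>auto intro: order_trans[of _ 0]\<close>)
  moreover have "x - y \<le> (e - 1) * y" using assms by (simp add: algebra_simps)
  ultimately have "\<bar>(y - x) / y\<bar> \<le> e - 1" using y by (simp add: abs_le_iff field_simps)
  moreover have "\<bar>y * kappa chi y\<bar> \<le> dchi 1 + \<bar>M\<bar> * \<bar>kappa chi (max 1 M)\<bar>"
    by (rule kappa_times_bounded) (use assms in auto)
  ultimately have "\<bar>(y * kappa chi y) * ((y - x) / y)\<bar> \<le> (dchi 1 + \<bar>M\<bar> * \<bar>kappa chi (max 1 M)\<bar>) * (e - 1)"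
    unfolding abs_mult using dchi_nonneg[of 1] by (intro mult_mono) (auto intro!: add_nonneg_nonneg)
  moreover have "(y * kappa chi y) * ((y - x) / y) = kappa chi y * (y - x)" using y by simp
  moreover have "entropy y - entropy x \<le> kappa chi y * (y - x)"
    using entropy_tangent[OF y assms(1)] by (simp add: entropy_def[of y] algebra_simps)
  ultimately show ?thesis by linarith
qed

theorem mainTheorem12:
  fixes a b T :: real and chi :: "real \<Rightarrow> real"
    and F1 F2 G1 G2 :: "real \<Rightarrow> real \<Rightarrow> real"
    and rho0 eta0 r0 :: "real \<Rightarrow> real"
  assumes ab: "a < b" and Tpos: "0 < T"
    and chi: "internal_energy_density chi"
    and F1: "bdd_lip F1" and F2: "bdd_lip F2" and G1: "bdd_lip G1" and G2: "bdd_lip G2"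
    and G1_nonneg: "\<forall>\<eta>\<ge>0. G1 0 \<eta> \<ge> 0" and G2_nonneg: "\<forall>\<rho>\<ge>0. G2 \<rho> 0 \<ge> 0"
    and rho0: "is_BV rho0 a b" "bounded (rho0 ` {a..b})" "\<forall>x\<in>{a..b}. 0 \<le> rho0 x"
    and eta0: "is_BV eta0 a b" "bounded (eta0 ` {a..b})" "\<forall>x\<in>{a..b}. 0 \<le> eta0 x"
    and r0: "is_BV r0 a b" "\<forall>x\<in>{a..b}. 0 \<le> r0 x \<and> r0 x \<le> 1"
      "\<forall>x\<in>{a..b}. rho0 x + eta0 x > 0 \<longrightarrow> r0 x = rho0 x / (rho0 x + eta0 x)"
  shows "\<exists>C. \<forall>\<tau> (N::nat) sig r sigh rh rhoN etaN Tm.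
           0 < \<tau> \<longrightarrow> \<tau> < 1 \<longrightarrow> real N * \<tau> = T \<longrightarrow>
           splitting_scheme a b chi F1 F2 G1 G2 rho0 eta0 r0 \<tau> N sig r sigh rh rhoN etaN Tm \<longrightarrow>
           (\<exists>g :: nat \<Rightarrow> real \<Rightarrow> real.
              (\<forall>n\<in>{1..N}. weak_deriv_L2 a b (\<lambda>x. chi1 chi (sig n x)) (g n)) \<and>
              sqrt (\<Sum>n\<in>{1..N}. \<tau> * (LINT x:{a<..<b}|lborel. (g n x)^2)) \<le> C)"
proof -
  interpret energy_density chi by unfold_locales (rule chi)
  obtain B where B: "0 < B" "\<And>u v. 0 \<le> u \<Longrightarrow> 0 \<le> v \<Longrightarrow> v \<le> 1 \<Longrightarrow> \<bar>SigmaF F1 F2 G1 G2 u v\<bar> \<le> B * u"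
    using SigmaF_bound[OF F1 F2 G1 G2] by blast
  obtain c1 where c1: "\<And>x. x \<in> {a..b} \<Longrightarrow> \<bar>rho0 x\<bar> \<le> c1"
    using rho0(2) unfolding bounded_iff real_norm_def by blast
  obtain c2 where c2: "\<And>x. x \<in> {a..b} \<Longrightarrow> \<bar>eta0 x\<bar> \<le> c2"
    using eta0(2) unfolding bounded_iff real_norm_def by blast
  define M0 where "M0 = \<bar>c1\<bar> + \<bar>c2\<bar> + 1"
  define M where "M = M0 * exp (B * T)"
  define K where "K = dchi 1 + \<bar>M\<bar> * \<bar>kappa chi (max 1 M)\<bar>"
  define C where "C = 2 * ((b - a) * (K + dchi M)) + (b - a) * K * (B * exp B) * T"
  have M0: "0 < M0" by (simp add: M0_def)
  have M: "0 < M" using M0 by (simp add: M_def)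
  have K: "0 \<le> K" unfolding K_def using dchi_nonneg[of 1] by (auto intro!: add_nonneg_nonneg)
  define I where "I f x = (if x \<in> {a<..<b} then f x else 0)" for f :: "real \<Rightarrow> real" and x :: real
  show ?thesis
  proof (intro exI[of _ "sqrt C"] allI impI)
    fix \<tau> N sig r sigh rh rhoN etaN Tm
    assume tau: "0 < \<tau>" "\<tau> < 1" and NT: "real N * \<tau> = T"
      and scheme: "splitting_scheme a b chi F1 F2 G1 G2 rho0 eta0 r0 \<tau> N sig r sigh rh rhoN etaN Tm"
    have init: "sig 0 x = rho0 x + eta0 x" "r 0 x = r0 x" if "x \<in> {a..b}" for x
      using scheme that by (auto simp: splitting_scheme_def)
    have react: "\<exists>s q. reaction_sol (SigmaF F1 F2 G1 G2) (RF F1 F2 G1 G2) \<tau> (sig n x) (r n x) s q \<and>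
         sigh n x = s \<tau> \<and> rh n x = q \<tau>" if "n < N" "x \<in> {a..b}" for n x
      using scheme that unfolding splitting_scheme_def by blast
    define e where "e = exp (B * \<tau>)"
    have e1: "1 \<le> e" using B tau by (simp add: e_def)
    have react': "0 \<le> sig n x" "0 \<le> sigh n x" "0 \<le> rh n x \<and> rh n x \<le> 1" "sigh n x \<le> e * sig n x" "sig n x \<le> e * sigh n x"
      if nx: "n < N" "x \<in> {a..b}" for n x
    proof -
      obtain s q where sol: "reaction_sol (SigmaF F1 F2 G1 G2) (RF F1 F2 G1 G2) \<tau> (sig n x) (r n x) s q"
        "sigh n x = s \<tau>" "rh n x = q \<tau>" using react[OF nx] by blast
      show "sigh n x \<le> e * sig n x" "sig n x \<le> e * sigh n x"
        using reaction_sol_growth[OF sol(1), of \<tau> B] tau B sol(2) by (auto simp: e_def)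
      show "0 \<le> sig n x" "0 \<le> sigh n x" "0 \<le> rh n x \<and> rh n x \<le> 1"
        using sol(1)[unfolded reaction_sol_def, THEN conjunct2, THEN conjunct2, THEN bspec, of 0]
          sol(1)[unfolded reaction_sol_def, THEN conjunct2, THEN conjunct2, THEN bspec, of \<tau>]
          sol(1)[unfolded reaction_sol_def, THEN conjunct1] sol(2,3) tau by auto
    qed
    have diffusion: "admissible a b (emeasure (dens a b (\<lambda>x. rh n x * sigh n x)) UNIV) (rhoN (Suc n))"
      "admissible a b (emeasure (dens a b (\<lambda>x. (1 - rh n x) * sigh n x)) UNIV) (etaN (Suc n))"
      "\<And>\<rho> \<eta>. admissible a b (emeasure (dens a b (\<lambda>x. rh n x * sigh n x)) UNIV) \<rho> \<Longrightarrow>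
        admissible a b (emeasure (dens a b (\<lambda>x. (1 - rh n x) * sigh n x)) UNIV) \<eta> \<Longrightarrow>
        JKO chi a b \<tau> (\<lambda>x. rh n x * sigh n x) (\<lambda>x. (1 - rh n x) * sigh n x) (rhoN (Suc n)) (etaN (Suc n))
          \<le> JKO chi a b \<tau> (\<lambda>x. rh n x * sigh n x) (\<lambda>x. (1 - rh n x) * sigh n x) \<rho> \<eta>"
      "\<And>x. x \<in> {a..b} \<Longrightarrow> sig (Suc n) x = rhoN (Suc n) x + etaN (Suc n) x"
      "Tm n \<in> borel_measurable lborel" "mono_on {a..b} (Tm n)" "Tm n ` {a..b} \<subseteq> {a..b}"
      "distr (dens a b (sig (Suc n))) lborel (Tm n) = dens a b (sigh n)"
      "\<And>x. x \<in> {a..b} \<Longrightarrow> r (Suc n) x = rh n (Tm n x)" if "n < N" for n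
      using scheme that unfolding splitting_scheme_def Let_def by simp_all
    define Mn where "Mn n = M0 * exp (B * (real n * \<tau>))" for n
    have Mn_pos: "0 < Mn n" for n using M0 by (simp add: Mn_def)
    have Mn_Suc: "e * Mn n = Mn (Suc n)" for n by (simp add: Mn_def e_def exp_add[symmetric] algebra_simps)
    have Mn_le: "Mn n \<le> M" if "n \<le> N" for n
    proof -
      have "real n * \<tau> \<le> T" using that tau NT by (metis mult_right_mono of_nat_le_iff less_imp_le)
      then show ?thesis using M0 B by (simp add: Mn_def M_def)
    qed
    let ?X = "restrict_space borel {a..b} :: real measure"
    have half: "sigh n \<in> borel_measurable ?X \<and> rh n \<in> borel_measurable ?X"
      if "n < N" "sig n \<in> borel_measurable ?X" "r n \<in> borel_measurable ?X" for n
      using reaction_step_measurable[OF F1 F2 G1 G2 less_imp_le[OF tau(1)] that(2,3) react[OF that(1)]] by blast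
    have half_le: "AE x\<in>{a<..<b} in lborel. sigh n x \<le> Mn (Suc n)"
      if "n < N" "AE x\<in>{a<..<b} in lborel. sig n x \<le> Mn n" for n
      using that(2)
    proof eventually_elim
      case (elim x)
      show ?case
      proof
        assume x: "x \<in> {a<..<b}"
        have "sigh n x \<le> e * sig n x" using react'(4)[OF that(1), of x] x by simp
        also have "\<dots> \<le> e * Mn n" using elim x e1 by simp
        finally show "sigh n x \<le> Mn (Suc n)" by (simp add: Mn_Suc)
      qed
    qed
    have step: "jko_step a b (\<lambda>x. Tm n (max a (min b x))) (I (sig (Suc n))) (I (sigh n)) chi \<tau> (Mn (Suc n))"
      if n: "n < N" and meas: "sig n \<in> borel_measurable ?X" "r n \<in> borel_measurable ?X"
        and le: "AE x\<in>{a<..<b} in lborel. sig n x \<le> Mn n" for n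
      unfolding I_def
      by (rule jko_stepI[where rh="rh n" and \<rho>="rhoN (Suc n)" and \<eta>="etaN (Suc n)"])
        (use ab tau chi Mn_pos half[OF n meas] react'[OF n] half_le[OF n le] diffusion[OF n] in auto)
    have invariant: "sig n \<in> borel_measurable ?X \<and> r n \<in> borel_measurable ?X \<and>
        (AE x\<in>{a<..<b} in lborel. sig n x \<le> Mn n)" if "n \<le> N" for n
      using that
    proof (induction n)
      case 0
      have "(\<lambda>x. rho0 x + eta0 x) \<in> borel_measurable ?X"
        by (intro borel_measurable_add is_BV_measurable rho0 eta0 ab)
      then have "sig 0 \<in> borel_measurable ?X"
        by (rule measurable_cong[THEN iffD1, rotated]) (use init in \<open>auto simp: space_restrict_space\<close>)
      moreover have "r0 \<in> borel_measurable ?X"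
        by (intro is_BV_measurable r0 ab)
      then have "r 0 \<in> borel_measurable ?X"
        by (rule measurable_cong[THEN iffD1, rotated]) (use init in \<open>auto simp: space_restrict_space\<close>)
      moreover have "sig 0 x \<le> Mn 0" if "x \<in> {a<..<b}" for x
        using c1[of x] c2[of x] that init(1)[of x] by (simp add: Mn_def M0_def)
      ultimately show ?case by simp
    next
      case (Suc n)
      then have n: "n < N" and meas: "sig n \<in> borel_measurable ?X" "r n \<in> borel_measurable ?X"
        and le: "AE x\<in>{a<..<b} in lborel. sig n x \<le> Mn n" by auto
      interpret st: jko_step a b "\<lambda>x. Tm n (max a (min b x))" "I (sig (Suc n))" "I (sigh n)" chi \<tau> "Mn (Suc n)"
        by (rule step[OF n meas le])
      have "(\<lambda>x. rhoN (Suc n) x + etaN (Suc n) x) \<in> borel_measurable ?X"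
        using diffusion(1,2)[OF n] by (intro borel_measurable_add measurable_restrict_space1) (auto simp: admissible_def)
      then have "sig (Suc n) \<in> borel_measurable ?X"
        by (rule measurable_cong[THEN iffD1, rotated]) (use diffusion(4)[OF n] in \<open>auto simp: space_restrict_space\<close>)
      moreover have "Tm n \<in> ?X \<rightarrow>\<^sub>M ?X"
        using diffusion(5,7)[OF n] by (intro measurable_restrict_space3) (simp, blast)
      then have "(\<lambda>x. rh n (Tm n x)) \<in> borel_measurable ?X"
        using half[OF n meas] measurable_compose by blast
      then have "r (Suc n) \<in> borel_measurable ?X"
        by (rule measurable_cong[THEN iffD1, rotated]) (use diffusion(9)[OF n] in \<open>auto simp: space_restrict_space\<close>)
      moreover have "AE x\<in>{a<..<b} in lborel. sig (Suc n) x \<le> Mn (Suc n)"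
        using st.s_le by eventually_elim (auto simp: I_def)
      ultimately show ?case by blast
    qed
    define A where "A n = (\<integral>x. entropy (I (sig n) x) \<partial>lborel)" for n
    define H where "H n = (\<integral>x. entropy (I (sigh n) x) \<partial>lborel)" for n
    have "\<exists>g. weak_deriv_L2 a b (\<lambda>x. chi1 chi (sig (Suc n) x)) g \<and>
        A (Suc n) + \<tau> * (LINT x:{a<..<b}|lborel. (g x)\<^sup>2) \<le> H n" if n: "n < N" for n
    proof -
      interpret st: jko_step a b "\<lambda>x. Tm n (max a (min b x))" "I (sig (Suc n))" "I (sigh n)" chi \<tau> "Mn (Suc n)"
        using invariant[of n] n by (intro step) auto
      show ?thesis
        using st.weak_deriv_L2_g[of "sig (Suc n)"] st.entropy_dissipation
        unfolding A_def H_def by (intro exI[of _ st.g]) (auto simp: I_def[abs_def])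
    qed
    then obtain g where g: "\<And>n. n < N \<Longrightarrow> weak_deriv_L2 a b (\<lambda>x. chi1 chi (sig (Suc n) x)) (g n)"
      "\<And>n. n < N \<Longrightarrow> A (Suc n) + \<tau> * (LINT x:{a<..<b}|lborel. (g n x)\<^sup>2) \<le> H n"
      by metis
    have sig_nonneg: "0 \<le> sig n x" if "n \<le> N" "x \<in> {a..b}" for n x
    proof (cases n)
      case 0
      then show ?thesis using init(1)[OF that(2)] rho0(3) eta0(3) that by simp
    next
      case (Suc m)
      then have "m < N" using that by simp
      then show ?thesis using diffusion(1,2,4)[of m] that Suc by (auto simp: admissible_def)
    qed
    define nice where "nice u \<longleftrightarrow> u \<in> borel_measurable ?X \<and> (\<forall>x\<in>{a..b}. 0 \<le> u x) \<and>
      (AE x\<in>{a<..<b} in lborel. u x \<le> M)" for u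
    have I_le: "AE x in lborel. I u x \<le> M" if "nice u" for u
    proof -
      have "AE x\<in>{a<..<b} in lborel. u x \<le> M" using that by (simp add: nice_def)
      then show ?thesis by eventually_elim (use M in \<open>auto simp: I_def\<close>)
    qed
    have I_nonneg: "0 \<le> I u x" if "nice u" for u x using that by (auto simp: nice_def I_def)
    have int: "integrable lborel (\<lambda>x. entropy (I u x))" if "nice u" for u
    proof (rule entropy_integrable(3)[where a=a and b=b and M=M])
      show "I u \<in> borel_measurable borel"
        unfolding I_def[abs_def] using that by (intro measurable_restrict_interval) (simp add: nice_def)
    qed (use that I_nonneg I_le in \<open>auto simp: I_def\<close>)
    have nice_sig: "nice (sig n)" if "n \<le> N" for n
      unfolding nice_def
    proof (intro conjI)
      show "AE x\<in>{a<..<b} in lborel. sig n x \<le> M"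
        using invariant[OF that] Mn_le[OF that] by (auto elim!: eventually_mono)
    qed (use invariant[OF that] sig_nonneg[OF that] in auto)
    have nice_sigh: "nice (sigh n)" if "n < N" for n
      unfolding nice_def
    proof (intro conjI)
      show "AE x\<in>{a<..<b} in lborel. sigh n x \<le> M"
        using half_le[OF that] invariant[of n] Mn_le[of "Suc n"] that by (auto elim!: eventually_mono)
    qed (use half[OF that] invariant[of n] react'(2)[OF that] that in auto)
    have ind: "(\<integral>x. c * indicator {a<..<b} x \<partial>lborel) = (b - a) * c" for c :: real using ab by simp
    have ind_int: "integrable lborel (\<lambda>x. c * indicator {a<..<b} x :: real)" for c :: real using ab by simp
    have A_bound: "\<bar>A n\<bar> \<le> (b - a) * (K + dchi M)" if "n \<le> N" for n
    proof -
      have "\<bar>A n\<bar> \<le> (\<integral>x. \<bar>entropy (I (sig n) x)\<bar> \<partial>lborel)"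
        unfolding A_def by (rule integral_abs_bound)
      also have "\<dots> \<le> (\<integral>x. (K + dchi M) * indicator {a<..<b} x \<partial>lborel)"
      proof (rule integral_mono_AE)
        show "AE x in lborel. \<bar>entropy (I (sig n) x)\<bar> \<le> (K + dchi M) * indicator {a<..<b} x"
          using I_le[OF nice_sig[OF that]]
        proof eventually_elim
          case (elim x)
          show ?case
          proof (cases "x \<in> {a<..<b}")
            case True
            have "\<bar>I (sig n) x * kappa chi (I (sig n) x)\<bar> \<le> K"
              unfolding K_def by (rule kappa_times_bounded) (use I_nonneg[OF nice_sig[OF that]] elim in auto)
            moreover have "0 \<le> dchi (I (sig n) x)" "dchi (I (sig n) x) \<le> dchi M"
              using dchi_nonneg dchi_mono I_nonneg[OF nice_sig[OF that]] elim by auto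
            ultimately show ?thesis using True by (auto simp: entropy_def)
          qed (auto simp: I_def)
        qed
      qed (intro integrable_abs int[OF nice_sig[OF that]] ind_int)+
      finally show ?thesis by (simp only: ind)
    qed
    have H_le: "H n \<le> A n + (b - a) * K * (B * exp B) * \<tau>" if n: "n < N" for n
    proof -
      have nN: "n \<le> N" using n by simp
      have "H n \<le> (\<integral>x. entropy (I (sig n) x) + K * (e - 1) * indicator {a<..<b} x \<partial>lborel)"
        unfolding H_def
      proof (rule integral_mono_AE)
        show "AE x in lborel. entropy (I (sigh n) x) \<le> entropy (I (sig n) x) + K * (e - 1) * indicator {a<..<b} x"
          using I_le[OF nice_sigh[OF n]]
        proof eventually_elim
          case (elim x)
          show ?case
          proof (cases "x \<in> {a<..<b}")
            case True
            have "entropy (I (sigh n) x) - entropy (I (sig n) x) \<le> K * (e - 1)"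
              unfolding K_def using react'[OF n, of x] True elim e1
              by (intro entropy_increment) (auto simp: I_def)
            then show ?thesis using True by simp
          qed (auto simp: I_def)
        qed
      qed (intro int[OF nice_sigh[OF n]] Bochner_Integration.integrable_add int[OF nice_sig[OF nN]] ind_int)+
      also have "\<dots> = A n + (b - a) * (K * (e - 1))"
        unfolding A_def ind[symmetric] by (rule Bochner_Integration.integral_add[OF int[OF nice_sig[OF nN]] ind_int])
      also have "(b - a) * (K * (e - 1)) \<le> (b - a) * (K * (B * exp B * \<tau>))"
      proof (intro mult_left_mono)
        have "1 - B * \<tau> \<le> exp (- (B * \<tau>))" using exp_ge_add_one_self[of "- (B * \<tau>)"] by simp
        then have "e * (1 - B * \<tau>) \<le> e * exp (- (B * \<tau>))" using e1 by (intro mult_left_mono) auto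
        also have "\<dots> = 1" by (simp add: e_def exp_minus)
        finally have "e - 1 \<le> e * (B * \<tau>)" by (simp add: algebra_simps)
        also have "\<dots> \<le> exp B * (B * \<tau>)"
          using B tau by (intro mult_right_mono) (auto simp: e_def)
        finally show "e - 1 \<le> B * exp B * \<tau>" by (simp add: ac_simps)
      qed (use K ab in auto)
      finally show ?thesis by (simp add: ac_simps)
    qed
    have "(\<Sum>n<m. \<tau> * (LINT x:{a<..<b}|lborel. (g n x)\<^sup>2)) \<le> A 0 - A m + real m * ((b - a) * K * (B * exp B) * \<tau>)"
      if "m \<le> N" for m
      using that
    proof (induction m)
      case (Suc m)
      then have "m < N" by simp
      from g(2)[OF this] H_le[OF this] Suc show ?case by (simp add: algebra_simps)
    qed simp
    from this[of N] have "(\<Sum>n<N. \<tau> * (LINT x:{a<..<b}|lborel. (g n x)\<^sup>2)) \<le> A 0 - A N + (b - a) * K * (B * exp B) * (real N * \<tau>)"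
      by (simp add: ac_simps)
    also have "\<dots> \<le> C"
      using A_bound[of 0] A_bound[of N] unfolding NT C_def by auto
    finally have "(\<Sum>n<N. \<tau> * (LINT x:{a<..<b}|lborel. (g n x)\<^sup>2)) \<le> C" .
    moreover have "(\<Sum>n\<in>{1..N}. \<tau> * (LINT x:{a<..<b}|lborel. (g (n - 1) x)\<^sup>2)) = (\<Sum>n<N. \<tau> * (LINT x:{a<..<b}|lborel. (g n x)\<^sup>2))"
      by (rule sum.reindex_bij_witness[of _ Suc "\<lambda>n. n - 1"]) auto
    ultimately have "sqrt (\<Sum>n\<in>{1..N}. \<tau> * (LINT x:{a<..<b}|lborel. (g (n - 1) x)^2)) \<le> sqrt C"
      by simp
    moreover have "\<forall>n\<in>{1..N}. weak_deriv_L2 a b (\<lambda>x. chi1 chi (sig n x)) (g (n - 1))"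
    proof
      fix n assume "n \<in> {1..N}"
      then have "n - 1 < N" "Suc (n - 1) = n" by auto
      then show "weak_deriv_L2 a b (\<lambda>x. chi1 chi (sig n x)) (g (n - 1))" using g(1)[of "n - 1"] by simp
    qed
    ultimately show "\<exists>g. (\<forall>n\<in>{1..N}. weak_deriv_L2 a b (\<lambda>x. chi1 chi (sig n x)) (g n)) \<and>
        sqrt (\<Sum>n\<in>{1..N}. \<tau> * (LINT x:{a<..<b}|lborel. (g n x)^2)) \<le> sqrt C"
      by (intro exI[of _ "\<lambda>n. g (n - 1)"] conjI)
  qed
qed

end
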